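(* Let $f\in L^\infty(0,\infty;H^{-1}(\Omega))$ and $u_0\in L^2(\Omega)$, and let $u$ be the weak solution of $$(u_t,v)+\left(1+\|\nabla u\|^2\right)(\nabla u,\nabla v)=(f,v)\quad\forall v\in H^1_0(\Omega),\ t>0,\qquad u(0)=u_0.$$ Then for $0<\alpha<\frac{\lambda_1}{2}$ and all $t>0$, with $\beta=1-\frac{2\alpha}{\lambda_1}>0$, $$\|u(t)\|^2+\beta e^{-2\alpha t}\int_0^te^{2\alpha s}\|\nabla u(s)\|^2ds+2e^{-2\alpha t}\int_0^te^{2\alpha s}\|\nabla u(s)\|^4ds\le e^{-2\alpha t}\|u_0\|^2+\frac{1}{2\alpha}\|f\|^2_{L^\infty(H^{-1})}(1-e^{-2\alpha t})\le\|u_0\|^2+\frac1{2\alpha}\|f\|^2_{L^\infty(H^{-1})}.$$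
   Context: $\Omega\subset\mathbb{R}^d$ ($d=2$ or $3$) is a bounded convex polygonal or polyhedral domain; $\|\cdot\|$ is the $L^2(\Omega)$-norm and $(\cdot,\cdot)$ the $L^2$ inner product, also used for the duality between $H^{-1}(\Omega)$ and $H^1_0(\Omega)$. $H^{-1}(\Omega)$ carries the norm dual to $\|\nabla\cdot\|$ on $H^1_0(\Omega)$. $\lambda_1>0$ is the smallest eigenvalue of $-\Delta$ with homogeneous Dirichlet boundary condition. A weak solution is taken in the natural class $u\in C([0,\infty);L^2(\Omega))\cap L^4_{loc}([0,\infty);H^1_0(\Omega))$ with $u_t\in L^{4/3}_{loc}([0,\infty);H^{-1}(\Omega))$. *)

theory Defs
  imports "HOL-Analysis.Analysis" "HOL-Probability.Essential_Supremum"
begin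

definition convex_polyhedral_domain :: "'a::euclidean_space set \<Rightarrow> bool" where
  "convex_polyhedral_domain \<Omega> \<longleftrightarrow>
     open \<Omega> \<and> \<Omega> \<noteq> {} \<and> bounded \<Omega> \<and> convex \<Omega> \<and> polytope (closure \<Omega>)"


section \<open>Lebesgue and Sobolev spaces on a domain\<close>

text \<open>
  Elements of the function spaces are represented by functions on the whole space of which
  only the values on \<open>\<Omega>\<close> matter; functions that agree almost everywhere on \<open>\<Omega>\<close> represent
  the same element, so the norms below are seminorms on representatives.
\<close>

definition L2 :: "'a::euclidean_space set \<Rightarrow> ('a \<Rightarrow> 'b::euclidean_space) set" where
  "L2 \<Omega> = {v. v \<in> borel_measurable (lebesgue_on \<Omega>) \<and>
              integrable (lebesgue_on \<Omega>) (\<lambda>x. (norm (v x))\<^sup>2)}"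

definition l2inner :: "'a::euclidean_space set \<Rightarrow> ('a \<Rightarrow> 'b::euclidean_space) \<Rightarrow> ('a \<Rightarrow> 'b) \<Rightarrow> real" where
  "l2inner \<Omega> v w = (LINT x|lebesgue_on \<Omega>. v x \<bullet> w x)"

definition l2norm :: "'a::euclidean_space set \<Rightarrow> ('a \<Rightarrow> 'b::euclidean_space) \<Rightarrow> real" where
  "l2norm \<Omega> v = sqrt (l2inner \<Omega> v v)"

text \<open>The partial derivative in direction \<open>b\<close>; meaningful only where \<open>\<phi>\<close> is differentiable.\<close>

definition partial_deriv :: "'a::euclidean_space \<Rightarrow> ('a \<Rightarrow> real) \<Rightarrow> 'a \<Rightarrow> real" where
  "partial_deriv b \<phi> = (\<lambda>x. frechet_derivative \<phi> (at x) b)"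

primrec C_k :: "nat \<Rightarrow> ('a::euclidean_space \<Rightarrow> real) \<Rightarrow> bool" where
  "C_k 0 \<phi> \<longleftrightarrow> continuous_on UNIV \<phi>"
| "C_k (Suc k) \<phi> \<longleftrightarrow>
     (\<forall>x. \<phi> differentiable (at x)) \<and> (\<forall>b\<in>Basis. C_k k (partial_deriv b \<phi>))"

text \<open>The space of smooth functions with compact support in the open set \<open>U\<close>, each extended by zero.\<close>

definition test_functions :: "'a::euclidean_space set \<Rightarrow> ('a \<Rightarrow> real) set" where
  "test_functions U = {\<phi>. (\<forall>k. C_k k \<phi>) \<and>
     compact (closure {x. \<phi> x \<noteq> 0}) \<and> closure {x. \<phi> x \<noteq> 0} \<subseteq> U}"

definition weak_gradient ::
    "'a::euclidean_space set \<Rightarrow> ('a \<Rightarrow> real) \<Rightarrow> ('a \<Rightarrow> 'a) \<Rightarrow> bool" where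
  "weak_gradient \<Omega> v g \<longleftrightarrow> g \<in> L2 \<Omega> \<and>
     (\<forall>\<phi>\<in>test_functions \<Omega>. \<forall>b\<in>Basis.
        (LINT x|lebesgue_on \<Omega>. v x * partial_deriv b \<phi> x) =
        - (LINT x|lebesgue_on \<Omega>. (g x \<bullet> b) * \<phi> x))"

definition H1 :: "'a::euclidean_space set \<Rightarrow> ('a \<Rightarrow> real) set" where
  "H1 \<Omega> = {v \<in> L2 \<Omega>. \<exists>g. weak_gradient \<Omega> v g}"

text \<open>Weak gradients are unique up to null sets, so any choice of representative will do.\<close>

definition grad :: "'a::euclidean_space set \<Rightarrow> ('a \<Rightarrow> real) \<Rightarrow> 'a \<Rightarrow> 'a" where
  "grad \<Omega> v = (SOME g. weak_gradient \<Omega> v g)"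

definition h1norm :: "'a::euclidean_space set \<Rightarrow> ('a \<Rightarrow> real) \<Rightarrow> real" where
  "h1norm \<Omega> v = sqrt ((l2norm \<Omega> v)\<^sup>2 + (l2norm \<Omega> (grad \<Omega> v))\<^sup>2)"

definition H10 :: "'a::euclidean_space set \<Rightarrow> ('a \<Rightarrow> real) set" where
  "H10 \<Omega> = {v \<in> H1 \<Omega>. \<exists>\<phi>. (\<forall>n. \<phi> n \<in> test_functions \<Omega>) \<and>
                        (\<lambda>n. h1norm \<Omega> (\<phi> n - v)) \<longlonglongrightarrow> 0}"

definition h10norm :: "'a::euclidean_space set \<Rightarrow> ('a \<Rightarrow> real) \<Rightarrow> real" where
  "h10norm \<Omega> v = l2norm \<Omega> (grad \<Omega> v)"

text \<open>
  The dual of \<open>H10\<close>. A functional is a function on all of \<^typ>\<open>'a \<Rightarrow> real\<close> of which only the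
  values on \<open>H10\<close> matter; boundedness forces it to respect almost-everywhere equality there.
  The value \<open>F v\<close> is the duality pairing of \<open>F\<close> and \<open>v\<close>.
\<close>

definition Hminus1 :: "'a::euclidean_space set \<Rightarrow> (('a \<Rightarrow> real) \<Rightarrow> real) set" where
  "Hminus1 \<Omega> = {F.
     (\<forall>v\<in>H10 \<Omega>. \<forall>w\<in>H10 \<Omega>. \<forall>a b. F (\<lambda>x. a * v x + b * w x) = a * F v + b * F w) \<and>
     (\<exists>C. \<forall>v\<in>H10 \<Omega>. \<bar>F v\<bar> \<le> C * h10norm \<Omega> v)}"

definition hm1norm :: "'a::euclidean_space set \<Rightarrow> (('a \<Rightarrow> real) \<Rightarrow> real) \<Rightarrow> real" where
  "hm1norm \<Omega> F = Sup {\<bar>F v\<bar> | v. v \<in> H10 \<Omega> \<and> h10norm \<Omega> v \<le> 1}"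

definition dirichlet_eigenvalue :: "'a::euclidean_space set \<Rightarrow> real \<Rightarrow> bool" where
  "dirichlet_eigenvalue \<Omega> \<mu> \<longleftrightarrow>
     (\<exists>w\<in>H10 \<Omega>. l2norm \<Omega> w \<noteq> 0 \<and>
        (\<forall>v\<in>H10 \<Omega>. l2inner \<Omega> (grad \<Omega> w) (grad \<Omega> v) = \<mu> * l2inner \<Omega> w v))"

definition lambda1 :: "'a::euclidean_space set \<Rightarrow> real" where
  "lambda1 \<Omega> = (LEAST \<mu>. dirichlet_eigenvalue \<Omega> \<mu>)"


section \<open>Spaces of functions of time with values in a normed space\<close>

text \<open>
  The target space is given by a set \<open>X\<close> of representatives and a seminorm \<open>N\<close> on it.
  Strong (Bochner) measurability is almost-everywhere approximability by simple functions.
\<close>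

definition strongly_measurable ::
    "real set \<Rightarrow> 'v::minus set \<Rightarrow> ('v \<Rightarrow> real) \<Rightarrow> (real \<Rightarrow> 'v) \<Rightarrow> bool" where
  "strongly_measurable J X N F \<longleftrightarrow>
     (AE t in lebesgue_on J. F t \<in> X) \<and>
     (\<exists>s. (\<forall>n. simple_function (lebesgue_on J) (s n) \<and> (\<forall>t\<in>J. s n t \<in> X)) \<and>
          (AE t in lebesgue_on J. (\<lambda>n. N (s n t - F t)) \<longlonglongrightarrow> 0))"

definition bochner_Lp ::
    "real \<Rightarrow> real set \<Rightarrow> 'v::minus set \<Rightarrow> ('v \<Rightarrow> real) \<Rightarrow> (real \<Rightarrow> 'v) set" where
  "bochner_Lp p J X N =
     {F. strongly_measurable J X N F \<and> integrable (lebesgue_on J) (\<lambda>t. N (F t) powr p)}"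

definition bochner_Lp_loc ::
    "real \<Rightarrow> 'v::minus set \<Rightarrow> ('v \<Rightarrow> real) \<Rightarrow> (real \<Rightarrow> 'v) set" where
  "bochner_Lp_loc p X N = {F. \<forall>T>0. F \<in> bochner_Lp p {0<..<T} X N}"

definition bochner_Linf ::
    "real set \<Rightarrow> 'v::minus set \<Rightarrow> ('v \<Rightarrow> real) \<Rightarrow> (real \<Rightarrow> 'v) set" where
  "bochner_Linf J X N =
     {F. strongly_measurable J X N F \<and> esssup (lebesgue_on J) (\<lambda>t. ereal (N (F t))) < \<infinity>}"

definition linf_norm :: "real set \<Rightarrow> ('v \<Rightarrow> real) \<Rightarrow> (real \<Rightarrow> 'v) \<Rightarrow> real" where
  "linf_norm J N F = real_of_ereal (esssup (lebesgue_on J) (\<lambda>t. ereal (N (F t))))"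

definition C_time :: "'v::minus set \<Rightarrow> ('v \<Rightarrow> real) \<Rightarrow> (real \<Rightarrow> 'v) set" where
  "C_time X N = {F. \<forall>t\<ge>0. F t \<in> X \<and> ((\<lambda>s. N (F s - F t)) \<longlongrightarrow> 0) (at t within {0..})}"


section \<open>Weak solutions\<close>

text \<open>
  \<open>w\<close> is the distributional derivative of \<open>u\<close> on \<open>(0,\<infinity>)\<close> with values in \<open>Hminus1\<close>, where \<open>L2\<close> is
  embedded into \<open>Hminus1\<close> by the inner product: \<open>\<integral> \<eta>' u = - \<integral> \<eta> w\<close> for all scalar test
  functions \<open>\<eta>\<close>. Both sides are elements of \<open>Hminus1\<close>, and pairing with \<open>v\<close> commutes with the
  Bochner integral.
\<close>

definition weak_time_derivative ::
    "'a::euclidean_space set \<Rightarrow> (real \<Rightarrow> 'a \<Rightarrow> real) \<Rightarrow> (real \<Rightarrow> ('a \<Rightarrow> real) \<Rightarrow> real) \<Rightarrow> bool" where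
  "weak_time_derivative \<Omega> u w \<longleftrightarrow>
     (\<forall>\<eta>\<in>test_functions {0<..}. \<forall>v\<in>H10 \<Omega>.
        (LINT t|lebesgue_on {0<..}. deriv \<eta> t * l2inner \<Omega> (u t) v) =
        - (LINT t|lebesgue_on {0<..}. \<eta> t * w t v))"

definition weak_solution ::
    "'a::euclidean_space set \<Rightarrow> (real \<Rightarrow> ('a \<Rightarrow> real) \<Rightarrow> real) \<Rightarrow> ('a \<Rightarrow> real) \<Rightarrow>
     (real \<Rightarrow> 'a \<Rightarrow> real) \<Rightarrow> bool" where
  "weak_solution \<Omega> f u0 u \<longleftrightarrow>
     u \<in> C_time (L2 \<Omega>) (l2norm \<Omega>) \<and>
     u \<in> bochner_Lp_loc 4 (H10 \<Omega>) (h10norm \<Omega>) \<and>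
     (\<exists>ut. ut \<in> bochner_Lp_loc (4/3) (Hminus1 \<Omega>) (hm1norm \<Omega>) \<and>
           weak_time_derivative \<Omega> u ut \<and>
           (AE t in lebesgue_on {0<..}. \<forall>v\<in>H10 \<Omega>.
              ut t v + (1 + (l2norm \<Omega> (grad \<Omega> (u t)))\<^sup>2) *
                         l2inner \<Omega> (grad \<Omega> (u t)) (grad \<Omega> v) = f t v)) \<and>
     (AE x in lebesgue_on \<Omega>. u 0 x = u0 x)"

end

theory Submission
  imports Defs
begin

text \<open>
  Formally one tests the equation with \<open>u\<close>, multiplies by \<open>exp (2 * \<alpha> * t)\<close>, absorbs \<open>2 * \<alpha> * |u|\<^sup>2\<close> by the
  Poincare inequality with constant \<open>\<lambda>\<^sub>1\<close> and \<open>2 * (f, u)\<close> by Young's inequality, and integrates.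
  Two steps are not formal. The Poincare inequality with the least eigenvalue as constant needs the
  Rayleigh quotient to attain its infimum; up to a small multiple of the gradient, the \<open>L\<^sup>2\<close> norm on
  \<open>H\<^sup>1\<^sub>0\<close> is controlled by finitely many averages over balls, which makes a minimizing sequence Cauchy.
  The chain rule for \<open>|u|\<^sup>2\<close> is needed only as an inequality, and this follows from backward difference
  quotients, without Bochner integrals or mollification in time.
\<close>

section \<open>The Hilbert space \<open>L\<^sup>2\<close>\<close>

text \<open>\<open>lambda1\<close> is a \<open>LEAST\<close>, so nothing is known about it until a
  smallest eigenvalue is exhibited: a minimizer of the Rayleigh quotient is an eigenfunction by
  first variation, and every eigenvalue is itself a Rayleigh quotient. In time the obstacle is that
  the derivative is available only through pairings with a fixed element of \<open>H10\<close>,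
  while the equation has to be tested with \<open>u t\<close>. In a backward quotient at
  \<open>t\<close> the element \<open>u t\<close> is frozen and the discarded square has the
  favourable sign. The exchange costs an error that is small uniformly in the time step because the
  exponents \<open>4\<close> and \<open>4/3\<close> are conjugate. Constants:
  \<open>2 * (f, u)\<close> is at most the squared norm of \<open>f\<close> plus one copy of the
  squared gradient norm. This uses one of the two copies from linear diffusion; the Poincare
  inequality takes the fraction \<open>1 - \<beta>\<close> of the other, so \<open>\<beta>\<close>
  remains. The quartic term keeps its factor \<open>2\<close>, and \<open>1 / (2 * \<alpha>)\<close>
  comes from integrating the weight.\<close>

lemma discriminant_bound:
  fixes a b c :: real
  assumes "\<And>x. 0 \<le> a + 2 * b * x + c * x\<^sup>2" and "0 \<le> c"
  shows "b\<^sup>2 \<le> a * c"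
proof (cases "c = 0")
  case True
  have "b = 0"
  proof (rule ccontr)
    assume "b \<noteq> 0"
    \<comment> \<open>At this point the affine function takes the value \<open>-1\<close>.\<close>
    then show False
      using assms(1)[of "- (a + 1) / (2 * b)"] True by (simp add: field_simps)
  qed
  then show ?thesis using True by simp
next
  case False
  then have "0 \<le> a - b\<^sup>2 / c"
    using assms(1)[of "- b / c"] by (simp add: power2_eq_square field_simps)
  then show ?thesis using False assms(2) by (simp add: field_simps)
qed

lemma L2_measurable: "v \<in> L2 \<Omega> \<Longrightarrow> v \<in> borel_measurable (lebesgue_on \<Omega>)"
  by (simp add: L2_def)

lemma L2_integrable_norm_sq: "v \<in> L2 \<Omega> \<Longrightarrow> integrable (lebesgue_on \<Omega>) (\<lambda>x. (norm (v x))\<^sup>2)"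
  by (simp add: L2_def)

lemma L2_inner_integrable:
  assumes "v \<in> L2 \<Omega>" "w \<in> L2 \<Omega>"
  shows "integrable (lebesgue_on \<Omega>) (\<lambda>x. v x \<bullet> w x)"
proof (rule Bochner_Integration.integrable_bound)
  show "integrable (lebesgue_on \<Omega>) (\<lambda>x. (norm (v x))\<^sup>2 + (norm (w x))\<^sup>2)"
    by (intro Bochner_Integration.integrable_add L2_integrable_norm_sq assms)
  show "(\<lambda>x. v x \<bullet> w x) \<in> borel_measurable (lebesgue_on \<Omega>)"
    using assms[THEN L2_measurable] by simp
  have "\<bar>v x \<bullet> w x\<bar> \<le> (norm (v x))\<^sup>2 + (norm (w x))\<^sup>2" for x
  proof -
    have "\<bar>v x \<bullet> w x\<bar> \<le> norm (v x) * norm (w x)"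
      by (rule Cauchy_Schwarz_ineq2)
    also have "\<dots> \<le> (norm (v x))\<^sup>2 + (norm (w x))\<^sup>2"
      using zero_le_power2[of "norm (v x) - norm (w x)"]
        mult_nonneg_nonneg[OF norm_ge_zero norm_ge_zero, of "v x" "w x"] unfolding power2_diff mult.assoc by linarith
    finally show ?thesis .
  qed
  then show "AE x in lebesgue_on \<Omega>. norm (v x \<bullet> w x) \<le> norm ((norm (v x))\<^sup>2 + (norm (w x))\<^sup>2)"
    by auto
qed

lemma L2_lincomb:
  assumes "v \<in> L2 \<Omega>" "w \<in> L2 \<Omega>"
  shows "(\<lambda>x. a *\<^sub>R v x + b *\<^sub>R w x) \<in> L2 \<Omega>"
proof -
  have "(norm (a *\<^sub>R v x + b *\<^sub>R w x))\<^sup>2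
      = a\<^sup>2 * (v x \<bullet> v x) + 2 * a * b * (v x \<bullet> w x) + b\<^sup>2 * (w x \<bullet> w x)" for x
    unfolding power2_norm_eq_inner by (simp add: inner_simps inner_commute algebra_simps power2_eq_square)
  then have "integrable (lebesgue_on \<Omega>) (\<lambda>x. (norm (a *\<^sub>R v x + b *\<^sub>R w x))\<^sup>2)"
    using assms by (auto intro!: Bochner_Integration.integrable_add integrable_mult_right L2_inner_integrable)
  then show ?thesis
    using assms[THEN L2_measurable] by (simp add: L2_def)
qed

lemma L2_zero: "(\<lambda>x. 0) \<in> L2 \<Omega>"
  by (simp add: L2_def)

lemma L2_diff: "v \<in> L2 \<Omega> \<Longrightarrow> w \<in> L2 \<Omega> \<Longrightarrow> (\<lambda>x. v x - w x) \<in> L2 \<Omega>"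
  using L2_lincomb[of v \<Omega> w 1 "-1"] by simp

lemma l2inner_commute: "l2inner \<Omega> v w = l2inner \<Omega> w v"
  by (simp add: l2inner_def inner_commute)

lemma l2inner_nonneg: "0 \<le> l2inner \<Omega> v v"
  by (simp add: l2inner_def)

lemma l2norm_nonneg: "0 \<le> l2norm \<Omega> v"
  by (simp add: l2norm_def l2inner_nonneg)

lemma l2norm_sq: "(l2norm \<Omega> v)\<^sup>2 = l2inner \<Omega> v v"
  by (simp add: l2norm_def l2inner_nonneg)

lemma l2norm_sq_integral: "(l2norm \<Omega> v)\<^sup>2 = (LINT x|lebesgue_on \<Omega>. (norm (v x))\<^sup>2)"
  by (simp add: l2norm_sq l2inner_def power2_norm_eq_inner)

lemma l2inner_lincomb_left:
  assumes "v \<in> L2 \<Omega>" "w \<in> L2 \<Omega>" "z \<in> L2 \<Omega>"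
  shows "l2inner \<Omega> (\<lambda>x. a *\<^sub>R v x + b *\<^sub>R w x) z = a * l2inner \<Omega> v z + b * l2inner \<Omega> w z"
  using assms by (simp add: l2inner_def inner_add_left L2_inner_integrable)

lemma l2norm_lincomb_sq:
  assumes "v \<in> L2 \<Omega>" "w \<in> L2 \<Omega>"
  shows "(l2norm \<Omega> (\<lambda>x. a *\<^sub>R v x + b *\<^sub>R w x))\<^sup>2
     = a\<^sup>2 * (l2norm \<Omega> v)\<^sup>2 + 2 * a * b * l2inner \<Omega> v w + b\<^sup>2 * (l2norm \<Omega> w)\<^sup>2"
proof -
  let ?z = "\<lambda>x. a *\<^sub>R v x + b *\<^sub>R w x"
  have z: "?z \<in> L2 \<Omega>" by (rule L2_lincomb[OF assms])
  have "l2inner \<Omega> ?z ?z = a * l2inner \<Omega> ?z v + b * l2inner \<Omega> ?z w"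
    by (subst l2inner_lincomb_left[OF assms z]) (simp add: l2inner_commute[of \<Omega> ?z])
  also have "\<dots> = a * (a * l2inner \<Omega> v v + b * l2inner \<Omega> v w)
      + b * (a * l2inner \<Omega> v w + b * l2inner \<Omega> w w)"
    by (simp add: l2inner_lincomb_left[OF assms] assms l2inner_commute[of \<Omega> w v])
  finally show ?thesis
    unfolding l2norm_sq by (simp add: algebra_simps power2_eq_square)
qed

lemma l2inner_cong_AE:
  assumes "v \<in> L2 \<Omega>" "v' \<in> L2 \<Omega>" "w \<in> L2 \<Omega>" "w' \<in> L2 \<Omega>"
    and "AE x in lebesgue_on \<Omega>. v x = v' x" "AE x in lebesgue_on \<Omega>. w x = w' x"
  shows "l2inner \<Omega> v w = l2inner \<Omega> v' w'"
  unfolding l2inner_def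
  using assms by (intro integral_cong_AE) (auto dest!: L2_measurable)

lemma l2norm_cong_AE:
  assumes "v \<in> L2 \<Omega>" "w \<in> L2 \<Omega>" "AE x in lebesgue_on \<Omega>. v x = w x"
  shows "l2norm \<Omega> v = l2norm \<Omega> w"
  unfolding l2norm_def using assms by (simp add: l2inner_cong_AE[of v \<Omega> w v w])

lemma l2_Cauchy_Schwarz:
  assumes "v \<in> L2 \<Omega>" "w \<in> L2 \<Omega>"
  shows "\<bar>l2inner \<Omega> v w\<bar> \<le> l2norm \<Omega> v * l2norm \<Omega> w"
proof -
  have "(l2inner \<Omega> v w)\<^sup>2 \<le> (l2norm \<Omega> v)\<^sup>2 * (l2norm \<Omega> w)\<^sup>2"
  proof (rule discriminant_bound)
    fix x
    show "0 \<le> (l2norm \<Omega> v)\<^sup>2 + 2 * l2inner \<Omega> v w * x + (l2norm \<Omega> w)\<^sup>2 * x\<^sup>2"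
      using l2norm_lincomb_sq[OF assms, of 1 x]
        zero_le_power2[of "l2norm \<Omega> (\<lambda>y. 1 *\<^sub>R v y + x *\<^sub>R w y)"]
      by (simp add: mult.commute mult.left_commute)
  qed simp
  then have "\<bar>l2inner \<Omega> v w\<bar>\<^sup>2 \<le> (l2norm \<Omega> v * l2norm \<Omega> w)\<^sup>2"
    by (simp add: power_mult_distrib)
  then show ?thesis
    by (rule power2_le_imp_le) (simp_all add: power_mult_distrib l2norm_nonneg)
qed

lemma l2norm_add:
  assumes "v \<in> L2 \<Omega>" "w \<in> L2 \<Omega>"
  shows "l2norm \<Omega> (\<lambda>x. v x + w x) \<le> l2norm \<Omega> v + l2norm \<Omega> w"
proof (rule power2_le_imp_le)
  have "(l2norm \<Omega> (\<lambda>x. v x + w x))\<^sup>2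
      = (l2norm \<Omega> v)\<^sup>2 + 2 * l2inner \<Omega> v w + (l2norm \<Omega> w)\<^sup>2"
    using l2norm_lincomb_sq[OF assms, of 1 1] by simp
  then show "(l2norm \<Omega> (\<lambda>x. v x + w x))\<^sup>2 \<le> (l2norm \<Omega> v + l2norm \<Omega> w)\<^sup>2"
    using l2_Cauchy_Schwarz[OF assms] by (simp add: power2_sum)
qed (simp add: l2norm_nonneg)

lemma l2norm_scale: "l2norm \<Omega> (\<lambda>x. a *\<^sub>R v x) = \<bar>a\<bar> * l2norm \<Omega> v"
  by (simp add: l2norm_def l2inner_def real_sqrt_mult mult.assoc[symmetric])

lemma l2norm_minus_commute: "l2norm \<Omega> (\<lambda>x. v x - w x) = l2norm \<Omega> (\<lambda>x. w x - v x)"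
  by (simp add: l2norm_def l2inner_def power2_norm_eq_inner[symmetric] norm_minus_commute)

lemma l2norm_diff_triangle:
  assumes "u \<in> L2 \<Omega>" "v \<in> L2 \<Omega>" "w \<in> L2 \<Omega>"
  shows "l2norm \<Omega> (\<lambda>x. u x - w x) \<le> l2norm \<Omega> (\<lambda>x. u x - v x) + l2norm \<Omega> (\<lambda>x. v x - w x)"
  using l2norm_add[OF L2_diff[OF assms(1,2)] L2_diff[OF assms(2,3)]] by simp

lemma l2norm_diff_ge:
  assumes "v \<in> L2 \<Omega>" "w \<in> L2 \<Omega>"
  shows "\<bar>l2norm \<Omega> v - l2norm \<Omega> w\<bar> \<le> l2norm \<Omega> (\<lambda>x. v x - w x)"
  using l2norm_diff_triangle[OF assms L2_zero] l2norm_diff_triangle[OF assms(2,1) L2_zero]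
    l2norm_minus_commute[of \<Omega> v w] by (simp add: abs_le_iff)

lemma l2inner_tendsto:
  assumes "v \<in> L2 \<Omega>" "w \<in> L2 \<Omega>" "\<And>n. vs n \<in> L2 \<Omega>"
    and "((\<lambda>n. l2norm \<Omega> (\<lambda>x. vs n x - v x)) \<longlongrightarrow> 0) F"
  shows "((\<lambda>n. l2inner \<Omega> (vs n) w) \<longlongrightarrow> l2inner \<Omega> v w) F"
proof -
  have "\<bar>l2inner \<Omega> (vs n) w - l2inner \<Omega> v w\<bar> \<le> l2norm \<Omega> (\<lambda>x. vs n x - v x) * l2norm \<Omega> w" for n
    using l2_Cauchy_Schwarz[OF L2_diff[OF assms(3)[of n] assms(1)] assms(2)]
      l2inner_lincomb_left[OF assms(3)[of n] assms(1,2), of 1 "-1"] by simp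
  then have bound: "\<forall>n. norm (l2inner \<Omega> (vs n) w - l2inner \<Omega> v w)
      \<le> l2norm \<Omega> (\<lambda>x. vs n x - v x) * l2norm \<Omega> w"
    by simp
  have "((\<lambda>n. l2norm \<Omega> (\<lambda>x. vs n x - v x) * l2norm \<Omega> w) \<longlongrightarrow> 0) F"
    using tendsto_mult_right[OF assms(4), of "l2norm \<Omega> w"] by (simp only: mult_zero_left)
  from Lim_null_comparison[OF always_eventually[OF bound] this] show ?thesis by (rule LIM_zero_cancel)
qed

lemma l2norm_tendsto:
  assumes "v \<in> L2 \<Omega>" "\<And>n. vs n \<in> L2 \<Omega>"
    and "((\<lambda>n. l2norm \<Omega> (\<lambda>x. vs n x - v x)) \<longlongrightarrow> 0) F"
  shows "((\<lambda>n. l2norm \<Omega> (vs n)) \<longlongrightarrow> l2norm \<Omega> v) F"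
proof -
  have "((\<lambda>n. l2norm \<Omega> (vs n) - l2norm \<Omega> v) \<longlongrightarrow> 0) F"
    by (rule Lim_null_comparison[OF always_eventually assms(3)])
       (simp add: l2norm_diff_ge[OF assms(2,1)])
  then show ?thesis by (rule LIM_zero_cancel)
qed

text \<open>Fatou's lemma applied to the squared norms. Membership of the limit in \<open>L2\<close>
  is a conclusion and the bound is required only eventually; completeness uses it on differences
  \<open>vs n - vs (r j)\<close>, which are small only for large \<open>j\<close>.\<close>

lemma L2_Fatou:
  fixes vs :: "nat \<Rightarrow> 'a::euclidean_space \<Rightarrow> 'b::euclidean_space"
  assumes "\<And>n. vs n \<in> L2 \<Omega>" "v \<in> borel_measurable (lebesgue_on \<Omega>)"
    and "AE x in lebesgue_on \<Omega>. (\<lambda>n. vs n x) \<longlonglongrightarrow> v x"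
    and "\<forall>\<^sub>F n in sequentially. l2norm \<Omega> (vs n) \<le> C"
  shows "v \<in> L2 \<Omega>" "l2norm \<Omega> v \<le> C"
proof -
  let ?M = "lebesgue_on \<Omega>"
  have C: "0 \<le> C"
    using assms(4) l2norm_nonneg order_trans
    by (metis (mono_tags, lifting) eventually_happens trivial_limit_sequentially)
  have "(\<integral>\<^sup>+x. ennreal ((norm (v x))\<^sup>2) \<partial>?M) = (\<integral>\<^sup>+x. liminf (\<lambda>n. ennreal ((norm (vs n x))\<^sup>2)) \<partial>?M)"
  proof (rule nn_integral_cong_AE, use assms(3) in eventually_elim)
    case (elim x)
    have "(\<lambda>n. ennreal ((norm (vs n x))\<^sup>2)) \<longlonglongrightarrow> ennreal ((norm (v x))\<^sup>2)"
      by (intro tendsto_ennrealI tendsto_power tendsto_norm elim)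
    then show ?case by (rule lim_imp_Liminf[OF trivial_limit_sequentially, symmetric])
  qed
  also have "\<dots> \<le> liminf (\<lambda>n. (\<integral>\<^sup>+x. ennreal ((norm (vs n x))\<^sup>2) \<partial>?M))"
    using assms(1)[THEN L2_measurable] by (intro nn_integral_liminf) simp
  also have "\<dots> \<le> ennreal (C\<^sup>2)"
  proof (rule Liminf_le)
    show "\<forall>\<^sub>F n in sequentially. (\<integral>\<^sup>+x. ennreal ((norm (vs n x))\<^sup>2) \<partial>?M) \<le> ennreal (C\<^sup>2)"
      using assms(4)
    proof eventually_elim
      case (elim n)
      have "(\<integral>\<^sup>+x. ennreal ((norm (vs n x))\<^sup>2) \<partial>?M) = ennreal ((l2norm \<Omega> (vs n))\<^sup>2)"
        unfolding l2norm_sq_integral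
        by (intro nn_integral_eq_integral L2_integrable_norm_sq assms) simp
      also have "\<dots> \<le> ennreal (C\<^sup>2)"
        using elim by (intro ennreal_leI power_mono l2norm_nonneg)
      finally show ?case .
    qed
  qed simp
  finally have *: "(\<integral>\<^sup>+x. ennreal ((norm (v x))\<^sup>2) \<partial>?M) \<le> ennreal (C\<^sup>2)" .
  then have int: "integrable ?M (\<lambda>x. (norm (v x))\<^sup>2)"
    using assms(2) by (intro integrableI_bounded) (auto simp: le_less_trans[OF _ ennreal_less_top])
  then show v: "v \<in> L2 \<Omega>" using assms(2) by (simp add: L2_def)
  have "ennreal ((l2norm \<Omega> v)\<^sup>2) \<le> ennreal (C\<^sup>2)"
    using * unfolding l2norm_sq_integral by (subst nn_integral_eq_integral[symmetric]) (auto intro: int)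
  then show "l2norm \<Omega> v \<le> C"
    using C by (simp add: abs_le_square_iff[symmetric] l2norm_nonneg)
qed

text \<open>Along a subsequence the weighted series \<open>\<Sum> 2\<^sup>k |v\<^sub>k\<^sub>+\<^sub>1 - v\<^sub>k|\<^sup>2\<close> has finite
  integral, which forces pointwise convergence almost everywhere.\<close>

lemma L2_complete:
  fixes vs :: "nat \<Rightarrow> 'a::euclidean_space \<Rightarrow> 'b::euclidean_space"
  assumes L2: "\<And>n. vs n \<in> L2 \<Omega>"
    and Cauchy: "\<And>e. e > 0 \<Longrightarrow> \<exists>N. \<forall>m\<ge>N. \<forall>n\<ge>N. l2norm \<Omega> (\<lambda>x. vs m x - vs n x) < e"
  obtains v where "v \<in> L2 \<Omega>" "(\<lambda>n. l2norm \<Omega> (\<lambda>x. vs n x - v x)) \<longlonglongrightarrow> 0"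
proof -
  let ?M = "lebesgue_on \<Omega>"
  have "\<exists>N. \<forall>m\<ge>N. \<forall>n\<ge>N. l2norm \<Omega> (\<lambda>x. vs m x - vs n x) < (1/2)^k" for k :: nat
    by (rule Cauchy) simp
  then obtain N where N: "\<And>k m n. m \<ge> N k \<Longrightarrow> n \<ge> N k \<Longrightarrow> l2norm \<Omega> (\<lambda>x. vs m x - vs n x) < (1/2)^k"
    by metis
  \<comment> \<open>The partial sums put both \<open>r k\<close> and \<open>r (Suc k)\<close> beyond
    \<open>N k\<close>, so consecutive terms are close; the summand \<open>k\<close> drives
    \<open>r\<close> to infinity.\<close>
  define r where "r k = (\<Sum>i\<le>k. N i) + k" for k
  have r_ge: "r k \<ge> N k" "r k \<ge> k" "r (Suc k) \<ge> N k" for k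
    using member_le_sum[of k "{..k}" N] by (auto simp: r_def)
  define g where "g k x = norm (vs (r (Suc k)) x - vs (r k) x)" for k x
  have meas [measurable]: "vs n \<in> borel_measurable ?M" for n
    by (intro L2_measurable L2)
  \<comment> \<open>The squared norm of the increment is below \<open>(1/4)^k\<close>, which leaves
    room for the weight \<open>2^k\<close> while the integrals stay summable.\<close>
  have g_int: "(\<integral>\<^sup>+x. ennreal (2^k * (g k x)\<^sup>2) \<partial>?M) \<le> ennreal ((1/2)^k)" for k
  proof -
    have L: "(\<lambda>x. vs (r (Suc k)) x - vs (r k) x) \<in> L2 \<Omega>" by (intro L2_diff L2)
    have "(\<integral>\<^sup>+x. ennreal (2^k * (g k x)\<^sup>2) \<partial>?M) = ennreal (LINT x|?M. 2^k * (g k x)\<^sup>2)"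
      unfolding g_def using L2_integrable_norm_sq[OF L] by (intro nn_integral_eq_integral) auto
    also have "(LINT x|?M. 2^k * (g k x)\<^sup>2) = 2^k * (l2norm \<Omega> (\<lambda>x. vs (r (Suc k)) x - vs (r k) x))\<^sup>2"
      by (simp add: l2norm_sq_integral g_def)
    also have "\<dots> \<le> 2^k * ((1/2)^k)\<^sup>2"
      using N[OF r_ge(3) r_ge(1), of k] l2norm_nonneg by (intro mult_left_mono power_mono) (auto intro: less_imp_le)
    also have "\<dots> = (1/2)^k"
      by (simp add: power2_eq_square power_one_over)
    finally show ?thesis by (simp add: ennreal_leI)
  qed
  have "(\<integral>\<^sup>+x. (\<Sum>k. ennreal (2^k * (g k x)\<^sup>2)) \<partial>?M) = (\<Sum>k. (\<integral>\<^sup>+x. ennreal (2^k * (g k x)\<^sup>2) \<partial>?M))"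
    unfolding g_def by (intro nn_integral_suminf) simp
  also have "\<dots> \<le> (\<Sum>k. ennreal ((1/2)^k))"
    by (intro suminf_le g_int) auto
  also have "\<dots> = ennreal (\<Sum>k. (1/2)^k)"
    by (intro suminf_ennreal2) (auto intro: summable_geometric)
  finally have "(\<integral>\<^sup>+x. (\<Sum>k. ennreal (2^k * (g k x)\<^sup>2)) \<partial>?M) \<noteq> \<infinity>"
    using le_less_trans[OF _ ennreal_less_top] by (metis infinity_ennreal_def less_irrefl)
  then have AE1: "AE x in ?M. (\<Sum>k. ennreal (2^k * (g k x)\<^sup>2)) \<noteq> \<infinity>"
    unfolding g_def by (intro nn_integral_PInf_AE) auto
  have AE2: "AE x in ?M. convergent (\<lambda>k. vs (r k) x)"
    using AE1
  proof eventually_elim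
    case (elim x)
    then have "summable (\<lambda>k. 2^k * (g k x)\<^sup>2)"
      by (intro summable_suminf_not_top) auto
    then have "Bseq (\<lambda>k. 2^k * (g k x)\<^sup>2)"
      by (intro convergent_imp_Bseq) (auto dest: summable_LIMSEQ_zero simp: convergent_def)
    then obtain K where K: "K > 0" "\<And>k. \<bar>2^k * (g k x)\<^sup>2\<bar> \<le> K"
      by (auto simp: Bseq_def)
    have half_pow: "(sqrt (1/2) ^ k)\<^sup>2 = (1/2 :: real) ^ k" for k
    proof -
      have "(sqrt (1/2) ^ k)\<^sup>2 = ((sqrt (1/2))\<^sup>2) ^ k"
        by (simp only: power_mult[symmetric] mult.commute)
      then show ?thesis by simp
    qed
    \<comment> \<open>Boundedness of the weighted terms gives geometric decay of the increments with
      ratio \<open>sqrt (1/2)\<close>, and this makes them absolutely summable.\<close>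
    have "g k x \<le> sqrt K * sqrt (1/2) ^ k" for k
    proof (rule power2_le_imp_le)
      have "(g k x)\<^sup>2 = (2^k * (g k x)\<^sup>2) * (1/2)^k"
        by (simp add: power_one_over)
      also have "\<dots> \<le> K * (1/2)^k"
        using K(2)[of k] by (intro mult_right_mono) auto
      also have "\<dots> = (sqrt K * sqrt (1/2) ^ k)\<^sup>2"
        using K(1) by (simp only: power_mult_distrib half_pow) simp
      finally show "(g k x)\<^sup>2 \<le> (sqrt K * sqrt (1/2) ^ k)\<^sup>2" .
    qed (use K in auto)
    moreover have "summable (\<lambda>k. sqrt K * sqrt (1/2) ^ k)"
      by (intro summable_mult summable_geometric) (simp add: real_sqrt_divide)
    ultimately have "summable (\<lambda>k. g k x)"
      by (intro summable_comparison_test'[of "\<lambda>k. sqrt K * sqrt (1/2) ^ k" 0 "\<lambda>k. g k x"]) (auto simp: g_def)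
    then have "summable (\<lambda>k. vs (r (Suc k)) x - vs (r k) x)"
      unfolding g_def by (rule summable_norm_cancel)
    then have "convergent (\<lambda>n. \<Sum>k<n. vs (r (Suc k)) x - vs (r k) x)"
      by (simp add: summable_iff_convergent)
    then have "convergent (\<lambda>n. vs (r n) x - vs (r 0) x)"
      by (simp add: sum_lessThan_telescope[of "\<lambda>k. vs (r k) x"])
    then obtain l where "(\<lambda>n. vs (r n) x - vs (r 0) x) \<longlonglongrightarrow> l" by (auto simp: convergent_def)
    from tendsto_add[OF this tendsto_const[of "vs (r 0) x"]] show ?case
      by (auto simp: convergent_def)
  qed
  define v where "v x = lim (\<lambda>k. vs (r k) x)" for x
  have v_meas [measurable]: "v \<in> borel_measurable ?M"
    unfolding v_def by (intro borel_measurable_lim_metric) simp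
  have lim: "AE x in ?M. (\<lambda>k. vs (r k) x) \<longlonglongrightarrow> v x"
    using AE2 by eventually_elim (simp add: v_def convergent_LIMSEQ_iff)
  \<comment> \<open>In the Cauchy estimate one index runs to infinity along the subsequence and the
    other stays free, so Fatou yields convergence of the whole sequence.\<close>
  have est: "(\<lambda>x. vs n x - v x) \<in> L2 \<Omega> \<and> l2norm \<Omega> (\<lambda>x. vs n x - v x) \<le> (1/2)^k" if "n \<ge> N k" for n k
  proof -
    have 1: "(\<lambda>x. vs n x - vs (r j) x) \<in> L2 \<Omega>" for j by (intro L2_diff L2)
    have 2: "AE x in ?M. (\<lambda>j. vs n x - vs (r j) x) \<longlonglongrightarrow> vs n x - v x"
      using lim by eventually_elim (intro tendsto_diff tendsto_const)
    have 3: "\<forall>\<^sub>F j in sequentially. l2norm \<Omega> (\<lambda>x. vs n x - vs (r j) x) \<le> (1/2)^k"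
      using eventually_ge_at_top[of "N k"]
    proof eventually_elim
      case (elim j)
      then have "r j \<ge> N k" using r_ge(2)[of j] by simp
      then show ?case using N[OF that] by (simp add: less_imp_le)
    qed
    show ?thesis using L2_Fatou[OF 1 _ 2 3] by simp
  qed
  have "v = (\<lambda>x. vs (N 0) x - (vs (N 0) x - v x))" by simp
  then have "v \<in> L2 \<Omega>" using L2_diff[OF L2[of "N 0"] conjunct1[OF est[of 0 "N 0"]]] by simp
  moreover have "(\<lambda>n. l2norm \<Omega> (\<lambda>x. vs n x - v x)) \<longlonglongrightarrow> 0"
  proof (rule LIMSEQ_I)
    fix e :: real assume "e > 0"
    then obtain k where "(1/2)^k < e" using real_arch_pow_inv[of e "1/2"] by auto
    then have "\<forall>n\<ge>N k. norm (l2norm \<Omega> (\<lambda>x. vs n x - v x) - 0) < e"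
      using est[of k] by (auto simp: l2norm_nonneg intro: le_less_trans)
    then show "\<exists>no. \<forall>n\<ge>no. norm (l2norm \<Omega> (\<lambda>x. vs n x - v x) - 0) < e" by blast
  qed
  ultimately show ?thesis using that by blast
qed


section \<open>Smooth functions with compact support\<close>

lemma partial_deriv_eq:
  assumes "(\<phi> has_derivative f') (at x)"
  shows "partial_deriv b \<phi> x = f' b"
  using frechet_derivative_at[OF assms] by (simp add: partial_deriv_def)

lemma C_k_has_derivative: "C_k (Suc k) \<phi> \<Longrightarrow> (\<phi> has_derivative frechet_derivative \<phi> (at x)) (at x)"
  by (simp add: frechet_derivative_works[symmetric])

lemma C_k_Suc: "C_k (Suc k) \<phi> \<Longrightarrow> C_k k \<phi>"
proof (induction k arbitrary: \<phi>)
  case 0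
  then show ?case
    by (auto intro!: differentiable_imp_continuous_on simp: differentiable_on_def intro: differentiable_at_withinI)
next
  case (Suc k)
  then show ?case by (auto simp del: C_k.simps(1))
qed

lemma C_k_const: "C_k k (\<lambda>x. c)"
proof (induction k arbitrary: c)
  case (Suc k)
  have "partial_deriv b (\<lambda>x::'a. c) = (\<lambda>x. 0)" for b
    by (simp add: partial_deriv_def frechet_derivative_const fun_eq_iff)
  then show ?case using Suc[of 0] by simp
qed simp

lemma C_k_add: "C_k k \<phi> \<Longrightarrow> C_k k \<psi> \<Longrightarrow> C_k k (\<lambda>x. \<phi> x + \<psi> x)"
proof (induction k arbitrary: \<phi> \<psi>)
  case 0
  then show ?case by (simp add: continuous_on_add)
next
  case (Suc k)
  have "partial_deriv b (\<lambda>x. \<phi> x + \<psi> x) = (\<lambda>x. partial_deriv b \<phi> x + partial_deriv b \<psi> x)" for b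
  proof
    fix x
    show "partial_deriv b (\<lambda>x. \<phi> x + \<psi> x) x = partial_deriv b \<phi> x + partial_deriv b \<psi> x"
      using partial_deriv_eq[OF has_derivative_add[OF Suc.prems[THEN C_k_has_derivative]], of b x]
      by (simp add: partial_deriv_def)
  qed
  with Suc show ?case by (auto intro: differentiable_add)
qed

lemma partial_deriv_mult:
  assumes "\<phi> differentiable (at x)" "\<psi> differentiable (at x)"
  shows "partial_deriv b (\<lambda>x. \<phi> x * \<psi> x) x = \<phi> x * partial_deriv b \<psi> x + partial_deriv b \<phi> x * \<psi> x"
  using partial_deriv_eq[OF has_derivative_mult[OF assms[unfolded frechet_derivative_works]], of b]
  by (simp add: partial_deriv_def)

lemma C_k_mult: "C_k k \<phi> \<Longrightarrow> C_k k \<psi> \<Longrightarrow> C_k k (\<lambda>x. \<phi> x * \<psi> x)"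
proof (induction k arbitrary: \<phi> \<psi>)
  case 0
  then show ?case by (simp add: continuous_on_mult)
next
  case (Suc k)
  have "partial_deriv b (\<lambda>x. \<phi> x * \<psi> x) = (\<lambda>x. \<phi> x * partial_deriv b \<psi> x + partial_deriv b \<phi> x * \<psi> x)" for b
    using Suc.prems by (intro ext partial_deriv_mult) auto
  moreover have "C_k k (\<lambda>x. \<phi> x * partial_deriv b \<psi> x + partial_deriv b \<phi> x * \<psi> x)" if "b \<in> Basis" for b
    using Suc.prems that by (intro C_k_add Suc.IH) (auto simp del: C_k.simps(1) intro: C_k_Suc simp: C_k.simps(2))
  ultimately show ?case using Suc.prems by (auto intro: differentiable_mult)
qed

lemma C_k_prod: "finite I \<Longrightarrow> (\<And>i. i \<in> I \<Longrightarrow> C_k k (\<phi> i)) \<Longrightarrow> C_k k (\<lambda>x. \<Prod>i\<in>I. \<phi> i x)"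
  by (induction I rule: finite_induct) (auto simp: C_k_const C_k_mult)

text \<open>The induction runs through the whole family \<open>D\<close> of successive derivatives:
  a partial derivative in direction \<open>b\<close> multiplies the factor by
  \<open>m * (b \<bullet> v)\<close> and raises the index, so \<open>c\<close> and \<open>n\<close>
  must stay arbitrary.\<close>

lemma C_k_inner_compose:
  assumes D: "\<And>n x. (D n has_real_derivative D (Suc n) x) (at x)"
  shows "C_k k (\<lambda>x. c * D n (m * (x \<bullet> v) + q))"
proof (induction k arbitrary: n c)
  case 0
  have "continuous_on UNIV (D n)"
    using D by (meson DERIV_isCont continuous_at_imp_continuous_on)
  then have "continuous_on UNIV (\<lambda>x. D n (m * (x \<bullet> v) + q))"
    by (rule continuous_on_compose2) (auto intro!: continuous_intros)
  then show ?case by (auto intro!: continuous_intros)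
next
  case (Suc k)
  have *: "((\<lambda>x. c * D n (m * (x \<bullet> v) + q)) has_derivative
      (\<lambda>h. c * (m * (h \<bullet> v) * D (Suc n) (m * (x \<bullet> v) + q)))) (at x)" for x
  proof -
    have "((\<lambda>x. m * (x \<bullet> v) + q) has_derivative (\<lambda>h. m * (h \<bullet> v))) (at x)"
      by (auto intro!: derivative_eq_intros)
    from DERIV_compose_FDERIV[OF D this] show ?thesis
      by (rule has_derivative_mult_right)
  qed
  have "partial_deriv b (\<lambda>x. c * D n (m * (x \<bullet> v) + q))
      = (\<lambda>x. (c * m * (b \<bullet> v)) * D (Suc n) (m * (x \<bullet> v) + q))" for b
    by (intro ext, subst partial_deriv_eq[OF *]) simp
  with Suc.IH[of "c * m * (b \<bullet> v)" "Suc n" for b] * show ?case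
    by (auto simp: differentiable_def)
qed

section \<open>Smooth step functions built from \<open>exp (- 1 / x)\<close>\<close>

definition flat :: "real poly \<Rightarrow> real \<Rightarrow> real" where
  "flat p x = (if x > 0 then poly p (1 / x) * exp (- 1 / x) else 0)"

lemma poly_exp_neg_tendsto_0: "((\<lambda>y::real. poly p y * exp (- y)) \<longlongrightarrow> 0) at_top"
proof -
  have "((\<lambda>y::real. \<Sum>i\<le>degree p. coeff p i * (y ^ i / exp y)) \<longlongrightarrow> (\<Sum>i\<le>degree p. coeff p i * 0)) at_top"
    by (intro tendsto_sum tendsto_mult tendsto_const tendsto_power_div_exp_0)
  then show ?thesis
    by (simp add: poly_altdef exp_minus sum_distrib_right divide_inverse mult.assoc)
qed

text \<open>With \<open>y = 1 / x\<close> the derivative in \<open>x\<close> is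
  \<open>- y\<^sup>2\<close> times the derivative in \<open>y\<close>, which sends \<open>p\<close>
  to \<open>y\<^sup>2 * (p - p')\<close>; the list \<open>[:0, 0, 1:]\<close> is that square. The
  polynomial parameter thus makes the family closed under differentiation. At zero the exponential
  beats every polynomial.\<close>

lemma flat_deriv: "(flat p has_real_derivative flat ([:0, 0, 1:] * (p - pderiv p)) x) (at x)"
proof -
  consider "x > 0" | "x < 0" | "x = 0" by linarith
  then show ?thesis
  proof cases
    case 1
    have "((\<lambda>x. poly p (1 / x) * exp (- 1 / x)) has_real_derivative
        flat ([:0, 0, 1:] * (p - pderiv p)) x) (at x)"
    proof -
      have "((\<lambda>x. 1 / x) has_real_derivative (- 1 / x\<^sup>2)) (at x)"
        using 1 by (auto intro!: derivative_eq_intros simp: power2_eq_square)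
      from DERIV_chain2[OF poly_DERIV this]
      have "((\<lambda>x. poly p (1 / x)) has_real_derivative poly (pderiv p) (1 / x) * (- 1 / x\<^sup>2)) (at x)" .
      moreover have "((\<lambda>x. exp (- 1 / x)) has_real_derivative exp (- 1 / x) * (1 / x\<^sup>2)) (at x)"
        using 1 by (auto intro!: derivative_eq_intros simp: power2_eq_square)
      ultimately show ?thesis
        by (rule DERIV_cong[OF DERIV_mult]) (use 1 in \<open>simp add: flat_def field_simps power2_eq_square\<close>)
    qed
    then show ?thesis
      by (rule has_field_derivative_transform_within_open[where S = "{0<..}"])
         (use 1 in \<open>auto simp: flat_def\<close>)
  next
    case 2
    have "((\<lambda>x. 0) has_real_derivative 0) (at x)" by simp
    then have "(flat p has_real_derivative 0) (at x)"
      by (rule has_field_derivative_transform_within_open[where S = "{..<0}"])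
         (use 2 in \<open>auto simp: flat_def\<close>)
    then show ?thesis using 2 by (simp add: flat_def)
  next
    case 3
    have "((\<lambda>h. flat p h / h) \<longlongrightarrow> 0) (at_right 0)"
    proof -
      \<comment> \<open>Dividing by \<open>h\<close> contributes one more factor
        \<open>1 / h\<close>, hence the product with \<open>[:0,1:]\<close>.\<close>
      have "((\<lambda>h::real. poly ([:0,1:] * p) (inverse h) * exp (- inverse h)) \<longlongrightarrow> 0) (at_right 0)"
        by (rule filterlim_compose[OF poly_exp_neg_tendsto_0 filterlim_inverse_at_top_right])
      then show ?thesis
        by (rule Lim_transform_eventually)
           (auto simp: eventually_at_filter flat_def field_simps)
    qed
    moreover have "((\<lambda>h. flat p h / h) \<longlongrightarrow> 0) (at_left 0)"
      by (rule Lim_transform_eventually[OF tendsto_const])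
         (auto simp: eventually_at_filter flat_def)
    ultimately have "((\<lambda>h. flat p h / h) \<longlongrightarrow> 0) (at 0)"
      by (rule filterlim_split_at_real[rotated])
    then show ?thesis using 3 by (simp add: DERIV_def flat_def)
  qed
qed

text \<open>The \<open>n\<close>-th derivative of \<open>exp (- 1 / x)\<close>, continued by zero to
  the left. Two members matter: \<open>flat_step 0\<close> is a smooth step rising from 0 to 1, and
  \<open>flat_step (Suc 0)\<close> is a nonnegative kernel on the positive axis with integral
  one.\<close>

definition flat_step :: "nat \<Rightarrow> real \<Rightarrow> real" where
  "flat_step n = flat (((\<lambda>p. [:0, 0, 1:] * (p - pderiv p)) ^^ n) 1)"

lemma flat_step_deriv: "(flat_step n has_real_derivative flat_step (Suc n) x) (at x)"
  unfolding flat_step_def funpow.simps o_apply by (rule flat_deriv)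

lemma flat_step_0: "flat_step 0 x = (if x > 0 then exp (- 1 / x) else 0)"
  by (simp add: flat_step_def flat_def)

lemma flat_step_1: "flat_step (Suc 0) x = (if x > 0 then exp (- 1 / x) / x\<^sup>2 else 0)"
  by (simp add: flat_step_def flat_def power2_eq_square)

lemma flat_step_0_bounds: "0 \<le> flat_step 0 x" "flat_step 0 x \<le> 1"
  by (auto simp: flat_step_0)

lemma flat_step_0_at_top: "(flat_step 0 \<longlongrightarrow> 1) at_top"
proof -
  have "((\<lambda>x::real. exp (- inverse x)) \<longlongrightarrow> exp (- 0)) at_top"
    by (rule tendsto_exp[OF tendsto_minus[OF tendsto_inverse_0_at_top[OF filterlim_ident]]])
  then have "((\<lambda>x::real. exp (- inverse x)) \<longlongrightarrow> 1) at_top" by simp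
  then show ?thesis
    by (rule Lim_transform_eventually)
       (use eventually_gt_at_top[of 0] in \<open>eventually_elim, simp add: flat_step_0 field_simps\<close>)
qed

lemma flat_step_0_scaled_tendsto:
  "(\<lambda>n. flat_step 0 (real n * x)) \<longlonglongrightarrow> (if x > 0 then 1 else 0)"
proof (cases "x > 0")
  case True
  have "filterlim (\<lambda>n. real n * x) at_top sequentially"
    using True by (intro filterlim_at_top_mult_tendsto_pos[OF tendsto_const] filterlim_real_sequentially)
  from filterlim_compose[OF flat_step_0_at_top this] show ?thesis using True by simp
next
  case False
  then have "\<not> 0 < real n * x" for n by (simp add: zero_less_mult_iff)
  then show ?thesis using False by (simp add: flat_step_0)
qed

section \<open>Compactly supported bumps and general properties of test functions\<close>

lemma test_functionsI:
  assumes "\<And>k. C_k k \<phi>" "\<And>x. \<phi> x \<noteq> 0 \<Longrightarrow> x \<in> K" "compact K" "K \<subseteq> U"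
  shows "\<phi> \<in> test_functions U"
proof -
  have "closure {x. \<phi> x \<noteq> 0} \<subseteq> K"
    using assms(2,3) by (intro closure_minimal compact_imp_closed) auto
  moreover have "bounded {x. \<phi> x \<noteq> 0}"
    using assms(2,3) by (auto intro: bounded_subset[OF compact_imp_bounded[OF assms(3)]])
  ultimately show ?thesis
    using assms(1,4) by (auto simp: test_functions_def compact_closure)
qed

text \<open>One smooth step rises from every face of the box. The function stays below the indicator
  of the open box and tends to it as the steps steepen with \<open>n\<close>; in dimension one its
  derivative approximates the difference of point evaluations at the two ends.\<close>

definition box_bump :: "'a::euclidean_space \<Rightarrow> 'a \<Rightarrow> nat \<Rightarrow> 'a \<Rightarrow> real" where
  "box_bump a c n x = (\<Prod>b\<in>Basis. flat_step 0 (real n * (x \<bullet> b - a \<bullet> b)) *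
                               flat_step 0 (real n * (c \<bullet> b - x \<bullet> b)))"

lemma box_bump_C_k: "C_k k (box_bump a c n)"
proof -
  have *: "C_k k (\<lambda>x. flat_step 0 (real n * (x \<bullet> b - a \<bullet> b)) * flat_step 0 (real n * (c \<bullet> b - x \<bullet> b)))"
    for b :: 'a
    using C_k_mult[OF C_k_inner_compose[of flat_step, OF flat_step_deriv, of k 1 0 "real n" b "- real n * (a \<bullet> b)"]
                      C_k_inner_compose[of flat_step, OF flat_step_deriv, of k 1 0 "- real n" b "real n * (c \<bullet> b)"]]
    by (simp add: algebra_simps)
  show ?thesis
    unfolding box_bump_def[abs_def] by (intro C_k_prod finite_Basis *)
qed

lemma box_bump_support: "box_bump a c n x \<noteq> 0 \<Longrightarrow> x \<in> box a c"
  unfolding box_bump_def mem_box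
  by (auto simp: flat_step_0 zero_less_mult_iff split: if_splits)

lemma box_bump_bounds: "0 \<le> box_bump a c n x" "box_bump a c n x \<le> 1"
  unfolding box_bump_def
  by (auto intro!: prod_nonneg prod_le_1 mult_le_one simp: flat_step_0_bounds)

lemma box_bump_test_function:
  assumes "cbox a c \<subseteq> U"
  shows "box_bump a c n \<in> test_functions U"
  using assms
  by (intro test_functionsI[of _ "cbox a c"] box_bump_C_k)
     (auto dest!: box_bump_support simp: box_subset_cbox[THEN subsetD])

lemma box_bump_tendsto: "(\<lambda>n. box_bump a c n x) \<longlonglongrightarrow> indicator (box a c) x"
proof -
  have "(\<lambda>n. box_bump a c n x) \<longlonglongrightarrow>
    (\<Prod>b\<in>Basis. (if x \<bullet> b - a \<bullet> b > 0 then 1 else 0) * (if c \<bullet> b - x \<bullet> b > 0 then 1 else 0))"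
    unfolding box_bump_def by (intro tendsto_prod tendsto_mult flat_step_0_scaled_tendsto)
  also have "(\<Prod>b\<in>Basis. (if x \<bullet> b - a \<bullet> b > 0 then 1 else 0) * (if c \<bullet> b - x \<bullet> b > 0 then 1 else 0))
      = (indicator (box a c) x :: real)"
  proof (cases "x \<in> box a c")
    case True
    then show ?thesis by (simp add: mem_box)
  next
    case False
    then obtain b where "b \<in> Basis" "\<not> (a \<bullet> b < x \<bullet> b \<and> x \<bullet> b < c \<bullet> b)"
      by (auto simp: mem_box)
    then show ?thesis using False by (auto intro!: prod_zero bexI[of _ b])
  qed
  finally show ?thesis .
qed

lemma test_functions_continuous: "\<phi> \<in> test_functions U \<Longrightarrow> continuous_on UNIV \<phi>"
  unfolding test_functions_def by (metis (mono_tags, lifting) C_k.simps(1) mem_Collect_eq)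

lemma test_functions_C_k: "\<phi> \<in> test_functions U \<Longrightarrow> C_k k \<phi>"
  by (simp add: test_functions_def)

lemma test_functions_differentiable: "\<phi> \<in> test_functions U \<Longrightarrow> \<phi> differentiable (at x)"
  using test_functions_C_k[of \<phi> U "Suc 0"] by simp

lemma test_functions_partial_continuous:
  "\<phi> \<in> test_functions U \<Longrightarrow> b \<in> Basis \<Longrightarrow> continuous_on UNIV (partial_deriv b \<phi>)"
  using test_functions_C_k[of \<phi> U "Suc 0"] by simp

text \<open>Off the closed support the function vanishes on a whole neighbourhood, so one compact
  set serves for the function and for all its partial derivatives.\<close>

lemma test_functions_support:
  assumes "\<phi> \<in> test_functions U"
  obtains K where "compact K" "K \<subseteq> U" "\<And>x. x \<notin> K \<Longrightarrow> \<phi> x = 0" "\<And>x b. x \<notin> K \<Longrightarrow> partial_deriv b \<phi> x = 0"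
proof
  let ?K = "closure {x. \<phi> x \<noteq> 0}"
  show "compact ?K" "?K \<subseteq> U" using assms by (auto simp: test_functions_def)
  show "\<phi> x = 0" if "x \<notin> ?K" for x
    using that closure_subset[of "{x. \<phi> x \<noteq> 0}"] by auto
  show "partial_deriv b \<phi> x = 0" if "x \<notin> ?K" for x b
  proof -
    have "((\<lambda>x. 0) has_derivative (\<lambda>h. 0)) (at x)" by simp
    then have "(\<phi> has_derivative (\<lambda>h. 0)) (at x)"
      by (rule has_derivative_transform_within_open[where s = "- ?K"])
         (use that closure_subset[of "{x. \<phi> x \<noteq> 0}"] in auto)
    from partial_deriv_eq[OF this] show ?thesis .
  qed
qed

lemma test_functions_lincomb:
  assumes "\<phi> \<in> test_functions U" "\<psi> \<in> test_functions U"
  shows "(\<lambda>x. a * \<phi> x + b * \<psi> x) \<in> test_functions U"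
proof -
  obtain K where K: "compact K" "K \<subseteq> U" "\<And>x. x \<notin> K \<Longrightarrow> \<phi> x = 0"
    by (rule test_functions_support[OF assms(1)]) blast
  obtain L where L: "compact L" "L \<subseteq> U" "\<And>x. x \<notin> L \<Longrightarrow> \<psi> x = 0"
    by (rule test_functions_support[OF assms(2)]) blast
  have "x \<in> K \<union> L" if "a * \<phi> x + b * \<psi> x \<noteq> 0" for x
    using that K(3)[of x] L(3)[of x] by (cases "x \<in> K"; cases "x \<in> L") auto
  then show ?thesis
    by (rule test_functionsI[where K = "K \<union> L", rotated])
       (use K L assms[THEN test_functions_C_k] in \<open>auto intro!: C_k_add C_k_mult C_k_const\<close>)
qed

section \<open>The fundamental lemma of the calculus of variations\<close>

lemma integral_boxes_zero_imp_AE_zero: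
  fixes H :: "'a::euclidean_space \<Rightarrow> real"
  assumes H: "integrable lborel H" and total: "(LINT x|lborel. H x) = 0"
    and boxes: "\<And>a c. (LINT x:box a c|lborel. H x) = 0"
  shows "AE x in lborel. H x = 0"
proof -
  have si: "set_integrable lborel A H" if "A \<in> sets borel" for A
    using that H unfolding set_integrable_def by (intro integrable_mult_indicator) auto
  \<comment> \<open>Open boxes are stable under intersection and generate the Borel sets, so
    Dynkin's argument extends the vanishing from boxes to all Borel sets. The vanishing total
    integral handles complements.\<close>
  have "(LINT x:A|lborel. H x) = 0" if "A \<in> sets borel" for A
  proof -
    let ?G = "range (\<lambda>(a, b). box a b) :: 'a set set"
    have borel: "B \<in> sets borel" if "B \<in> sigma_sets UNIV ?G" for B
      using that by (simp add: borel_eq_box)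
    have "Int_stable ?G" "?G \<subseteq> Pow UNIV" "A \<in> sigma_sets UNIV ?G"
      using that by (auto simp: Int_stable_def box_Int_box borel_eq_box)
    then show ?thesis
    proof (induction rule: sigma_sets_induct_disjoint)
      case (basic B)
      then show ?case using boxes by auto
    next
      case empty
      then show ?case by (simp add: set_lebesgue_integral_def)
    next
      case (compl B)
      then have "(LINT x:B \<union> (UNIV - B)|lborel. H x) = (LINT x:B|lborel. H x) + (LINT x:UNIV - B|lborel. H x)"
        using borel by (intro set_integral_Un si) auto
      then show ?case using compl total by (simp add: set_lebesgue_integral_def)
    next
      case (union B)
      then have "B i \<in> sets borel" for i using borel by blast
      then have "(LINT x:(\<Union>i. B i)|lborel. H x) = (\<Sum>i. (LINT x:B i|lborel. H x))"
        using union(1) by (intro lebesgue_integral_countable_add si) (auto simp: disjoint_family_on_def)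
      then show ?case using union by simp
    qed
  qed
  then have zero: "(LINT x|lborel. indicator A x * H x) = 0" if "A \<in> sets borel" for A
    using that by (simp add: set_lebesgue_integral_def)
  \<comment> \<open>The set where \<open>s * H\<close> is positive is Borel, so the integral over it
    vanishes; \<open>s = 1\<close> and \<open>s = -1\<close> together exclude both signs.\<close>
  have half: "AE x in lborel. \<not> 0 < s * H x" for s :: real
  proof -
    let ?A = "{x. 0 < s * H x}"
    have [measurable]: "H \<in> borel_measurable borel" using borel_measurable_integrable[OF H] by simp
    have A: "?A \<in> sets borel" by simp
    have "(LINT x|lborel. s * (indicator ?A x * H x)) = 0"
      using zero[OF A] by simp
    moreover have "integrable lborel (\<lambda>x. s * (indicator ?A x * H x))"
      using integrable_mult_indicator[OF _ H, of ?A] A by (intro integrable_mult_right) simp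
    moreover have "AE x in lborel. 0 \<le> s * (indicator ?A x * H x)"
      by (auto split: split_indicator)
    ultimately have "AE x in lborel. s * (indicator ?A x * H x) = 0"
      by (simp only: integral_nonneg_eq_0_iff_AE)
    then show ?thesis by eventually_elim (auto split: split_indicator_asm)
  qed
  show ?thesis using half[of 1] half[of "-1"] by eventually_elim auto
qed

text \<open>Bumps approximate indicators of boxes, so \<open>h\<close> integrates to zero over every
  box whose closure lies in \<open>\<Omega>\<close>. The conclusion is obtained on each closed box
  inside \<open>\<Omega>\<close> separately, and countably many such boxes exhaust
  \<open>\<Omega>\<close>.\<close>

lemma AE_zero_if_orthogonal_to_test_functions:
  fixes h :: "'a::euclidean_space \<Rightarrow> real"
  assumes \<Omega>: "open \<Omega>" and h: "h \<in> L2 \<Omega>"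
    and orth: "\<And>\<phi>. \<phi> \<in> test_functions \<Omega> \<Longrightarrow> (LINT x|lebesgue_on \<Omega>. h x * \<phi> x) = 0"
  shows "AE x in lebesgue_on \<Omega>. h x = 0"
proof -
  have sets: "\<Omega> \<in> sets lebesgue" using \<Omega> by simp
  define h0 where "h0 x = indicator \<Omega> x * h x" for x
  have h0_meas [measurable]: "h0 \<in> borel_measurable lebesgue"
    using L2_measurable[OF h] sets by (simp add: borel_measurable_restrict_space_iff h0_def[abs_def])
  have h0_sq: "integrable lebesgue (\<lambda>x. (h0 x)\<^sup>2)"
  proof -
    have "integrable lebesgue (\<lambda>x. indicator \<Omega> x *\<^sub>R (norm (h x))\<^sup>2)"
      using L2_integrable_norm_sq[OF h] sets by (simp add: integrable_restrict_space)
    then show ?thesis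
      by (rule back_subst[of "integrable lebesgue"]) (auto simp: h0_def split: split_indicator)
  qed
  have h0_box: "integrable lebesgue (\<lambda>x. indicator (box a c) x * h0 x)" for a c
  proof (rule Bochner_Integration.integrable_bound)
    show "integrable lebesgue (\<lambda>x. (h0 x)\<^sup>2 + indicator (box a c) x)"
      using h0_sq by (intro Bochner_Integration.integrable_add integrable_real_indicator) (auto simp: emeasure_lborel_box_eq)
    \<comment> \<open>Square integrability controls the first power on sets of finite measure; this
      is how integrability on boxes arises.\<close>
    have "\<bar>h0 x\<bar> \<le> (h0 x)\<^sup>2 + 1" for x
      using zero_le_power2[of "\<bar>h0 x\<bar> - 1"] by (simp add: power2_diff)
    then show "AE x in lebesgue. norm (indicator (box a c) x * h0 x) \<le> norm ((h0 x)\<^sup>2 + indicator (box a c) x)"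
      by (auto simp: abs_mult split: split_indicator)
  qed (intro borel_measurable_times h0_meas borel_measurable_indicator, simp)
  have box_zero: "(LINT x|lebesgue. indicator (box a c) x * h0 x) = 0" if ac: "cbox a c \<subseteq> \<Omega>" for a c
  proof -
    have "(\<lambda>n. LINT x|lebesgue. h0 x * box_bump a c n x) \<longlonglongrightarrow> (LINT x|lebesgue. h0 x * indicator (box a c) x)"
    proof (rule integral_dominated_convergence[where w = "\<lambda>x. \<bar>indicator (box a c) x * h0 x\<bar>"])
      show "(\<lambda>x. h0 x * box_bump a c n x) \<in> borel_measurable lebesgue" for n
        using borel_measurable_continuous_onI[OF test_functions_continuous[OF box_bump_test_function[OF ac]], of n]
        by (intro borel_measurable_times h0_meas measurable_completion) simp
      show "AE x in lebesgue. (\<lambda>n. h0 x * box_bump a c n x) \<longlonglongrightarrow> h0 x * indicator (box a c) x"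
        by (intro AE_I2 tendsto_mult tendsto_const box_bump_tendsto)
      have "norm (h0 x * box_bump a c n x) \<le> \<bar>indicator (box a c) x * h0 x\<bar>" for n x
        using box_bump_support[of a c n x] box_bump_bounds[where a=a and c=c and n=n and x=x]
        by (cases "box_bump a c n x = 0") (auto simp: abs_mult mult_left_le)
      then show "AE x in lebesgue. norm (h0 x * box_bump a c n x) \<le> \<bar>indicator (box a c) x * h0 x\<bar>" for n
        by simp
      show "integrable lebesgue (\<lambda>x. \<bar>indicator (box a c) x * h0 x\<bar>)"
        by (intro integrable_abs h0_box)
    qed (intro borel_measurable_times h0_meas borel_measurable_indicator, simp)
    moreover have "(LINT x|lebesgue. h0 x * box_bump a c n x) = 0" for n
      using orth[OF box_bump_test_function[OF ac, of n]] sets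
      by (simp add: integral_restrict_space h0_def mult.assoc)
    ultimately show ?thesis by (simp add: LIMSEQ_const_iff mult.commute)
  qed
  \<comment> \<open>The Dynkin argument works with Borel sets and \<open>lborel\<close>, so a Borel
    representative replaces the Lebesgue measurable function.\<close>
  obtain H where H: "H \<in> borel_measurable lborel" "AE x in lborel. h0 x = H x"
    using completion_ex_borel_measurable_real[OF h0_meas] by blast
  have transfer: "(LINT x|lborel. indicator (box a c) x * H x) = (LINT x|lebesgue. indicator (box a c) x * h0 x)"
    "integrable lborel (\<lambda>x. indicator (box a c) x * H x)" for a c
  proof -
    have [measurable]: "H \<in> borel_measurable borel" using H(1) by simp
    have m: "(\<lambda>x. indicator (box a c) x * H x) \<in> borel_measurable lborel" by simp
    have m': "(\<lambda>x. indicator (box a c) x * H x) \<in> borel_measurable lebesgue"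
      using m by (rule measurable_completion)
    have m0: "(\<lambda>x. indicator (box a c) x * h0 x) \<in> borel_measurable lebesgue"
      by (rule borel_measurable_integrable[OF h0_box])
    have ae: "AE x in lebesgue. indicator (box a c) x * h0 x = indicator (box a c) x * H x"
      using AE_completion[OF H(2)] by eventually_elim simp
    have "integrable lebesgue (\<lambda>x. indicator (box a c) x * H x)"
      by (rule integrable_cong_AE_imp[OF h0_box m' ae])
    then show "integrable lborel (\<lambda>x. indicator (box a c) x * H x)"
      using m by (simp add: integrable_completion)
    have "(LINT x|lebesgue. indicator (box a c) x * h0 x) = (LINT x|lebesgue. indicator (box a c) x * H x)"
      by (rule integral_cong_AE[OF m0 m' ae])
    then show "(LINT x|lborel. indicator (box a c) x * H x) = (LINT x|lebesgue. indicator (box a c) x * h0 x)"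
      using m by (simp add: integral_completion)
  qed
  have local_zero: "AE x in lebesgue. x \<in> cbox p q \<longrightarrow> h0 x = 0" if pq: "cbox p q \<subseteq> \<Omega>" for p q
  proof -
    have "AE x in lborel. indicator (box p q) x * H x = 0"
    proof (rule integral_boxes_zero_imp_AE_zero)
      show "integrable lborel (\<lambda>x. indicator (box p q) x * H x)" by (rule transfer)
      show "(LINT x|lborel. indicator (box p q) x * H x) = 0" using transfer box_zero[OF pq] by simp
      fix a c
      obtain a' c' where ac: "box a c \<inter> box p q = box a' c'" by (rule that[OF box_Int_box])
      have "indicator (box a' c') x = (indicator (box a c) x * indicator (box p q) x :: real)" for x
        unfolding ac[symmetric] by (rule indicator_inter_arith)
      then have "(LINT x:box a c|lborel. indicator (box p q) x * H x) = (LINT x|lborel. indicator (box a' c') x * H x)"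
        by (simp add: set_lebesgue_integral_def mult.assoc)
      also have "\<dots> = 0"
      proof (cases "box a' c' = {}")
        case False
        have "closure (box a' c') \<subseteq> cbox p q"
          using ac box_subset_cbox[of p q] by (intro closure_minimal) auto
        then have "cbox a' c' \<subseteq> \<Omega>" using False pq by (simp add: closure_box)
        then show ?thesis using transfer box_zero by simp
      qed simp
      finally show "(LINT x:box a c|lborel. indicator (box p q) x * H x) = 0" .
    qed
    then have "AE x in lebesgue. indicator (box p q) x * H x = 0" by (rule AE_completion)
    \<comment> \<open>The vanishing was shown on open boxes while the exhaustion uses closed ones;
      their difference is negligible.\<close>
    moreover have "AE x in lebesgue. x \<notin> cbox p q - box p q"
      using negligible_frontier_interval[of p q] by (intro AE_not_in) (simp add: negligible_iff_null_sets)
    ultimately show ?thesis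
      using AE_completion[OF H(2)] by eventually_elim auto
  qed
  obtain D where D: "countable D" "D \<subseteq> Pow \<Omega>" "\<And>X. X \<in> D \<Longrightarrow> \<exists>a b. X = cbox a b" "\<Union>D = \<Omega>"
    by (rule open_countable_Union_open_cbox[OF \<Omega>]) blast
  have "AE x in lebesgue. \<forall>X\<in>D. x \<in> X \<longrightarrow> h0 x = 0"
    unfolding AE_ball_countable[OF D(1)]
  proof
    fix X assume "X \<in> D"
    then show "AE x in lebesgue. x \<in> X \<longrightarrow> h0 x = 0"
      using D(2) D(3)[of X] local_zero by blast
  qed
  then have "AE x in lebesgue. x \<in> \<Omega> \<longrightarrow> h x = 0"
    by eventually_elim (use D(4) in \<open>auto simp: h0_def indicator_def\<close>)
  then show ?thesis using sets by (simp add: AE_restrict_space_iff)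
qed

section \<open>Weak gradients and the space \<open>H\<^sup>1\<^sub>0\<close>\<close>

lemma integrable_continuous_compact_support:
  fixes f :: "'a::euclidean_space \<Rightarrow> 'b::euclidean_space"
  assumes "continuous_on UNIV f" "compact K" "\<And>x. x \<notin> K \<Longrightarrow> f x = 0"
  shows "integrable lborel f"
proof -
  have "integrable lborel (\<lambda>x. indicator K x *\<^sub>R f x)"
    using assms by (intro borel_integrable_compact) (auto intro: continuous_on_subset)
  then show ?thesis
    by (rule back_subst[of "integrable lborel"]) (auto simp: assms(3) split: split_indicator)
qed

lemma integrable_lebesgue_on_continuous_compact_support:
  fixes f :: "'a::euclidean_space \<Rightarrow> 'b::euclidean_space"
  assumes "continuous_on UNIV f" "compact K" "\<And>x. x \<notin> K \<Longrightarrow> f x = 0" "\<Omega> \<in> sets lebesgue"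
  shows "integrable (lebesgue_on \<Omega>) f"
proof -
  have "integrable lebesgue f"
    using integrable_continuous_compact_support[OF assms(1-3)] borel_measurable_continuous_onI[OF assms(1)]
    by (simp add: integrable_completion)
  then show ?thesis
    using assms(4) by (simp add: integrable_restrict_space integrable_mult_indicator)
qed

lemma integral_lebesgue_on_continuous_compact_support:
  fixes f :: "'a::euclidean_space \<Rightarrow> 'b::euclidean_space"
  assumes "continuous_on UNIV f" "\<And>x. x \<notin> \<Omega> \<Longrightarrow> f x = 0" "\<Omega> \<in> sets lebesgue"
  shows "(LINT x|lebesgue_on \<Omega>. f x) = (LINT x|lborel. f x)"
proof -
  have "(LINT x|lebesgue_on \<Omega>. f x) = (LINT x|lebesgue. indicator \<Omega> x *\<^sub>R f x)"
    using assms(3) by (simp add: integral_restrict_space)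
  also have "(\<lambda>x. indicator \<Omega> x *\<^sub>R f x) = f"
    using assms(2) by (auto split: split_indicator)
  also have "(LINT x|lebesgue. f x) = (LINT x|lborel. f x)"
    using borel_measurable_continuous_onI[OF assms(1)] by (simp add: integral_completion)
  finally show ?thesis .
qed

lemma L2_continuous_compact_support:
  assumes "continuous_on UNIV f" "compact K" "\<And>x. x \<notin> K \<Longrightarrow> f x = 0" "\<Omega> \<in> sets lebesgue"
  shows "f \<in> L2 \<Omega>"
proof -
  have "integrable (lebesgue_on \<Omega>) (\<lambda>x. (norm (f x))\<^sup>2)"
    using assms by (intro integrable_lebesgue_on_continuous_compact_support[of _ K] continuous_intros) auto
  moreover have "integrable (lebesgue_on \<Omega>) f"
    by (rule integrable_lebesgue_on_continuous_compact_support[OF assms])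
  ultimately show ?thesis by (simp add: L2_def borel_measurable_integrable)
qed

section \<open>Classical gradients and difference quotients of test functions\<close>

definition test_grad :: "('a::euclidean_space \<Rightarrow> real) \<Rightarrow> 'a \<Rightarrow> 'a" where
  "test_grad \<phi> x = (\<Sum>b\<in>Basis. partial_deriv b \<phi> x *\<^sub>R b)"

lemma test_grad_inner_Basis: "b \<in> Basis \<Longrightarrow> test_grad \<phi> x \<bullet> b = partial_deriv b \<phi> x"
  by (simp add: test_grad_def inner_sum_left inner_Basis if_distrib cong: if_cong)

lemma test_grad_has_derivative:
  assumes "\<phi> \<in> test_functions U"
  shows "(\<phi> has_derivative (\<lambda>h. test_grad \<phi> x \<bullet> h)) (at x)"
proof -
  let ?D = "frechet_derivative \<phi> (at x)"
  have D: "(\<phi> has_derivative ?D) (at x)"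
    using test_functions_differentiable[OF assms] by (simp add: frechet_derivative_works[symmetric])
  then interpret linear ?D by (rule has_derivative_linear)
  have "?D h = test_grad \<phi> x \<bullet> h" for h
  proof -
    have "?D h = ?D (\<Sum>b\<in>Basis. (h \<bullet> b) *\<^sub>R b)" by (simp add: euclidean_representation)
    also have "\<dots> = (\<Sum>b\<in>Basis. (h \<bullet> b) * ?D b)" by (simp add: sum scale)
    also have "\<dots> = test_grad \<phi> x \<bullet> h"
      by (simp add: test_grad_def partial_deriv_def inner_sum_right inner_commute[of _ h] mult.commute)
    finally show ?thesis .
  qed
  then have "?D = (\<lambda>h. test_grad \<phi> x \<bullet> h)" by (rule ext)
  with D show ?thesis by simp
qed

lemma test_grad_continuous: "\<phi> \<in> test_functions U \<Longrightarrow> continuous_on UNIV (test_grad \<phi>)"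
  unfolding test_grad_def[abs_def] by (intro continuous_intros test_functions_partial_continuous)

lemma test_functions_Lipschitz:
  assumes "\<phi> \<in> test_functions U"
  obtains B where "0 \<le> B" "\<And>x. norm (test_grad \<phi> x) \<le> B" "\<And>x z. \<bar>\<phi> (x + z) - \<phi> x\<bar> \<le> B * norm z"
proof -
  obtain K where K: "compact K" "\<And>x b. x \<notin> K \<Longrightarrow> partial_deriv b \<phi> x = 0"
    by (rule test_functions_support[OF assms]) blast
  have "compact (test_grad \<phi> ` K)"
    using test_grad_continuous[OF assms] K(1) by (meson compact_continuous_image continuous_on_subset subset_UNIV)
  then obtain B where B: "B > 0" "\<And>x. x \<in> K \<Longrightarrow> norm (test_grad \<phi> x) \<le> B"
    by (auto dest!: compact_imp_bounded simp: bounded_pos)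
  have bound: "norm (test_grad \<phi> x) \<le> B" for x
    using B K(2)[of x] by (cases "x \<in> K") (auto simp: test_grad_def)
  have "norm (\<phi> (x + z) - \<phi> x) \<le> B * norm (x + z - x)" for x z
  proof (rule differentiable_bound[of UNIV])
    fix y
    show "onorm (\<lambda>h. test_grad \<phi> y \<bullet> h) \<le> B"
      using bound[of y] by (intro onorm_le order_trans[OF Cauchy_Schwarz_ineq2[unfolded real_norm_def[symmetric]]] mult_right_mono) auto
  qed (auto intro: has_derivative_at_withinI test_grad_has_derivative[OF assms])
  then show ?thesis using that[of B] B bound by simp
qed

lemma difference_quotient_tendsto:
  assumes "(\<phi> has_derivative (\<lambda>h. g \<bullet> h)) (at x)"
  shows "(\<lambda>n. real (Suc n) * (\<phi> (x + (1 / real (Suc n)) *\<^sub>R z) - \<phi> x)) \<longlonglongrightarrow> g \<bullet> z"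
proof -
  have *: "((\<lambda>t. x + t *\<^sub>R z) has_derivative (\<lambda>t. t *\<^sub>R z)) (at (0::real))"
    by (auto intro!: derivative_eq_intros)
  have "((\<lambda>t. \<phi> (x + t *\<^sub>R z)) has_derivative (\<lambda>t. g \<bullet> (t *\<^sub>R z))) (at (0::real))"
    by (rule has_derivative_compose[OF *]) (simp add: assms)
  then have "((\<lambda>t. \<phi> (x + t *\<^sub>R z)) has_real_derivative (g \<bullet> z)) (at 0)"
    by (simp add: has_field_derivative_def mult.commute[of _ "g \<bullet> z"])
  then have "((\<lambda>t. (\<phi> (x + t *\<^sub>R z) - \<phi> x) / t) \<longlongrightarrow> g \<bullet> z) (at 0)"
    by (simp add: DERIV_def)
  moreover have "filterlim (\<lambda>n. 1 / real (Suc n)) (at 0) sequentially"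
    by (intro filterlim_atI) (use lim_1_over_n[THEN LIMSEQ_Suc] in auto)
  ultimately have "(\<lambda>n. (\<phi> (x + (1 / real (Suc n)) *\<^sub>R z) - \<phi> x) / (1 / real (Suc n))) \<longlonglongrightarrow> g \<bullet> z"
    by (rule filterlim_compose)
  then show ?thesis by (simp add: mult.commute)
qed

text \<open>The function \<open>G\<close> serves two purposes: the identity gives the vanishing
  integral of a partial derivative, the square gives the translation estimate. Dominated convergence
  applies because the Lipschitz bound confines the quotients to a compact range and
  \<open>G 0 = 0\<close> keeps the support in a fixed compact set.\<close>

lemma test_difference_quotient_integral:
  fixes G :: "real \<Rightarrow> real"
  assumes \<phi>: "\<phi> \<in> test_functions U" and G: "continuous_on UNIV G" "G 0 = 0"
  shows "(\<lambda>n. LINT x|lborel. G (real (Suc n) * (\<phi> (x + (1 / real (Suc n)) *\<^sub>R z) - \<phi> x)))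
    \<longlonglongrightarrow> (LINT x|lborel. G (test_grad \<phi> x \<bullet> z))"
proof -
  obtain K where K: "compact K" "\<And>x. x \<notin> K \<Longrightarrow> \<phi> x = 0"
    by (rule test_functions_support[OF \<phi>]) blast
  obtain B where B: "0 \<le> B" "\<And>x z. \<bar>\<phi> (x + z) - \<phi> x\<bar> \<le> B * norm z"
    by (rule test_functions_Lipschitz[OF \<phi>]) blast
  \<comment> \<open>All shifts have length at most \<open>norm z\<close>, so this enlarged set
    contains the support of every quotient.\<close>
  define K' where "K' = {x - y |x y. x \<in> K \<and> y \<in> cball 0 (norm z)}"
  have K': "compact K'" unfolding K'_def using K(1) by (intro compact_differences) auto
  have "compact (G ` {- (B * norm z) .. B * norm z})"
    by (intro compact_continuous_image continuous_on_subset[OF G(1)]) auto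
  then have "bounded (G ` {- (B * norm z) .. B * norm z})" by (rule compact_imp_bounded)
  then obtain C where "\<forall>y\<in>G ` {- (B * norm z) .. B * norm z}. norm y \<le> C"
    by (auto simp only: bounded_iff)
  then have C: "\<bar>G y\<bar> \<le> C" if "\<bar>y\<bar> \<le> B * norm z" for y
    using that by (simp add: abs_le_iff)
  have cont: "continuous_on UNIV \<phi>" by (rule test_functions_continuous[OF \<phi>])
  have meas: "(\<lambda>x. G (real (Suc n) * (\<phi> (x + (1 / real (Suc n)) *\<^sub>R z) - \<phi> x))) \<in> borel_measurable lborel" for n
    by (simp, intro borel_measurable_continuous_onI continuous_on_compose2[OF G(1)] continuous_intros
        continuous_on_compose2[OF cont]) auto
  have meas': "(\<lambda>x. G (test_grad \<phi> x \<bullet> z)) \<in> borel_measurable lborel"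
    by (simp, intro borel_measurable_continuous_onI continuous_on_compose2[OF G(1)] continuous_intros
        test_grad_continuous[OF \<phi>]) auto
  show ?thesis
  proof (rule integral_dominated_convergence[where w = "\<lambda>x. C * indicator K' x"])
    show "integrable lborel (\<lambda>x. C * indicator K' x)"
      using K' emeasure_bounded_finite[OF compact_imp_bounded[OF K']]
      by (intro integrable_mult_right integrable_real_indicator) (auto simp: borel_compact)
    show "AE x in lborel. (\<lambda>n. G (real (Suc n) * (\<phi> (x + (1 / real (Suc n)) *\<^sub>R z) - \<phi> x)))
        \<longlonglongrightarrow> G (test_grad \<phi> x \<bullet> z)"
    proof (rule AE_I2)
      fix x
      have "isCont G (test_grad \<phi> x \<bullet> z)" using G(1) by (simp add: continuous_on_eq_continuous_at)
      from isCont_tendsto_compose[OF this difference_quotient_tendsto[OF test_grad_has_derivative[OF \<phi>]]]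
      show "(\<lambda>n. G (real (Suc n) * (\<phi> (x + (1 / real (Suc n)) *\<^sub>R z) - \<phi> x))) \<longlonglongrightarrow> G (test_grad \<phi> x \<bullet> z)" .
    qed
    fix n
    have "norm (G (real (Suc n) * (\<phi> (x + (1 / real (Suc n)) *\<^sub>R z) - \<phi> x))) \<le> C * indicator K' x" for x
    proof (cases "x \<in> K'")
      case True
      have "\<bar>real (Suc n) * (\<phi> (x + (1 / real (Suc n)) *\<^sub>R z) - \<phi> x)\<bar>
          \<le> real (Suc n) * (B * norm ((1 / real (Suc n)) *\<^sub>R z))"
        unfolding abs_mult by (intro mult_mono B(2)) auto
      also have "\<dots> = B * norm z" by simp
      finally show ?thesis using C True by simp
    next
      case False
      let ?w = "(1 / real (Suc n)) *\<^sub>R z"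
      have "norm ?w \<le> norm z" by (simp add: divide_le_eq mult_le_cancel_left1)
      then have "x + ?w \<in> K \<Longrightarrow> x \<in> K'"
        unfolding K'_def by (intro CollectI exI[of _ "x + ?w"] exI[of _ ?w]) simp
      moreover have "x \<in> K \<Longrightarrow> x \<in> K'"
        unfolding K'_def by (intro CollectI exI[of _ x] exI[of _ 0]) simp
      ultimately have "x + ?w \<notin> K" "x \<notin> K" using False by blast+
      then show ?thesis using K(2) G(2) False by simp
    qed
    then show "AE x in lborel. norm (G (real (Suc n) * (\<phi> (x + (1 / real (Suc n)) *\<^sub>R z) - \<phi> x))) \<le> C * indicator K' x"
      by simp
  qed (rule meas' meas)+
qed

lemma lborel_integral_translation:
  fixes f :: "'a::euclidean_space \<Rightarrow> 'b::euclidean_space"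
  assumes "f \<in> borel_measurable borel"
  shows "(LINT x|lborel. f (x + c)) = (LINT x|lborel. f x)"
proof -
  have "(LINT x|lborel. f x) = (LINT x|distr lborel borel ((+) c). f x)"
    by (simp add: lborel_distr_plus)
  also have "\<dots> = (LINT x|lborel. f (c + x))"
    using assms by (intro integral_distr) auto
  finally show ?thesis by (simp add: add.commute)
qed

text \<open>By translation invariance every difference quotient has integral zero, and these
  integrals converge to that of the derivative.\<close>

lemma test_partial_deriv_integral_zero:
  assumes \<phi>: "\<phi> \<in> test_functions U" and b: "b \<in> Basis"
  shows "(LINT x|lborel. partial_deriv b \<phi> x) = 0"
proof -
  obtain K where K: "compact K" "\<And>x. x \<notin> K \<Longrightarrow> \<phi> x = 0"
    by (rule test_functions_support[OF \<phi>]) blast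
  have cont: "continuous_on UNIV \<phi>" by (rule test_functions_continuous[OF \<phi>])
  have int: "integrable lborel \<phi>" by (rule integrable_continuous_compact_support[OF cont K])
  have "(LINT x|lborel. \<phi> (x + c) - \<phi> x) = 0" for c
  proof -
    have "integrable lborel (\<lambda>x. \<phi> (x + c))"
    proof (rule integrable_continuous_compact_support)
      show "compact ((\<lambda>x. x - c) ` K)" using K(1) by (intro compact_continuous_image continuous_intros)
      show "\<phi> (x + c) = 0" if "x \<notin> (\<lambda>x. x - c) ` K" for x
        using that K(2)[of "x + c"] by (force simp: image_iff)
      show "continuous_on UNIV (\<lambda>x. \<phi> (x + c))"
        by (intro continuous_on_compose2[OF cont] continuous_intros) auto
    qed
    then show ?thesis
      using int lborel_integral_translation[OF borel_measurable_continuous_onI[OF cont], of c] by simp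
  qed
  then have "(LINT x|lborel. real (Suc n) * (\<phi> (x + (1 / real (Suc n)) *\<^sub>R b) - \<phi> x)) = 0" for n
    by (simp del: of_nat_Suc)
  then have "(\<lambda>n. 0) \<longlonglongrightarrow> (LINT x|lborel. test_grad \<phi> x \<bullet> b)"
    using test_difference_quotient_integral[OF \<phi>, of "\<lambda>y. y" b] by (simp del: of_nat_Suc add: continuous_on_id)
  then show ?thesis using b by (simp add: LIMSEQ_const_iff test_grad_inner_Basis)
qed

lemma test_functions_mult:
  assumes "\<phi> \<in> test_functions U" "\<psi> \<in> test_functions V"
  shows "(\<lambda>x. \<phi> x * \<psi> x) \<in> test_functions U"
proof -
  obtain K where K: "compact K" "K \<subseteq> U" "\<And>x. x \<notin> K \<Longrightarrow> \<phi> x = 0"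
    by (rule test_functions_support[OF assms(1)]) blast
  show ?thesis
    by (rule test_functionsI[OF _ _ K(1,2)])
       (use K(3) assms test_functions_C_k in \<open>auto intro!: C_k_mult\<close>)
qed

lemma test_function_L2:
  assumes "\<phi> \<in> test_functions U" "\<Omega> \<in> sets lebesgue"
  shows "\<phi> \<in> L2 \<Omega>" "test_grad \<phi> \<in> L2 \<Omega>" "b \<in> Basis \<Longrightarrow> partial_deriv b \<phi> \<in> L2 \<Omega>"
proof -
  obtain K where K: "compact K" "\<And>x. x \<notin> K \<Longrightarrow> \<phi> x = 0" "\<And>x b. x \<notin> K \<Longrightarrow> partial_deriv b \<phi> x = 0"
    by (rule test_functions_support[OF assms(1)]) blast
  show "\<phi> \<in> L2 \<Omega>"
    by (rule L2_continuous_compact_support[OF test_functions_continuous[OF assms(1)] K(1,2) assms(2)])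
  show "test_grad \<phi> \<in> L2 \<Omega>"
    by (rule L2_continuous_compact_support[OF test_grad_continuous[OF assms(1)] K(1) _ assms(2)])
       (simp add: test_grad_def K(3))
  show "partial_deriv b \<phi> \<in> L2 \<Omega>" if "b \<in> Basis"
    by (rule L2_continuous_compact_support[OF test_functions_partial_continuous[OF assms(1) that] K(1,3) assms(2)])
qed

text \<open>Integration by parts: the product rule applies to \<open>\<phi> * \<psi>\<close>, whose
  derivative has integral zero. The set \<open>U\<close> is unrelated to \<open>\<Omega>\<close>,
  since it is \<open>\<psi>\<close> that confines the product to \<open>\<Omega>\<close>.\<close>

lemma test_function_weak_gradient:
  assumes \<phi>: "\<phi> \<in> test_functions U" and \<Omega>: "open \<Omega>"
  shows "weak_gradient \<Omega> \<phi> (test_grad \<phi>)"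
  unfolding weak_gradient_def
proof (intro conjI ballI)
  show "test_grad \<phi> \<in> L2 \<Omega>" using \<phi> \<Omega> by (intro test_function_L2) auto
  fix \<psi> b assume \<psi>: "\<psi> \<in> test_functions \<Omega>" and b: "b \<in> (Basis :: 'a set)"
  have sets: "\<Omega> \<in> sets lebesgue" using \<Omega> by simp
  obtain K where K: "K \<subseteq> \<Omega>" "\<And>x. x \<notin> K \<Longrightarrow> \<psi> x = 0" "\<And>x b. x \<notin> K \<Longrightarrow> partial_deriv b \<psi> x = 0"
    by (rule test_functions_support[OF \<psi>]) blast
  have int: "integrable (lebesgue_on \<Omega>) (\<lambda>x. \<phi> x * partial_deriv b \<psi> x)"
    "integrable (lebesgue_on \<Omega>) (\<lambda>x. partial_deriv b \<phi> x * \<psi> x)"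
    using L2_inner_integrable[OF test_function_L2(1)[OF \<phi> sets] test_function_L2(3)[OF \<psi> sets b]]
      L2_inner_integrable[OF test_function_L2(3)[OF \<phi> sets b] test_function_L2(1)[OF \<psi> sets]] by simp_all
  have pd: "partial_deriv b (\<lambda>x. \<phi> x * \<psi> x) = (\<lambda>x. \<phi> x * partial_deriv b \<psi> x + partial_deriv b \<phi> x * \<psi> x)"
    by (intro ext partial_deriv_mult test_functions_differentiable[OF \<phi>] test_functions_differentiable[OF \<psi>])
  have "(LINT x|lebesgue_on \<Omega>. partial_deriv b (\<lambda>x. \<phi> x * \<psi> x) x) = (LINT x|lborel. partial_deriv b (\<lambda>x. \<phi> x * \<psi> x) x)"
  proof (intro integral_lebesgue_on_continuous_compact_support sets
        test_functions_partial_continuous[OF test_functions_mult[OF \<phi> \<psi>] b])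
    fix x assume "x \<notin> \<Omega>"
    then have "x \<notin> K" using K(1) by blast
    then show "partial_deriv b (\<lambda>x. \<phi> x * \<psi> x) x = 0" by (simp add: pd K)
  qed
  also have "\<dots> = 0"
    by (rule test_partial_deriv_integral_zero[OF test_functions_mult[OF \<phi> \<psi>] b])
  finally show "(LINT x|lebesgue_on \<Omega>. \<phi> x * partial_deriv b \<psi> x) =
      - (LINT x|lebesgue_on \<Omega>. (test_grad \<phi> x \<bullet> b) * \<psi> x)"
    using int b by (simp add: pd test_grad_inner_Basis)
qed

section \<open>Linearity and uniqueness of weak gradients\<close>

lemma weak_gradient_lincomb:
  assumes \<Omega>: "open \<Omega>" and "v \<in> L2 \<Omega>" "w \<in> L2 \<Omega>" "weak_gradient \<Omega> v g" "weak_gradient \<Omega> w h"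
  shows "weak_gradient \<Omega> (\<lambda>x. a * v x + b * w x) (\<lambda>x. a *\<^sub>R g x + b *\<^sub>R h x)"
  unfolding weak_gradient_def
proof (intro conjI ballI)
  have gh: "g \<in> L2 \<Omega>" "h \<in> L2 \<Omega>" using assms by (auto simp: weak_gradient_def)
  then show "(\<lambda>x. a *\<^sub>R g x + b *\<^sub>R h x) \<in> L2 \<Omega>" by (rule L2_lincomb)
  fix \<phi> e assume \<phi>: "\<phi> \<in> test_functions \<Omega>" and e: "e \<in> (Basis :: 'a set)"
  have sets: "\<Omega> \<in> sets lebesgue" using \<Omega> by simp
  have int: "integrable (lebesgue_on \<Omega>) (\<lambda>x. v x * partial_deriv e \<phi> x)"
    "integrable (lebesgue_on \<Omega>) (\<lambda>x. w x * partial_deriv e \<phi> x)"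
    using L2_inner_integrable[OF assms(2) test_function_L2(3)[OF \<phi> sets e]]
      L2_inner_integrable[OF assms(3) test_function_L2(3)[OF \<phi> sets e]] by simp_all
  have e\<phi>: "(\<lambda>x. \<phi> x *\<^sub>R e) \<in> L2 \<Omega>"
  proof -
    obtain K where K: "compact K" "\<And>x. x \<notin> K \<Longrightarrow> \<phi> x = 0"
      by (rule test_functions_support[OF \<phi>]) blast
    show ?thesis
      by (rule L2_continuous_compact_support[OF _ K(1) _ sets])
         (auto simp: K(2) intro!: continuous_intros test_functions_continuous[OF \<phi>])
  qed
  have int': "integrable (lebesgue_on \<Omega>) (\<lambda>x. (g x \<bullet> e) * \<phi> x)"
    "integrable (lebesgue_on \<Omega>) (\<lambda>x. (h x \<bullet> e) * \<phi> x)"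
    using L2_inner_integrable[OF gh(1) e\<phi>] L2_inner_integrable[OF gh(2) e\<phi>] by (simp_all add: mult.commute)
  have "(LINT x|lebesgue_on \<Omega>. (a * v x + b * w x) * partial_deriv e \<phi> x)
      = a * (LINT x|lebesgue_on \<Omega>. v x * partial_deriv e \<phi> x) + b * (LINT x|lebesgue_on \<Omega>. w x * partial_deriv e \<phi> x)"
    using int by (simp add: distrib_right mult.assoc)
  also have "\<dots> = a * - (LINT x|lebesgue_on \<Omega>. (g x \<bullet> e) * \<phi> x) + b * - (LINT x|lebesgue_on \<Omega>. (h x \<bullet> e) * \<phi> x)"
    using assms(4,5) \<phi> e by (simp add: weak_gradient_def)
  also have "\<dots> = - (LINT x|lebesgue_on \<Omega>. ((a *\<^sub>R g x + b *\<^sub>R h x) \<bullet> e) * \<phi> x)"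
    using int' by (simp add: inner_add_left distrib_right mult.assoc)
  finally show "(LINT x|lebesgue_on \<Omega>. (a * v x + b * w x) * partial_deriv e \<phi> x) =
      - (LINT x|lebesgue_on \<Omega>. ((a *\<^sub>R g x + b *\<^sub>R h x) \<bullet> e) * \<phi> x)" .
qed

text \<open>The difference of two weak gradients is a weak gradient of zero, hence componentwise
  orthogonal to all test functions. This is what makes the arbitrary choice in \<open>grad\<close>
  harmless.\<close>

lemma weak_gradient_unique:
  assumes \<Omega>: "open \<Omega>" and v: "v \<in> L2 \<Omega>" and g: "weak_gradient \<Omega> v g" "weak_gradient \<Omega> v h"
  shows "AE x in lebesgue_on \<Omega>. g x = h x"
proof -
  have "weak_gradient \<Omega> (\<lambda>x. 1 * v x + (-1) * v x) (\<lambda>x. 1 *\<^sub>R g x + (-1) *\<^sub>R h x)"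
    by (rule weak_gradient_lincomb[OF \<Omega> v v g])
  then have z: "weak_gradient \<Omega> (\<lambda>x. 0) (\<lambda>x. g x - h x)" by simp
  have "AE x in lebesgue_on \<Omega>. (g x - h x) \<bullet> b = 0" if b: "b \<in> Basis" for b
  proof (rule AE_zero_if_orthogonal_to_test_functions[OF \<Omega>])
    have "(\<lambda>x. g x - h x) \<in> L2 \<Omega>" using z by (simp add: weak_gradient_def)
    then have L: "(\<lambda>x. g x - h x) \<in> borel_measurable (lebesgue_on \<Omega>)"
      "integrable (lebesgue_on \<Omega>) (\<lambda>x. (norm (g x - h x))\<^sup>2)" by (simp_all add: L2_def)
    have m: "(\<lambda>x. (g x - h x) \<bullet> b) \<in> borel_measurable (lebesgue_on \<Omega>)"
      using L(1) by (intro borel_measurable_inner) auto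
    have "norm ((norm ((g x - h x) \<bullet> b))\<^sup>2) \<le> norm ((norm (g x - h x))\<^sup>2)" for x
      using Basis_le_norm[OF b, of "g x - h x"] by (simp add: abs_le_square_iff[symmetric])
    then have "integrable (lebesgue_on \<Omega>) (\<lambda>x. (norm ((g x - h x) \<bullet> b))\<^sup>2)"
      using m by (intro Bochner_Integration.integrable_bound[OF L(2)] AE_I2) auto
    then show "(\<lambda>x. (g x - h x) \<bullet> b) \<in> L2 \<Omega>" using m by (simp add: L2_def)
    show "(LINT x|lebesgue_on \<Omega>. ((g x - h x) \<bullet> b) * \<phi> x) = 0" if "\<phi> \<in> test_functions \<Omega>" for \<phi>
      using z that b by (simp add: weak_gradient_def)
  qed
  then have "AE x in lebesgue_on \<Omega>. \<forall>b\<in>Basis. (g x - h x) \<bullet> b = 0"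
    by (simp add: AE_ball_countable countable_finite)
  then show ?thesis
    by eventually_elim (simp add: euclidean_eq_iff[of "g _"] inner_diff_left)
qed

section \<open>Sobolev spaces as vector spaces with seminorms\<close>

lemma H1_L2: "v \<in> H1 \<Omega> \<Longrightarrow> v \<in> L2 \<Omega>"
  by (simp add: H1_def)

lemma grad_weak_gradient: "v \<in> H1 \<Omega> \<Longrightarrow> weak_gradient \<Omega> v (grad \<Omega> v)"
  unfolding H1_def grad_def using someI_ex[of "weak_gradient \<Omega> v"] by auto

lemma grad_L2: "v \<in> H1 \<Omega> \<Longrightarrow> grad \<Omega> v \<in> L2 \<Omega>"
  using grad_weak_gradient[of v \<Omega>] by (simp add: weak_gradient_def)

lemma H1_lincomb:
  assumes "open \<Omega>" "v \<in> H1 \<Omega>" "w \<in> H1 \<Omega>"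
  shows "(\<lambda>x. a * v x + b * w x) \<in> H1 \<Omega>"
  using weak_gradient_lincomb[OF assms(1) H1_L2[OF assms(2)] H1_L2[OF assms(3)]
      grad_weak_gradient[OF assms(2)] grad_weak_gradient[OF assms(3)]]
    L2_lincomb[OF H1_L2[OF assms(2)] H1_L2[OF assms(3)]]
  by (auto simp: H1_def)

text \<open>Since \<open>grad\<close> is a choice of representative, linearity holds only almost
  everywhere; inner products and norms do not see the exceptional set.\<close>

lemma grad_lincomb:
  assumes "open \<Omega>" "v \<in> H1 \<Omega>" "w \<in> H1 \<Omega>"
  shows "AE x in lebesgue_on \<Omega>. grad \<Omega> (\<lambda>x. a * v x + b * w x) x = a *\<^sub>R grad \<Omega> v x + b *\<^sub>R grad \<Omega> w x"
  using assms
  by (intro weak_gradient_unique[of \<Omega> "\<lambda>x. a * v x + b * w x"] grad_weak_gradient H1_lincomb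
      weak_gradient_lincomb H1_L2) auto

definition grad_inner :: "'a::euclidean_space set \<Rightarrow> ('a \<Rightarrow> real) \<Rightarrow> ('a \<Rightarrow> real) \<Rightarrow> real" where
  "grad_inner \<Omega> v w = l2inner \<Omega> (grad \<Omega> v) (grad \<Omega> w)"

lemma h10norm_sq: "(h10norm \<Omega> v)\<^sup>2 = grad_inner \<Omega> v v"
  by (simp add: h10norm_def grad_inner_def l2norm_sq)

lemma h10norm_nonneg: "0 \<le> h10norm \<Omega> v"
  by (simp add: h10norm_def l2norm_nonneg)

lemma h10norm_lincomb:
  assumes "open \<Omega>" "v \<in> H1 \<Omega>" "w \<in> H1 \<Omega>"
  shows "h10norm \<Omega> (\<lambda>x. a * v x + b * w x) = l2norm \<Omega> (\<lambda>x. a *\<^sub>R grad \<Omega> v x + b *\<^sub>R grad \<Omega> w x)"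
  unfolding h10norm_def using assms
  by (intro l2norm_cong_AE grad_lincomb grad_L2 H1_lincomb L2_lincomb)

lemma h10norm_lincomb_sq:
  assumes "open \<Omega>" "v \<in> H1 \<Omega>" "w \<in> H1 \<Omega>"
  shows "(h10norm \<Omega> (\<lambda>x. a * v x + b * w x))\<^sup>2
    = a\<^sup>2 * (h10norm \<Omega> v)\<^sup>2 + 2 * a * b * grad_inner \<Omega> v w + b\<^sup>2 * (h10norm \<Omega> w)\<^sup>2"
  unfolding h10norm_lincomb[OF assms]
  using assms by (simp add: l2norm_lincomb_sq grad_L2 h10norm_def grad_inner_def)

lemma h10norm_scale:
  assumes "open \<Omega>" "v \<in> H1 \<Omega>"
  shows "h10norm \<Omega> (\<lambda>x. a * v x) = \<bar>a\<bar> * h10norm \<Omega> v"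
  using h10norm_lincomb[OF assms assms(2), of a 0] by (simp add: l2norm_scale h10norm_def)

lemma h10norm_add:
  assumes "open \<Omega>" "v \<in> H1 \<Omega>" "w \<in> H1 \<Omega>"
  shows "h10norm \<Omega> (\<lambda>x. v x + w x) \<le> h10norm \<Omega> v + h10norm \<Omega> w"
  using h10norm_lincomb[OF assms, of 1 1] l2norm_add[OF grad_L2[OF assms(2)] grad_L2[OF assms(3)]]
  by (simp add: h10norm_def)

lemma h10norm_diff:
  assumes "open \<Omega>" "v \<in> H1 \<Omega>" "w \<in> H1 \<Omega>"
  shows "h10norm \<Omega> (\<lambda>x. v x - w x) = l2norm \<Omega> (\<lambda>x. grad \<Omega> v x - grad \<Omega> w x)"
  using h10norm_lincomb[OF assms, of 1 "-1"] by simp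

lemma H1_diff: "open \<Omega> \<Longrightarrow> v \<in> H1 \<Omega> \<Longrightarrow> w \<in> H1 \<Omega> \<Longrightarrow> (\<lambda>x. v x - w x) \<in> H1 \<Omega>"
  using H1_lincomb[of \<Omega> v w 1 "-1"] by simp

lemma test_function_H1: "open \<Omega> \<Longrightarrow> \<phi> \<in> test_functions U \<Longrightarrow> \<phi> \<in> H1 \<Omega>"
  using test_function_weak_gradient test_function_L2(1)[of \<phi> U \<Omega>] by (auto simp: H1_def)

lemma test_function_h10norm:
  assumes "open \<Omega>" "\<phi> \<in> test_functions U"
  shows "h10norm \<Omega> \<phi> = l2norm \<Omega> (test_grad \<phi>)"
  unfolding h10norm_def
  using assms test_function_H1[OF assms]
  by (intro l2norm_cong_AE grad_L2 weak_gradient_unique[of \<Omega> \<phi>] grad_weak_gradient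
      test_function_weak_gradient H1_L2 test_function_L2) auto

lemma h1norm_tendsto_zero_iff:
  "((\<lambda>n. h1norm \<Omega> (vs n)) \<longlongrightarrow> 0) F \<longleftrightarrow>
   ((\<lambda>n. l2norm \<Omega> (vs n)) \<longlongrightarrow> 0) F \<and> ((\<lambda>n. h10norm \<Omega> (vs n)) \<longlongrightarrow> 0) F" (is "?L \<longleftrightarrow> ?R")
proof
  assume L: ?L
  have "\<forall>n. norm (l2norm \<Omega> (vs n)) \<le> h1norm \<Omega> (vs n)" "\<forall>n. norm (h10norm \<Omega> (vs n)) \<le> h1norm \<Omega> (vs n)"
    by (auto simp: h1norm_def h10norm_def intro!: real_le_rsqrt)
  then show ?R
    by (intro conjI Lim_null_comparison[OF always_eventually L]) auto
next
  assume R: ?R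
  then have "((\<lambda>n. sqrt ((l2norm \<Omega> (vs n))\<^sup>2 + (h10norm \<Omega> (vs n))\<^sup>2)) \<longlongrightarrow> sqrt (0\<^sup>2 + 0\<^sup>2)) F"
    by (intro tendsto_intros) auto
  then show ?L by (simp add: h1norm_def h10norm_def)
qed

lemma H10_H1: "v \<in> H10 \<Omega> \<Longrightarrow> v \<in> H1 \<Omega>"
  by (simp add: H10_def)

lemma H10_L2: "v \<in> H10 \<Omega> \<Longrightarrow> v \<in> L2 \<Omega>"
  by (simp add: H10_H1 H1_L2)

lemma H10_iff:
  "v \<in> H10 \<Omega> \<longleftrightarrow> v \<in> H1 \<Omega> \<and> (\<exists>\<phi>. (\<forall>n. \<phi> n \<in> test_functions \<Omega>) \<and>
     (\<lambda>n. l2norm \<Omega> (\<lambda>x. \<phi> n x - v x)) \<longlonglongrightarrow> 0 \<and> (\<lambda>n. h10norm \<Omega> (\<lambda>x. \<phi> n x - v x)) \<longlonglongrightarrow> 0)"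
  unfolding H10_def by (auto simp: h1norm_tendsto_zero_iff fun_diff_def)

lemma test_function_H10:
  assumes "open \<Omega>" "\<phi> \<in> test_functions \<Omega>"
  shows "\<phi> \<in> H10 \<Omega>"
proof -
  have "h10norm \<Omega> (\<lambda>x. 0) = 0"
    using h10norm_scale[OF assms(1) test_function_H1[OF assms], of 0] by simp
  moreover have "l2norm \<Omega> (\<lambda>x. 0::real) = 0" by (simp add: l2norm_def l2inner_def)
  ultimately show ?thesis
    unfolding H10_iff using assms test_function_H1[OF assms] by (auto intro!: exI[of _ "\<lambda>n. \<phi>"])
qed

lemma H10_lincomb:
  assumes \<Omega>: "open \<Omega>" and v: "v \<in> H10 \<Omega>" and w: "w \<in> H10 \<Omega>"
  shows "(\<lambda>x. a * v x + b * w x) \<in> H10 \<Omega>"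
proof -
  obtain \<phi> where \<phi>: "\<And>n. \<phi> n \<in> test_functions \<Omega>" "(\<lambda>n. l2norm \<Omega> (\<lambda>x. \<phi> n x - v x)) \<longlonglongrightarrow> 0"
    "(\<lambda>n. h10norm \<Omega> (\<lambda>x. \<phi> n x - v x)) \<longlonglongrightarrow> 0" using v unfolding H10_iff by blast
  obtain \<psi> where \<psi>: "\<And>n. \<psi> n \<in> test_functions \<Omega>" "(\<lambda>n. l2norm \<Omega> (\<lambda>x. \<psi> n x - w x)) \<longlonglongrightarrow> 0"
    "(\<lambda>n. h10norm \<Omega> (\<lambda>x. \<psi> n x - w x)) \<longlonglongrightarrow> 0" using w unfolding H10_iff by blast
  have d: "(\<lambda>x. \<phi> n x - v x) \<in> H1 \<Omega>" "(\<lambda>x. \<psi> n x - w x) \<in> H1 \<Omega>" for n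
    using test_function_H1[OF \<Omega>] \<phi>(1) \<psi>(1) H10_H1[OF v] H10_H1[OF w] by (auto intro!: H1_diff \<Omega>)
  have eq: "(\<lambda>x. (a * \<phi> n x + b * \<psi> n x) - (a * v x + b * w x)) = (\<lambda>x. a * (\<phi> n x - v x) + b * (\<psi> n x - w x))" for n
    by (simp add: algebra_simps)
  have L: "\<forall>n. norm (l2norm \<Omega> (\<lambda>x. (a * \<phi> n x + b * \<psi> n x) - (a * v x + b * w x)))
      \<le> \<bar>a\<bar> * l2norm \<Omega> (\<lambda>x. \<phi> n x - v x) + \<bar>b\<bar> * l2norm \<Omega> (\<lambda>x. \<psi> n x - w x)"
  proof
    fix n
    have "(\<lambda>x. a * (\<phi> n x - v x)) \<in> L2 \<Omega>" "(\<lambda>x. b * (\<psi> n x - w x)) \<in> L2 \<Omega>"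
      using L2_lincomb[OF H1_L2[OF d(1)[of n]] H1_L2[OF d(1)[of n]], of a 0]
        L2_lincomb[OF H1_L2[OF d(2)[of n]] H1_L2[OF d(2)[of n]], of b 0] by simp_all
    from l2norm_add[OF this] show "norm (l2norm \<Omega> (\<lambda>x. (a * \<phi> n x + b * \<psi> n x) - (a * v x + b * w x)))
      \<le> \<bar>a\<bar> * l2norm \<Omega> (\<lambda>x. \<phi> n x - v x) + \<bar>b\<bar> * l2norm \<Omega> (\<lambda>x. \<psi> n x - w x)"
      using l2norm_scale[of \<Omega> a "\<lambda>x. \<phi> n x - v x"] l2norm_scale[of \<Omega> b "\<lambda>x. \<psi> n x - w x"]
      unfolding eq by (simp add: l2norm_nonneg)
  qed
  have H: "\<forall>n. norm (h10norm \<Omega> (\<lambda>x. (a * \<phi> n x + b * \<psi> n x) - (a * v x + b * w x)))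
      \<le> \<bar>a\<bar> * h10norm \<Omega> (\<lambda>x. \<phi> n x - v x) + \<bar>b\<bar> * h10norm \<Omega> (\<lambda>x. \<psi> n x - w x)"
  proof
    fix n
    have "(\<lambda>x. a * (\<phi> n x - v x)) \<in> H1 \<Omega>" "(\<lambda>x. b * (\<psi> n x - w x)) \<in> H1 \<Omega>"
      using H1_lincomb[OF \<Omega> d(1)[of n] d(1)[of n], of a 0]
        H1_lincomb[OF \<Omega> d(2)[of n] d(2)[of n], of b 0] by simp_all
    from h10norm_add[OF \<Omega> this] show "norm (h10norm \<Omega> (\<lambda>x. (a * \<phi> n x + b * \<psi> n x) - (a * v x + b * w x)))
      \<le> \<bar>a\<bar> * h10norm \<Omega> (\<lambda>x. \<phi> n x - v x) + \<bar>b\<bar> * h10norm \<Omega> (\<lambda>x. \<psi> n x - w x)"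
      using h10norm_scale[OF \<Omega> d(1)] h10norm_scale[OF \<Omega> d(2)]
      unfolding eq by (simp add: h10norm_nonneg)
  qed
  have "(\<lambda>n. \<bar>a\<bar> * l2norm \<Omega> (\<lambda>x. \<phi> n x - v x) + \<bar>b\<bar> * l2norm \<Omega> (\<lambda>x. \<psi> n x - w x)) \<longlonglongrightarrow> \<bar>a\<bar> * 0 + \<bar>b\<bar> * 0"
    "(\<lambda>n. \<bar>a\<bar> * h10norm \<Omega> (\<lambda>x. \<phi> n x - v x) + \<bar>b\<bar> * h10norm \<Omega> (\<lambda>x. \<psi> n x - w x)) \<longlonglongrightarrow> \<bar>a\<bar> * 0 + \<bar>b\<bar> * 0"
    using \<phi> \<psi> by (intro tendsto_intros; simp)+
  then have "(\<lambda>n. l2norm \<Omega> (\<lambda>x. (a * \<phi> n x + b * \<psi> n x) - (a * v x + b * w x))) \<longlonglongrightarrow> 0"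
    "(\<lambda>n. h10norm \<Omega> (\<lambda>x. (a * \<phi> n x + b * \<psi> n x) - (a * v x + b * w x))) \<longlonglongrightarrow> 0"
    using Lim_null_comparison[OF always_eventually[OF L]] Lim_null_comparison[OF always_eventually[OF H]] by simp_all
  moreover have "(\<lambda>x. a * \<phi> n x + b * \<psi> n x) \<in> test_functions \<Omega>" for n
    by (intro test_functions_lincomb \<phi> \<psi>)
  ultimately show ?thesis
    unfolding H10_iff using H1_lincomb[OF \<Omega> H10_H1[OF v] H10_H1[OF w]]
    by (intro conjI exI[of _ "\<lambda>n x. a * \<phi> n x + b * \<psi> n x"]) auto
qed

lemma H10_diff: "open \<Omega> \<Longrightarrow> v \<in> H10 \<Omega> \<Longrightarrow> w \<in> H10 \<Omega> \<Longrightarrow> (\<lambda>x. v x - w x) \<in> H10 \<Omega>"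
  using H10_lincomb[of \<Omega> v w 1 "-1"] by simp

text \<open>The shift is cut into \<open>Suc n\<close> equal steps. Cauchy-Schwarz for the
  telescoping sum and translation invariance of the integral reduce the estimate to one small step,
  whose scaled square converges to the squared directional derivative.\<close>

lemma test_translation_bound:
  assumes \<phi>: "\<phi> \<in> test_functions U"
  shows "(LINT x|lborel. (\<phi> (x + z) - \<phi> x)\<^sup>2) \<le> (norm z)\<^sup>2 * (LINT x|lborel. (norm (test_grad \<phi> x))\<^sup>2)"
proof -
  obtain K where K: "compact K" "\<And>x. x \<notin> K \<Longrightarrow> \<phi> x = 0" "\<And>x b. x \<notin> K \<Longrightarrow> partial_deriv b \<phi> x = 0"
    by (rule test_functions_support[OF \<phi>]) blast
  have cont: "continuous_on UNIV \<phi>" by (rule test_functions_continuous[OF \<phi>])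
  have int: "integrable lborel (\<lambda>x. (\<phi> (x + w) - \<phi> (x + w'))\<^sup>2)" for w w'
  proof (rule integrable_continuous_compact_support)
    show "compact ((\<lambda>x. x - w) ` K \<union> (\<lambda>x. x - w') ` K)"
      using K(1) by (intro compact_Un compact_continuous_image continuous_intros)
    show "(\<phi> (x + w) - \<phi> (x + w'))\<^sup>2 = 0" if "x \<notin> (\<lambda>x. x - w) ` K \<union> (\<lambda>x. x - w') ` K" for x
      using that K(2)[of "x + w"] K(2)[of "x + w'"] by (force simp: image_iff)
    show "continuous_on UNIV (\<lambda>x. (\<phi> (x + w) - \<phi> (x + w'))\<^sup>2)"
      by (intro continuous_intros continuous_on_compose2[OF cont]) auto
  qed
  have step: "(LINT x|lborel. (\<phi> (x + z) - \<phi> x)\<^sup>2)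
      \<le> (LINT x|lborel. (real (Suc n) * (\<phi> (x + (1 / real (Suc n)) *\<^sub>R z) - \<phi> x))\<^sup>2)" for n
  proof -
    define N where "N = real (Suc n)"
    have N: "N > 0" by (simp add: N_def)
    define w where "w m = (real m / N) *\<^sub>R z" for m
    have w: "w 0 = 0" "w (Suc m) = (1 / N) *\<^sub>R z + w m" for m
      using N by (auto simp: w_def add_divide_distrib scaleR_left_distrib)
    have w_Suc_n: "w (Suc n) = z"
      by (simp add: w_def N_def del: of_nat_Suc)
    have pointwise: "(\<phi> (x + z) - \<phi> x)\<^sup>2 \<le> N * (\<Sum>m<Suc n. (\<phi> (x + w (Suc m)) - \<phi> (x + w m))\<^sup>2)" for x
    proof -
      have "\<phi> (x + z) - \<phi> x = (\<Sum>m<Suc n. \<phi> (x + w (Suc m)) - \<phi> (x + w m))"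
        using sum_lessThan_telescope[of "\<lambda>m. \<phi> (x + w m)" "Suc n"] by (simp add: w(1) w_Suc_n del: sum.lessThan_Suc)
      also have "\<dots>\<^sup>2 \<le> (\<Sum>m<Suc n. (\<phi> (x + w (Suc m)) - \<phi> (x + w m))\<^sup>2) * real (card {..<Suc n})"
        by (rule sum_squared_le_sum_of_squares) 
      finally show ?thesis by (simp add: N_def mult.commute)
    qed
    have tr: "(LINT x|lborel. (\<phi> (x + w (Suc m)) - \<phi> (x + w m))\<^sup>2)
        = (LINT x|lborel. (\<phi> (x + (1 / N) *\<^sub>R z) - \<phi> x)\<^sup>2)" for m
    proof -
      have "(\<lambda>x. (\<phi> (x + (1 / N) *\<^sub>R z) - \<phi> x)\<^sup>2) \<in> borel_measurable borel"
        by (intro borel_measurable_continuous_onI continuous_intros continuous_on_compose2[OF cont]) auto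
      from lborel_integral_translation[OF this, of "w m"] show ?thesis
        by (simp add: w(2) add_ac)
    qed
    have "(LINT x|lborel. (\<phi> (x + z) - \<phi> x)\<^sup>2)
        \<le> (LINT x|lborel. N * (\<Sum>m<Suc n. (\<phi> (x + w (Suc m)) - \<phi> (x + w m))\<^sup>2))"
      using int[of z 0] pointwise
      by (intro integral_mono integrable_mult_right Bochner_Integration.integrable_sum int) simp_all
    also have "\<dots> = N * (\<Sum>m<Suc n. (LINT x|lborel. (\<phi> (x + w (Suc m)) - \<phi> (x + w m))\<^sup>2))"
      by (simp only: integral_mult_right_zero Bochner_Integration.integral_sum[OF int])
    also have "\<dots> = N * (N * (LINT x|lborel. (\<phi> (x + (1 / N) *\<^sub>R z) - \<phi> x)\<^sup>2))"
      unfolding tr by (simp add: N_def)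
    finally show ?thesis
      unfolding N_def[symmetric] by (simp add: power_mult_distrib power2_eq_square[of N] mult.assoc)
  qed
  have "(LINT x|lborel. (\<phi> (x + z) - \<phi> x)\<^sup>2) \<le> (LINT x|lborel. (test_grad \<phi> x \<bullet> z)\<^sup>2)"
    by (rule LIMSEQ_le_const[OF test_difference_quotient_integral[OF \<phi>, of "\<lambda>y. y\<^sup>2"]])
       (use step in \<open>auto intro!: continuous_intros\<close>)
  also have "\<dots> \<le> (LINT x|lborel. (norm z)\<^sup>2 * (norm (test_grad \<phi> x))\<^sup>2)"
  proof (rule integral_mono)
    have g: "test_grad \<phi> x = 0" if "x \<notin> K" for x using K(3)[OF that] by (simp add: test_grad_def)
    show "integrable lborel (\<lambda>x. (test_grad \<phi> x \<bullet> z)\<^sup>2)" "integrable lborel (\<lambda>x. (norm z)\<^sup>2 * (norm (test_grad \<phi> x))\<^sup>2)"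
      by (rule integrable_continuous_compact_support[OF _ K(1)];
          auto simp: g intro!: continuous_intros test_grad_continuous[OF \<phi>])+
    fix x
    have "\<bar>test_grad \<phi> x \<bullet> z\<bar>\<^sup>2 \<le> (norm (test_grad \<phi> x) * norm z)\<^sup>2"
      by (intro power_mono Cauchy_Schwarz_ineq2) simp
    then show "(test_grad \<phi> x \<bullet> z)\<^sup>2 \<le> (norm z)\<^sup>2 * (norm (test_grad \<phi> x))\<^sup>2"
      by (simp add: power_mult_distrib mult.commute)
  qed
  finally show ?thesis by simp
qed

section \<open>The first Dirichlet eigenvalue\<close>

text \<open>Cauchy-Schwarz against the constant one on \<open>S\<close>, read off from the
  nonnegative integral of \<open>(1 + x * g z)\<^sup>2\<close> as a quadratic in
  \<open>x\<close>.\<close>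

lemma integral_square_le:
  fixes g :: "'a::euclidean_space \<Rightarrow> real"
  assumes g: "continuous_on UNIV g" and S: "compact S"
  shows "(LINT z|lborel. indicator S z * g z)\<^sup>2 \<le> measure lborel S * (LINT z|lborel. indicator S z * (g z)\<^sup>2)"
proof (rule discriminant_bound)
  have int: "integrable lborel (\<lambda>z. indicator S z * f z)" if "continuous_on UNIV f" for f :: "'a \<Rightarrow> real"
    using borel_integrable_compact[OF S continuous_on_subset[OF that]] by simp
  have int1: "integrable lborel (indicator S :: 'a \<Rightarrow> real)"
    using int[of "\<lambda>_. 1"] by simp
  have int2: "integrable lborel (\<lambda>z. indicator S z * (g z)\<^sup>2)"
    by (intro int continuous_intros g)
  fix x :: real
  have "0 \<le> (LINT z|lborel. indicator S z * (1 + x * g z)\<^sup>2)" by simp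
  also have "(\<lambda>z. indicator S z * (1 + x * g z)\<^sup>2)
      = (\<lambda>z. indicator S z + 2 * x * (indicator S z * g z) + x\<^sup>2 * (indicator S z * (g z)\<^sup>2))"
    by (auto simp: power2_eq_square algebra_simps)
  also have "(LINT z|lborel. \<dots> z) = measure lborel S + 2 * (LINT z|lborel. indicator S z * g z) * x
      + (LINT z|lborel. indicator S z * (g z)\<^sup>2) * x\<^sup>2"
    using int[OF g] int1 int2 by simp
  finally show "0 \<le> measure lborel S + 2 * (LINT z|lborel. indicator S z * g z) * x
      + (LINT z|lborel. indicator S z * (g z)\<^sup>2) * x\<^sup>2" .
qed simp

text \<open>After exchanging the order of integration the translation bound applies for each fixed
  \<open>z\<close> in the ball, where \<open>norm z \<le> h\<close>. The exchange is justified
  because the integrand has compact support in the product space.\<close>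

lemma test_average_Fubini:
  fixes \<phi> :: "'a::euclidean_space \<Rightarrow> real"
  assumes \<phi>: "\<phi> \<in> test_functions U" and h: "0 \<le> h"
  defines "q \<equiv> \<lambda>x. LINT z|lborel. indicator (cball 0 h) z * (\<phi> (x + z) - \<phi> x)\<^sup>2"
  shows "integrable lborel q"
    and "(LINT x|lborel. q x) \<le> measure lborel (cball 0 h :: 'a set) * (h\<^sup>2 * (LINT x|lborel. (norm (test_grad \<phi> x))\<^sup>2))"
proof -
  let ?G = "LINT x|lborel. (norm (test_grad \<phi> x))\<^sup>2"
  let ?f = "\<lambda>x z. indicator (cball 0 h) z * (\<phi> (x + z) - \<phi> x)\<^sup>2 :: real"
  obtain K where K: "compact K" "\<And>x. x \<notin> K \<Longrightarrow> \<phi> x = 0"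
    by (rule test_functions_support[OF \<phi>]) blast
  have cont: "continuous_on UNIV \<phi>" by (rule test_functions_continuous[OF \<phi>])
  define K' where "K' = {x - y |x y. x \<in> K \<and> y \<in> cball 0 h}"
  have K': "compact K'" unfolding K'_def using K(1) by (intro compact_differences) auto
  have zero: "\<phi> (x + z) - \<phi> x = 0" if "x \<notin> K'" "z \<in> cball 0 h" for x z
  proof -
    have "x + z \<in> K \<Longrightarrow> x \<in> K'"
      unfolding K'_def using that(2) by (intro CollectI exI[of _ "x + z"] exI[of _ z]) simp
    moreover have "x \<in> K \<Longrightarrow> x \<in> K'"
      unfolding K'_def using h by (intro CollectI exI[of _ x] exI[of _ 0]) simp
    ultimately show ?thesis using that(1) K(2) by fastforce
  qed
  have "integrable lborel (\<lambda>p. indicator (K' \<times> cball 0 h) p *\<^sub>R (\<phi> (fst p + snd p) - \<phi> (fst p))\<^sup>2)"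
    using K' by (intro borel_integrable_compact compact_Times compact_cball continuous_intros
        continuous_on_compose2[OF cont]) auto
  also have "(\<lambda>p. indicator (K' \<times> cball 0 h) p *\<^sub>R (\<phi> (fst p + snd p) - \<phi> (fst p))\<^sup>2) = (\<lambda>(x, z). ?f x z)"
    using zero by (auto simp: fun_eq_iff split: split_indicator)
  finally have int: "integrable (lborel \<Otimes>\<^sub>M lborel) (\<lambda>(x, z). ?f x z)"
    by (simp add: lborel_prod)
  show "integrable lborel q"
    unfolding q_def using lborel_pair.integrable_fst'[OF int] by simp
  have "(LINT x|lborel. q x) = (LINT z|lborel. LINT x|lborel. ?f x z)"
    unfolding q_def by (rule lborel_pair.Fubini_integral[OF int, symmetric])
  also have "\<dots> \<le> (LINT z|lborel. indicator (cball (0::'a) h) z * (h\<^sup>2 * ?G))"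
  proof (rule integral_mono)
    show "integrable lborel (\<lambda>z. LINT x|lborel. ?f x z)"
      by (rule lborel_pair.integrable_snd[OF int])
    show "integrable lborel (\<lambda>z. indicator (cball 0 h) z * (h\<^sup>2 * ?G))"
      using emeasure_bounded_finite[OF bounded_cball, of 0 h] by (intro integrable_mult_left integrable_real_indicator) auto
    fix z :: 'a
    show "(LINT x|lborel. ?f x z) \<le> indicator (cball 0 h) z * (h\<^sup>2 * ?G)"
    proof (cases "z \<in> cball 0 h")
      case True
      have "(LINT x|lborel. (\<phi> (x + z) - \<phi> x)\<^sup>2) \<le> (norm z)\<^sup>2 * ?G"
        by (rule test_translation_bound[OF \<phi>])
      also have "\<dots> \<le> h\<^sup>2 * ?G" using True by (intro mult_right_mono power_mono) auto
      finally show ?thesis using True by simp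
    qed simp
  qed
  also have "\<dots> = measure lborel (cball 0 h :: 'a set) * (h\<^sup>2 * ?G)" by simp
  finally show "(LINT x|lborel. q x) \<le> measure lborel (cball 0 h :: 'a set) * (h\<^sup>2 * ?G)" .
qed

text \<open>The averages of \<open>\<phi>\<close> over balls of radius \<open>h\<close> are close to \<open>\<phi>\<close> in \<open>L\<^sup>2\<close> and Lipschitz in the
  centre, both with constants controlled by the gradient. A fine net of centres therefore
  determines \<open>\<phi>\<close> up to a small multiple of its gradient.\<close>

lemma test_function_finite_averages_bound:
  fixes \<Omega> :: "'a::euclidean_space set"
  assumes \<Omega>: "open \<Omega>" "bounded \<Omega>" and \<epsilon>: "\<epsilon> > 0"
  obtains P :: "'a set" and h C :: real where "finite P" "C \<ge> 0"
    "\<And>\<phi>. \<phi> \<in> test_functions \<Omega> \<Longrightarrow> (l2norm \<Omega> \<phi>)\<^sup>2 \<le> \<epsilon> * (h10norm \<Omega> \<phi>)\<^sup>2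
       + C * (\<Sum>p\<in>P. (l2inner \<Omega> \<phi> (indicator (cball p h)))\<^sup>2)"
proof -
  \<comment> \<open>The radius is chosen so that the deviation from the average contributes
    \<open>2 * h\<^sup>2 = \<epsilon> / 2\<close> times the squared gradient norm.\<close>
  define h where "h = sqrt (\<epsilon> / 4)"
  have h: "h > 0" "h\<^sup>2 = \<epsilon> / 4" using \<epsilon> by (auto simp: h_def)
  define B where "B = (cball 0 h :: 'a set)"
  define V where "V = measure lborel B"
  have V: "V > 0" using h(1) content_cball_pos[of h "0::'a"] by (simp add: V_def B_def)
  define m where "m = measure lborel \<Omega>"
  have m: "m \<ge> 0" by (simp add: m_def)
  \<comment> \<open>The mesh of the net makes the second error
    \<open>m * 4 * \<delta>\<^sup>2 / V\<close> at most \<open>\<epsilon> / 2\<close>;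
    \<open>m + 1\<close> in the denominator also covers a vanishing \<open>m\<close>.\<close>
  define \<delta> where "\<delta> = sqrt (\<epsilon> * V / (8 * (m + 1)))"
  have \<delta>: "\<delta> > 0" "\<delta>\<^sup>2 = \<epsilon> * V / (8 * (m + 1))" using \<epsilon> V m by (auto simp: \<delta>_def)
  have "compact (closure \<Omega>)" using \<Omega>(2) by (simp add: compact_closure)
  then obtain P where P: "finite P" "closure \<Omega> \<subseteq> (\<Union>p\<in>P. ball p \<delta>)"
    using compactE_image[of "closure \<Omega>" "closure \<Omega>" "\<lambda>p. ball p \<delta>"] \<delta>(1)
    by (metis UN_I centre_in_ball open_ball subsetI)
  show ?thesis
  proof (rule that[of P "4 * m / V\<^sup>2" h])
    show "finite P" "0 \<le> 4 * m / V\<^sup>2" using P(1) m by auto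
    fix \<phi> assume \<phi>: "\<phi> \<in> test_functions \<Omega>"
    have sets: "\<Omega> \<in> sets lebesgue" using \<Omega>(1) by simp
    have cont: "continuous_on UNIV \<phi>" by (rule test_functions_continuous[OF \<phi>])
    obtain K where K: "compact K" "K \<subseteq> \<Omega>" "\<And>x. x \<notin> K \<Longrightarrow> \<phi> x = 0" "\<And>x b. x \<notin> K \<Longrightarrow> partial_deriv b \<phi> x = 0"
      by (rule test_functions_support[OF \<phi>]) blast
    have off: "\<phi> x = 0" "test_grad \<phi> x = 0" if "x \<notin> \<Omega>" for x
    proof -
      have "x \<notin> K" using that K(2) by blast
      then show "\<phi> x = 0" "test_grad \<phi> x = 0" by (simp_all add: K(3,4) test_grad_def)
    qed
    define G where "G = (LINT x|lborel. (norm (test_grad \<phi> x))\<^sup>2)"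
    have G: "G \<ge> 0" "(h10norm \<Omega> \<phi>)\<^sup>2 = G"
      unfolding G_def test_function_h10norm[OF \<Omega>(1) \<phi>] l2norm_sq_integral
      by (auto intro!: integral_lebesgue_on_continuous_compact_support sets continuous_intros
          test_grad_continuous[OF \<phi>] simp: off)
    have L: "(l2norm \<Omega> \<phi>)\<^sup>2 = (LINT x|lborel. (\<phi> x)\<^sup>2)"
      unfolding l2norm_sq_integral real_norm_def power2_abs
      by (intro integral_lebesgue_on_continuous_compact_support sets continuous_intros cont) (simp add: off)
    define A where "A x = (LINT z|lborel. indicator B z * \<phi> (x + z))" for x
    have B: "compact B" by (simp add: B_def)
    have intB: "integrable lborel (\<lambda>z. indicator B z * f z)" if "continuous_on UNIV f" for f :: "'a \<Rightarrow> real"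
      using borel_integrable_compact[OF B continuous_on_subset[OF that]] by simp
    have shift: "continuous_on UNIV (\<lambda>z. \<phi> (x + z))" for x
      by (intro continuous_on_compose2[OF cont] continuous_intros) auto
    \<comment> \<open>Writing the unnormalized averages as inner products with fixed
      \<open>L2\<close> functions is what lets the estimate pass from test functions to
      limits.\<close>
    have A_l2inner: "A p = l2inner \<Omega> \<phi> (indicator (cball p h))" for p
    proof -
      have meas: "(\<lambda>y. indicator (cball p h) y * \<phi> y) \<in> borel_measurable borel"
        using borel_measurable_continuous_onI[OF cont] by (intro borel_measurable_times borel_measurable_indicator) auto
      have "(LINT y|lborel. indicator (cball p h) (y + p) * \<phi> (y + p)) = (LINT y|lborel. indicator (cball p h) y * \<phi> y)"
        by (rule lborel_integral_translation[OF meas])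
      moreover have "indicator (cball p h) (y + p) = (indicator B y :: real)" for y
        by (auto simp: B_def dist_norm split: split_indicator)
      ultimately have "A p = (LINT y|lborel. indicator (cball p h) y * \<phi> y)"
        by (simp add: A_def add.commute)
      also have "\<dots> = (LINT y|lebesgue. indicator (cball p h) y * \<phi> y)"
        using meas by (simp add: integral_completion)
      also have "\<dots> = l2inner \<Omega> \<phi> (indicator (cball p h))"
        unfolding l2inner_def using sets
        by (auto simp: integral_restrict_space off intro!: Bochner_Integration.integral_cong split: split_indicator)
      finally show ?thesis .
    qed
    define q where "q x = (LINT z|lborel. indicator B z * (\<phi> (x + z) - \<phi> x)\<^sup>2)" for x
    have q: "integrable lborel q" "(LINT x|lborel. q x) \<le> V * (h\<^sup>2 * G)"
      using test_average_Fubini[OF \<phi>, of h] h(1) by (simp_all add: q_def[abs_def] B_def V_def G_def)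
    have q_nonneg: "q x \<ge> 0" for x by (simp add: q_def)
    define S where "S = (\<Sum>p\<in>P. (A p)\<^sup>2)"
    have near: "(V * \<phi> x - A x)\<^sup>2 \<le> V * q x" for x
    proof -
      have "A x - V * \<phi> x = (LINT z|lborel. indicator B z * \<phi> (x + z)) - (LINT z|lborel. indicator B z * \<phi> x)"
        by (simp add: A_def V_def)
      also have "\<dots> = (LINT z|lborel. indicator B z * (\<phi> (x + z) - \<phi> x))"
        using intB[OF shift[of x]] intB[of "\<lambda>_. \<phi> x"] by (simp add: right_diff_distrib)
      finally have "(V * \<phi> x - A x)\<^sup>2 = (LINT z|lborel. indicator B z * (\<phi> (x + z) - \<phi> x))\<^sup>2"
        by (metis power2_commute)
      also have "\<dots> \<le> V * q x"
        unfolding V_def q_def by (intro integral_square_le B continuous_intros shift)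
      finally show ?thesis .
    qed
    \<comment> \<open>After Cauchy-Schwarz on the ball the integral is enlarged to the whole space,
      where the translation bound with shift \<open>x - p\<close> applies.\<close>
    have Lip: "(A x - A p)\<^sup>2 \<le> V * (\<delta>\<^sup>2 * G)" if "x \<in> ball p \<delta>" for x p
    proof -
      have "A x - A p = (LINT z|lborel. indicator B z * (\<phi> (x + z) - \<phi> (p + z)))"
        unfolding A_def using intB[OF shift] by (simp add: right_diff_distrib)
      then have "(A x - A p)\<^sup>2 \<le> V * (LINT z|lborel. indicator B z * (\<phi> (x + z) - \<phi> (p + z))\<^sup>2)"
        unfolding V_def by (simp only:) (intro integral_square_le B continuous_intros shift)
      also have "(LINT z|lborel. indicator B z * (\<phi> (x + z) - \<phi> (p + z))\<^sup>2) \<le> (LINT z|lborel. (\<phi> (x + z) - \<phi> (p + z))\<^sup>2)"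
      proof (rule integral_mono)
        show "integrable lborel (\<lambda>z. indicator B z * (\<phi> (x + z) - \<phi> (p + z))\<^sup>2)"
          by (intro intB continuous_intros shift)
        show "integrable lborel (\<lambda>z. (\<phi> (x + z) - \<phi> (p + z))\<^sup>2)"
        proof (rule integrable_continuous_compact_support)
          show "compact ((\<lambda>y. y - x) ` K \<union> (\<lambda>y. y - p) ` K)"
            using K(1) by (intro compact_Un compact_continuous_image continuous_intros)
          show "(\<phi> (x + z) - \<phi> (p + z))\<^sup>2 = 0" if "z \<notin> (\<lambda>y. y - x) ` K \<union> (\<lambda>y. y - p) ` K" for z
            using that K(3)[of "x + z"] K(3)[of "p + z"] by (force simp: image_iff)
        qed (intro continuous_intros shift)
      qed (auto split: split_indicator)
      also have "(LINT z|lborel. (\<phi> (x + z) - \<phi> (p + z))\<^sup>2) = (LINT z|lborel. (\<phi> (z + (x - p)) - \<phi> z)\<^sup>2)"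
      proof -
        have "(\<lambda>z. (\<phi> (z + (x - p)) - \<phi> z)\<^sup>2) \<in> borel_measurable borel"
          using shift[of "x - p"] by (intro borel_measurable_continuous_onI continuous_intros cont) (simp add: add.commute)
        from lborel_integral_translation[OF this, of p] show ?thesis by (simp add: add_ac)
      qed
      also have "\<dots> \<le> (norm (x - p))\<^sup>2 * G" unfolding G_def by (rule test_translation_bound[OF \<phi>])
      also have "\<dots> \<le> \<delta>\<^sup>2 * G"
        using that G by (intro mult_right_mono power_mono) (auto simp: dist_norm norm_minus_commute)
      finally show ?thesis using V by simp
    qed
    \<comment> \<open>Two applications of
      \<open>(a + b)\<^sup>2 \<le> 2 * a\<^sup>2 + 2 * b\<^sup>2\<close> lead from
      \<open>V * \<phi> x\<close> to the average at \<open>x\<close> and on to the average at a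
      nearby point of the net. Off \<open>\<Omega>\<close> the function vanishes, so the constant
      terms may carry the indicator and stay integrable.\<close>
    have bound: "(\<phi> x)\<^sup>2 \<le> (2 / V) * q x + indicator \<Omega> x * (4 * \<delta>\<^sup>2 * G / V + 4 * S / V\<^sup>2)" for x
    proof (cases "x \<in> \<Omega>")
      case False
      then show ?thesis using q_nonneg[of x] V by (simp add: off)
    next
      case True
      then obtain p where p: "p \<in> P" "x \<in> ball p \<delta>" using P(2) closure_subset by blast
      have "(A p)\<^sup>2 \<le> S" unfolding S_def using p(1) P(1) by (intro member_le_sum) auto
      have two: "(a + b)\<^sup>2 \<le> 2 * a\<^sup>2 + 2 * b\<^sup>2" for a b :: real
        using sum_squares_bound[of a b] by (simp add: power2_sum)
      have "V\<^sup>2 * (\<phi> x)\<^sup>2 = ((V * \<phi> x - A x) + A x)\<^sup>2" by (simp add: power_mult_distrib)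
      also have "\<dots> \<le> 2 * (V * \<phi> x - A x)\<^sup>2 + 2 * (A x)\<^sup>2" by (rule two)
      finally have "V\<^sup>2 * (\<phi> x)\<^sup>2 \<le> 2 * (V * \<phi> x - A x)\<^sup>2 + 2 * (A x)\<^sup>2" .
      moreover have "(A x)\<^sup>2 \<le> 2 * (A x - A p)\<^sup>2 + 2 * (A p)\<^sup>2" using two[of "A x - A p" "A p"] by simp
      ultimately have "V\<^sup>2 * (\<phi> x)\<^sup>2 \<le> 2 * (V * q x) + 4 * (V * (\<delta>\<^sup>2 * G)) + 4 * S"
        using near[of x] Lip[OF p(2)] \<open>(A p)\<^sup>2 \<le> S\<close> by linarith
      then have "(\<phi> x)\<^sup>2 \<le> (2 * (V * q x) + 4 * (V * (\<delta>\<^sup>2 * G)) + 4 * S) / V\<^sup>2"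
        using V by (simp add: pos_le_divide_eq mult.commute)
      also have "\<dots> = (2 / V) * q x + (4 * \<delta>\<^sup>2 * G / V + 4 * S / V\<^sup>2)"
        using V by (simp add: field_simps power2_eq_square)
      finally show ?thesis using True by simp
    qed
    have fin: "integrable lborel (indicator \<Omega> :: 'a \<Rightarrow> real)"
      using \<Omega> emeasure_bounded_finite[OF \<Omega>(2)] by (intro integrable_real_indicator) auto
    have "(LINT x|lborel. (\<phi> x)\<^sup>2) \<le> (LINT x|lborel. (2 / V) * q x + indicator \<Omega> x * (4 * \<delta>\<^sup>2 * G / V + 4 * S / V\<^sup>2))"
    proof (rule integral_mono)
      show "integrable lborel (\<lambda>x. (\<phi> x)\<^sup>2)"
        by (rule integrable_continuous_compact_support[OF _ K(1)]) (auto simp: K(3) intro!: continuous_intros cont)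
      show "integrable lborel (\<lambda>x. (2 / V) * q x + indicator \<Omega> x * (4 * \<delta>\<^sup>2 * G / V + 4 * S / V\<^sup>2))"
        by (intro Bochner_Integration.integrable_add integrable_mult_right integrable_mult_left q(1) fin)
    qed (rule bound)
    also have "\<dots> = (2 / V) * (LINT x|lborel. q x) + m * (4 * \<delta>\<^sup>2 * G / V + 4 * S / V\<^sup>2)"
      using q(1) fin by (simp add: m_def)
    also have "\<dots> \<le> (2 / V) * (V * (h\<^sup>2 * G)) + m * (4 * \<delta>\<^sup>2 * G / V + 4 * S / V\<^sup>2)"
      using q(2) V by (intro add_right_mono mult_left_mono) auto
    also have "\<dots> = \<epsilon> / 2 * G + (m / (m + 1)) * (\<epsilon> / 2 * G) + 4 * m / V\<^sup>2 * S"
    proof -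
      have "m + 1 \<noteq> 0" using m by simp
      then have "m * (4 * \<delta>\<^sup>2 * G / V) = (m / (m + 1)) * (\<epsilon> / 2 * G)"
        using V unfolding \<delta>(2) by (simp add: divide_simps)
      then show ?thesis using V by (simp add: h(2) distrib_left mult_ac)
    qed
    also have "\<dots> \<le> \<epsilon> / 2 * G + 1 * (\<epsilon> / 2 * G) + 4 * m / V\<^sup>2 * S"
      using m G(1) \<epsilon> by (intro add_mono mult_right_mono order_refl) auto
    also have "\<dots> = \<epsilon> * G + 4 * m / V\<^sup>2 * S" by simp
    finally show "(l2norm \<Omega> \<phi>)\<^sup>2 \<le> \<epsilon> * (h10norm \<Omega> \<phi>)\<^sup>2
       + 4 * m / V\<^sup>2 * (\<Sum>p\<in>P. (l2inner \<Omega> \<phi> (indicator (cball p h)))\<^sup>2)"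
      by (simp add: L G(2) S_def A_l2inner)
  qed
qed

section \<open>Passage to limits in \<open>H10\<close>\<close>

lemma h10norm_tendsto:
  assumes "open \<Omega>" "v \<in> H1 \<Omega>" "\<And>n. vs n \<in> H1 \<Omega>"
    and "((\<lambda>n. h10norm \<Omega> (\<lambda>x. vs n x - v x)) \<longlongrightarrow> 0) F"
  shows "((\<lambda>n. h10norm \<Omega> (vs n)) \<longlongrightarrow> h10norm \<Omega> v) F"
  unfolding h10norm_def
  using assms by (intro l2norm_tendsto grad_L2) (simp_all add: h10norm_diff)

lemma indicator_L2:
  assumes "S \<in> sets lebesgue" "bounded \<Omega>" "open \<Omega>"
  shows "(indicator S :: 'a::euclidean_space \<Rightarrow> real) \<in> L2 \<Omega>"
proof -
  have "emeasure lebesgue (\<Omega> \<inter> S) < \<infinity>"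
  proof -
    have "emeasure lebesgue (\<Omega> \<inter> S) \<le> emeasure lebesgue \<Omega>"
      using assms(3) by (intro emeasure_mono) auto
    also have "\<dots> < \<infinity>" using emeasure_bounded_finite[OF assms(2)] assms(3) by simp
    finally show ?thesis .
  qed
  then have "integrable lebesgue (indicator (\<Omega> \<inter> S) :: 'a \<Rightarrow> real)"
    using assms by (intro integrable_real_indicator) auto
  moreover have "(\<lambda>x. indicator \<Omega> x *\<^sub>R (norm (indicator S x :: real))\<^sup>2) = (indicator (\<Omega> \<inter> S) :: 'a \<Rightarrow> real)"
    by (auto split: split_indicator)
  ultimately have "integrable (lebesgue_on \<Omega>) (\<lambda>x. (norm (indicator S x :: real))\<^sup>2)"
    using assms(3) by (simp add: integrable_restrict_space)
  moreover have "(indicator S :: 'a \<Rightarrow> real) \<in> borel_measurable (lebesgue_on \<Omega>)"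
    using assms(1) by (intro measurable_restrict_space1) auto
  ultimately show ?thesis by (simp add: L2_def)
qed

text \<open>Both sides converge along approximating test functions: the norms by the triangle
  inequality, the averages because each pairs with a fixed element of \<open>L2\<close>. The net and
  the constants do not depend on the function.\<close>

lemma H10_finite_averages_bound:
  fixes \<Omega> :: "'a::euclidean_space set"
  assumes \<Omega>: "open \<Omega>" "bounded \<Omega>" and \<epsilon>: "\<epsilon> > 0"
  obtains P :: "'a set" and h C :: real where "finite P" "C \<ge> 0"
    "\<And>v. v \<in> H10 \<Omega> \<Longrightarrow> (l2norm \<Omega> v)\<^sup>2 \<le> \<epsilon> * (h10norm \<Omega> v)\<^sup>2
       + C * (\<Sum>p\<in>P. (l2inner \<Omega> v (indicator (cball p h)))\<^sup>2)"
proof -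
  obtain P :: "'a set" and h C where *: "finite P" "C \<ge> 0"
    "\<And>\<phi>. \<phi> \<in> test_functions \<Omega> \<Longrightarrow> (l2norm \<Omega> \<phi>)\<^sup>2 \<le> \<epsilon> * (h10norm \<Omega> \<phi>)\<^sup>2
       + C * (\<Sum>p\<in>P. (l2inner \<Omega> \<phi> (indicator (cball p h)))\<^sup>2)"
    by (rule test_function_finite_averages_bound[OF \<Omega> \<epsilon>]) blast
  show ?thesis
  proof (rule that[OF *(1,2)])
    fix v assume v: "v \<in> H10 \<Omega>"
    then obtain \<phi> where \<phi>: "\<And>n. \<phi> n \<in> test_functions \<Omega>" "(\<lambda>n. l2norm \<Omega> (\<lambda>x. \<phi> n x - v x)) \<longlonglongrightarrow> 0"
      "(\<lambda>n. h10norm \<Omega> (\<lambda>x. \<phi> n x - v x)) \<longlonglongrightarrow> 0" unfolding H10_iff by blast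
    have H1: "\<phi> n \<in> H1 \<Omega>" for n by (rule test_function_H1[OF \<Omega>(1) \<phi>(1)])
    have lim: "(\<lambda>n. l2norm \<Omega> (\<phi> n)) \<longlonglongrightarrow> l2norm \<Omega> v" "(\<lambda>n. h10norm \<Omega> (\<phi> n)) \<longlonglongrightarrow> h10norm \<Omega> v"
      "(\<lambda>n. l2inner \<Omega> (\<phi> n) (indicator (cball p h))) \<longlonglongrightarrow> l2inner \<Omega> v (indicator (cball p h))" for p
      using l2norm_tendsto[OF H10_L2[OF v] H1_L2[OF H1] \<phi>(2)] h10norm_tendsto[OF \<Omega>(1) H10_H1[OF v] H1 \<phi>(3)]
        l2inner_tendsto[OF H10_L2[OF v] indicator_L2[OF _ \<Omega>(2,1)] H1_L2[OF H1] \<phi>(2)] by auto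
    show "(l2norm \<Omega> v)\<^sup>2 \<le> \<epsilon> * (h10norm \<Omega> v)\<^sup>2 + C * (\<Sum>p\<in>P. (l2inner \<Omega> v (indicator (cball p h)))\<^sup>2)"
      by (rule LIMSEQ_le[of "\<lambda>n. (l2norm \<Omega> (\<phi> n))\<^sup>2" _
            "\<lambda>n. \<epsilon> * (h10norm \<Omega> (\<phi> n))\<^sup>2 + C * (\<Sum>p\<in>P. (l2inner \<Omega> (\<phi> n) (indicator (cball p h)))\<^sup>2)"])
         (use *(3)[OF \<phi>(1)] in \<open>auto intro!: tendsto_intros lim\<close>)
  qed
qed

lemma bounded_finite_family_convergent_subsequence:
  fixes a :: "nat \<Rightarrow> 'i \<Rightarrow> real"
  assumes "finite P" "\<And>p. p \<in> P \<Longrightarrow> bounded (range (\<lambda>n. a n p))"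
  shows "\<exists>r. strict_mono r \<and> (\<forall>p\<in>P. convergent (\<lambda>n. a (r n) p))"
  using assms
proof (induction P rule: finite_induct)
  case empty
  then show ?case using strict_mono_id by auto
next
  case (insert p P)
  then obtain r where r: "strict_mono r" "\<forall>p\<in>P. convergent (\<lambda>n. a (r n) p)" by auto
  have "bounded (range (\<lambda>n. a (r n) p))"
    using insert.prems[of p] by (rule bounded_subset) auto
  then obtain l s where s: "strict_mono s" "((\<lambda>n. a (r n) p) \<circ> s) \<longlonglongrightarrow> l"
    using bounded_imp_convergent_subsequence by blast
  have "convergent (\<lambda>n. a ((r \<circ> s) n) p')" if "p' \<in> insert p P" for p'
  proof (cases "p' = p")
    case True
    then show ?thesis using s(2) by (auto simp: convergent_def o_def)
  next
    case False
    then have "convergent (\<lambda>n. a (r n) p')" using that r(2) by simp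
    from convergent_subseq_convergent[OF this s(1)] show ?thesis by (simp add: o_def)
  qed
  then show ?case using strict_mono_o[OF r(1) s(1)] by blast
qed

text \<open>Diagonal argument: for every \<open>n\<close> a test function within
  \<open>1 / (n + 1)\<close> of \<open>vs n\<close> in both seminorms.\<close>

lemma H10_closed:
  assumes \<Omega>: "open \<Omega>" and v: "v \<in> H1 \<Omega>" and vs: "\<And>n. vs n \<in> H10 \<Omega>"
    and lim: "(\<lambda>n. l2norm \<Omega> (\<lambda>x. vs n x - v x)) \<longlonglongrightarrow> 0" "(\<lambda>n. h10norm \<Omega> (\<lambda>x. vs n x - v x)) \<longlonglongrightarrow> 0"
  shows "v \<in> H10 \<Omega>"
proof -
  have "\<exists>\<phi>. \<phi> \<in> test_functions \<Omega> \<and> l2norm \<Omega> (\<lambda>x. \<phi> x - vs n x) < 1 / real (Suc n) \<and>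
      h10norm \<Omega> (\<lambda>x. \<phi> x - vs n x) < 1 / real (Suc n)" for n
  proof -
    obtain \<phi> where \<phi>: "\<And>k. \<phi> k \<in> test_functions \<Omega>" "(\<lambda>k. l2norm \<Omega> (\<lambda>x. \<phi> k x - vs n x)) \<longlonglongrightarrow> 0"
      "(\<lambda>k. h10norm \<Omega> (\<lambda>x. \<phi> k x - vs n x)) \<longlonglongrightarrow> 0" using vs[of n] unfolding H10_iff by blast
    have "\<forall>\<^sub>F k in sequentially. l2norm \<Omega> (\<lambda>x. \<phi> k x - vs n x) < 1 / real (Suc n)"
      "\<forall>\<^sub>F k in sequentially. h10norm \<Omega> (\<lambda>x. \<phi> k x - vs n x) < 1 / real (Suc n)"
      by (rule order_tendstoD(2)[OF \<phi>(2)] order_tendstoD(2)[OF \<phi>(3)]; simp)+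
    from eventually_happens[OF eventually_conj[OF this]] show ?thesis using \<phi>(1) by auto
  qed
  then obtain \<phi> where \<phi>: "\<And>n. \<phi> n \<in> test_functions \<Omega>" "\<And>n. l2norm \<Omega> (\<lambda>x. \<phi> n x - vs n x) < 1 / real (Suc n)"
    "\<And>n. h10norm \<Omega> (\<lambda>x. \<phi> n x - vs n x) < 1 / real (Suc n)" by metis
  have inv: "(\<lambda>n. 1 / real (Suc n)) \<longlonglongrightarrow> 0" using lim_1_over_n[THEN LIMSEQ_Suc] .
  have H1: "\<phi> n \<in> H1 \<Omega>" "vs n \<in> H1 \<Omega>" for n using test_function_H1[OF \<Omega> \<phi>(1)] H10_H1[OF vs] by auto
  have L: "\<forall>n. norm (l2norm \<Omega> (\<lambda>x. \<phi> n x - v x)) \<le> 1 / real (Suc n) + l2norm \<Omega> (\<lambda>x. vs n x - v x)"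
  proof
    fix n
    show "norm (l2norm \<Omega> (\<lambda>x. \<phi> n x - v x)) \<le> 1 / real (Suc n) + l2norm \<Omega> (\<lambda>x. vs n x - v x)"
      using l2norm_diff_triangle[OF H1_L2[OF H1(1)[of n]] H1_L2[OF H1(2)[of n]] H1_L2[OF v]] \<phi>(2)[of n]
      by (simp add: l2norm_nonneg del: of_nat_Suc)
  qed
  have H: "\<forall>n. norm (h10norm \<Omega> (\<lambda>x. \<phi> n x - v x)) \<le> 1 / real (Suc n) + h10norm \<Omega> (\<lambda>x. vs n x - v x)"
  proof
    fix n
    show "norm (h10norm \<Omega> (\<lambda>x. \<phi> n x - v x)) \<le> 1 / real (Suc n) + h10norm \<Omega> (\<lambda>x. vs n x - v x)"
      using h10norm_add[OF \<Omega> H1_diff[OF \<Omega> H1(1)[of n] H1(2)[of n]] H1_diff[OF \<Omega> H1(2)[of n] v]] \<phi>(3)[of n]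
      by (simp add: h10norm_nonneg del: of_nat_Suc)
  qed
  have "(\<lambda>n. l2norm \<Omega> (\<lambda>x. \<phi> n x - v x)) \<longlonglongrightarrow> 0"
    by (rule Lim_null_comparison[OF always_eventually[OF L]]) (use tendsto_add[OF inv lim(1)] in simp)
  moreover have "(\<lambda>n. h10norm \<Omega> (\<lambda>x. \<phi> n x - v x)) \<longlonglongrightarrow> 0"
    by (rule Lim_null_comparison[OF always_eventually[OF H]]) (use tendsto_add[OF inv lim(2)] in simp)
  ultimately show ?thesis unfolding H10_iff using v \<phi>(1) by blast
qed

text \<open>The defining identity consists of inner products with fixed elements of
  \<open>L2\<close>, so it survives convergence of the functions and of their gradients.\<close>

lemma weak_gradient_limit:
  assumes \<Omega>: "open \<Omega>" and L2: "v \<in> L2 \<Omega>" "g \<in> L2 \<Omega>" "\<And>n. vs n \<in> L2 \<Omega>"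
    and wg: "\<And>n. weak_gradient \<Omega> (vs n) (gs n)"
    and lim: "(\<lambda>n. l2norm \<Omega> (\<lambda>x. vs n x - v x)) \<longlonglongrightarrow> 0" "(\<lambda>n. l2norm \<Omega> (\<lambda>x. gs n x - g x)) \<longlonglongrightarrow> 0"
  shows "weak_gradient \<Omega> v g"
  unfolding weak_gradient_def
proof (intro conjI ballI)
  fix \<phi> b assume \<phi>: "\<phi> \<in> test_functions \<Omega>" and b: "b \<in> (Basis :: 'a set)"
  have sets: "\<Omega> \<in> sets lebesgue" using \<Omega> by simp
  obtain K where K: "compact K" "\<And>x. x \<notin> K \<Longrightarrow> \<phi> x = 0"
    by (rule test_functions_support[OF \<phi>]) blast
  have b\<phi>: "(\<lambda>x. \<phi> x *\<^sub>R b) \<in> L2 \<Omega>"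
    by (rule L2_continuous_compact_support[OF _ K(1) _ sets])
       (auto simp: K(2) intro!: continuous_intros test_functions_continuous[OF \<phi>])
  have gs: "gs n \<in> L2 \<Omega>" for n using wg by (simp add: weak_gradient_def)
  have "l2inner \<Omega> (vs n) (partial_deriv b \<phi>) = - l2inner \<Omega> (gs n) (\<lambda>x. \<phi> x *\<^sub>R b)" for n
    using wg[of n] \<phi> b by (simp add: weak_gradient_def l2inner_def mult.commute)
  moreover have "(\<lambda>n. l2inner \<Omega> (vs n) (partial_deriv b \<phi>)) \<longlonglongrightarrow> l2inner \<Omega> v (partial_deriv b \<phi>)"
    by (intro l2inner_tendsto L2 lim test_function_L2(3)[OF \<phi> sets b])
  moreover have "(\<lambda>n. - l2inner \<Omega> (gs n) (\<lambda>x. \<phi> x *\<^sub>R b)) \<longlonglongrightarrow> - l2inner \<Omega> g (\<lambda>x. \<phi> x *\<^sub>R b)"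
    by (intro tendsto_minus l2inner_tendsto L2 lim b\<phi> gs)
  ultimately have "l2inner \<Omega> v (partial_deriv b \<phi>) = - l2inner \<Omega> g (\<lambda>x. \<phi> x *\<^sub>R b)"
    using LIMSEQ_unique by simp
  then show "(LINT x|lebesgue_on \<Omega>. v x * partial_deriv b \<phi> x) = - (LINT x|lebesgue_on \<Omega>. (g x \<bullet> b) * \<phi> x)"
    by (simp add: l2inner_def mult.commute)
qed (rule L2)

text \<open>Functions and gradients converge separately in \<open>L2\<close>, and closedness of the
  weak gradient ties the two limits together. Only convergence of the norms is recorded, which is
  what the minimization uses.\<close>

lemma H10_complete:
  assumes \<Omega>: "open \<Omega>" and vs: "\<And>n. vs n \<in> H10 \<Omega>"
    and C1: "\<And>e. e > 0 \<Longrightarrow> \<exists>N. \<forall>m\<ge>N. \<forall>n\<ge>N. l2norm \<Omega> (\<lambda>x. vs m x - vs n x) < e"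
    and C2: "\<And>e. e > 0 \<Longrightarrow> \<exists>N. \<forall>m\<ge>N. \<forall>n\<ge>N. h10norm \<Omega> (\<lambda>x. vs m x - vs n x) < e"
  obtains v where "v \<in> H10 \<Omega>" "(\<lambda>n. l2norm \<Omega> (vs n)) \<longlonglongrightarrow> l2norm \<Omega> v" "(\<lambda>n. h10norm \<Omega> (vs n)) \<longlonglongrightarrow> h10norm \<Omega> v"
proof -
  have H1: "vs n \<in> H1 \<Omega>" for n by (rule H10_H1[OF vs])
  obtain v where v: "v \<in> L2 \<Omega>" "(\<lambda>n. l2norm \<Omega> (\<lambda>x. vs n x - v x)) \<longlonglongrightarrow> 0"
    by (rule L2_complete[of vs \<Omega>]) (use C1 H1_L2[OF H1] in auto)
  obtain g where g: "g \<in> L2 \<Omega>" "(\<lambda>n. l2norm \<Omega> (\<lambda>x. grad \<Omega> (vs n) x - g x)) \<longlonglongrightarrow> 0"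
    by (rule L2_complete[of "\<lambda>n. grad \<Omega> (vs n)" \<Omega>])
       (use C2 grad_L2[OF H1] in \<open>auto simp: h10norm_diff[OF \<Omega> H1 H1]\<close>)
  have wg: "weak_gradient \<Omega> v g"
    by (rule weak_gradient_limit[OF \<Omega> v(1) g(1) H1_L2[OF H1] grad_weak_gradient[OF H1] v(2) g(2)])
  then have vH1: "v \<in> H1 \<Omega>" using v(1) by (auto simp: H1_def)
  have "l2norm \<Omega> (\<lambda>x. grad \<Omega> (vs n) x - g x) = h10norm \<Omega> (\<lambda>x. vs n x - v x)" for n
    unfolding h10norm_diff[OF \<Omega> H1 vH1]
  proof (rule l2norm_cong_AE)
    show "AE x in lebesgue_on \<Omega>. grad \<Omega> (vs n) x - g x = grad \<Omega> (vs n) x - grad \<Omega> v x"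
      using weak_gradient_unique[OF \<Omega> v(1) wg grad_weak_gradient[OF vH1]] by eventually_elim simp
  qed (intro L2_diff grad_L2 H1 vH1 g(1))+
  then have h: "(\<lambda>n. h10norm \<Omega> (\<lambda>x. vs n x - v x)) \<longlonglongrightarrow> 0" using g(2) by simp
  have "v \<in> H10 \<Omega>" by (rule H10_closed[OF \<Omega> vH1 vs v(2) h])
  moreover have "(\<lambda>n. l2norm \<Omega> (vs n)) \<longlonglongrightarrow> l2norm \<Omega> v"
    by (rule l2norm_tendsto[OF v(1) H1_L2[OF H1] v(2)])
  moreover have "(\<lambda>n. h10norm \<Omega> (vs n)) \<longlonglongrightarrow> h10norm \<Omega> v"
    by (rule h10norm_tendsto[OF \<Omega> vH1 H1 h])
  ultimately show ?thesis by (rule that)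
qed

text \<open>Compactness is used for a single \<open>\<epsilon>\<close> only: for a minimizing sequence the parallelogram law bounds
  the gradient of a difference by \<open>\<mu>\<close> times its \<open>L\<^sup>2\<close> norm plus a null sequence, and \<open>\<epsilon> * \<mu> \<le> 1 / 2\<close> lets
  the left-hand side absorb this term.\<close>

lemma Rayleigh_minimizer:
  fixes \<Omega> :: "'a::euclidean_space set"
  assumes \<Omega>: "open \<Omega>" "bounded \<Omega>" and nontrivial: "v0 \<in> H10 \<Omega>" "l2norm \<Omega> v0 \<noteq> 0"
  obtains w \<mu> where "w \<in> H10 \<Omega>" "l2norm \<Omega> w = 1" "(h10norm \<Omega> w)\<^sup>2 = \<mu>"
    "\<And>v. v \<in> H10 \<Omega> \<Longrightarrow> \<mu> * (l2norm \<Omega> v)\<^sup>2 \<le> (h10norm \<Omega> v)\<^sup>2"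
proof -
  define R where "R = {(h10norm \<Omega> v)\<^sup>2 |v. v \<in> H10 \<Omega> \<and> l2norm \<Omega> v = 1}"
  define \<mu> where "\<mu> = Inf R"
  have scale: "(\<lambda>x. c * v x) \<in> H10 \<Omega>" "l2norm \<Omega> (\<lambda>x. c * v x) = \<bar>c\<bar> * l2norm \<Omega> v"
    "h10norm \<Omega> (\<lambda>x. c * v x) = \<bar>c\<bar> * h10norm \<Omega> v" if "v \<in> H10 \<Omega>" for v c
    using H10_lincomb[OF \<Omega>(1) that that, of c 0] l2norm_scale[of \<Omega> c v] h10norm_scale[OF \<Omega>(1) H10_H1[OF that], of c]
    by simp_all
  have normalize: "(h10norm \<Omega> v)\<^sup>2 / (l2norm \<Omega> v)\<^sup>2 \<in> R" if "v \<in> H10 \<Omega>" "l2norm \<Omega> v \<noteq> 0" for v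
    unfolding R_def
    using scale[OF that(1), of "1 / l2norm \<Omega> v"] that(2) l2norm_nonneg[of \<Omega> v]
    by (intro CollectI exI[of _ "\<lambda>x. (1 / l2norm \<Omega> v) * v x"]) (auto simp: power_divide)
  have R: "R \<noteq> {}" "bdd_below R"
    using normalize[OF nontrivial] by (auto simp: R_def intro: bdd_belowI[of _ 0])
  have \<mu>: "\<mu> \<ge> 0" unfolding \<mu>_def using R(1) by (intro cInf_greatest) (auto simp: R_def)
  have lower: "\<mu> * (l2norm \<Omega> v)\<^sup>2 \<le> (h10norm \<Omega> v)\<^sup>2" if v: "v \<in> H10 \<Omega>" for v
  proof (cases "l2norm \<Omega> v = 0")
    case False
    have "\<mu> \<le> (h10norm \<Omega> v)\<^sup>2 / (l2norm \<Omega> v)\<^sup>2"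
      unfolding \<mu>_def by (rule cInf_lower[OF normalize[OF v False] R(2)])
    then show ?thesis using False by (simp add: pos_le_divide_eq)
  qed simp
  have "\<exists>v. v \<in> H10 \<Omega> \<and> l2norm \<Omega> v = 1 \<and> (h10norm \<Omega> v)\<^sup>2 < \<mu> + 1 / real (Suc n)" for n
  proof -
    have "Inf R < \<mu> + 1 / real (Suc n)" by (simp add: \<mu>_def)
    then show ?thesis using cInf_lessD[OF R(1)] unfolding R_def by blast
  qed
  then obtain w where w: "\<And>n. w n \<in> H10 \<Omega>" "\<And>n. l2norm \<Omega> (w n) = 1" "\<And>n. (h10norm \<Omega> (w n))\<^sup>2 < \<mu> + 1 / real (Suc n)"
    by metis
  \<comment> \<open>So far \<open>\<mu>\<close> is only known to be nonnegative; adding 1 keeps the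
    quotient defined and still gives \<open>\<epsilon> * \<mu> \<le> 1 / 2\<close>.\<close>
  define \<epsilon> where "\<epsilon> = 1 / (2 * (\<mu> + 1))"
  have \<epsilon>: "\<epsilon> > 0" "\<epsilon> * \<mu> \<le> 1 / 2" using \<mu> by (auto simp: \<epsilon>_def field_simps)
  obtain P :: "'a set" and h C where PhC: "finite P" "C \<ge> 0"
    "\<And>v. v \<in> H10 \<Omega> \<Longrightarrow> (l2norm \<Omega> v)\<^sup>2 \<le> \<epsilon> * (h10norm \<Omega> v)\<^sup>2
       + C * (\<Sum>p\<in>P. (l2inner \<Omega> v (indicator (cball p h)))\<^sup>2)"
    by (rule H10_finite_averages_bound[OF \<Omega> \<epsilon>(1)]) blast
  let ?l = "\<lambda>v p. l2inner \<Omega> v (indicator (cball p h))"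
  have ind: "(indicator (cball p h) :: 'a \<Rightarrow> real) \<in> L2 \<Omega>" for p by (intro indicator_L2 \<Omega>) auto
  have "bounded (range (\<lambda>n. ?l (w n) p))" for p
  proof (rule boundedI[of _ "l2norm \<Omega> (indicator (cball p h) :: 'a \<Rightarrow> real)"])
    fix y assume "y \<in> range (\<lambda>n. ?l (w n) p)"
    then show "norm y \<le> l2norm \<Omega> (indicator (cball p h) :: 'a \<Rightarrow> real)"
      using l2_Cauchy_Schwarz[OF H10_L2[OF w(1)] ind] w(2) by auto
  qed
  from bounded_finite_family_convergent_subsequence[OF PhC(1), of "\<lambda>n. ?l (w n)", OF this]
  obtain r where r: "strict_mono r" "\<forall>p\<in>P. convergent (\<lambda>n. ?l (w (r n)) p)" by blast
  define u where "u n = w (r n)" for n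
  have u: "u n \<in> H10 \<Omega>" "l2norm \<Omega> (u n) = 1" "(h10norm \<Omega> (u n))\<^sup>2 \<le> \<mu> + 1 / real (Suc n)" for n
  proof -
    show "u n \<in> H10 \<Omega>" "l2norm \<Omega> (u n) = 1" by (simp_all add: u_def w)
    have "1 / real (Suc (r n)) \<le> 1 / real (Suc n)"
      using seq_suble[OF r(1), of n] by (simp add: field_simps)
    then show "(h10norm \<Omega> (u n))\<^sup>2 \<le> \<mu> + 1 / real (Suc n)" using w(3)[of "r n"] by (simp add: u_def del: of_nat_Suc)
  qed
  let ?D = "\<lambda>m n. (l2norm \<Omega> (\<lambda>x. u m x - u n x))\<^sup>2"
  let ?H = "\<lambda>m n. (h10norm \<Omega> (\<lambda>x. u m x - u n x))\<^sup>2"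
  \<comment> \<open>The lower bound is applied to the sum \<open>u m + u n\<close>, whose squared
    norm is \<open>4\<close> minus that of the difference; both energies exceed \<open>\<mu>\<close>
    by at most the reciprocals, so the multiples of \<open>\<mu>\<close> cancel.\<close>
  have par: "?H m n \<le> \<mu> * ?D m n + 2 / real (Suc m) + 2 / real (Suc n)" for m n
  proof -
    have "\<mu> * (l2norm \<Omega> (\<lambda>x. u m x + u n x))\<^sup>2 \<le> (h10norm \<Omega> (\<lambda>x. u m x + u n x))\<^sup>2"
      using lower[OF H10_lincomb[OF \<Omega>(1) u(1)[of m] u(1)[of n], of 1 1]] by simp
    moreover have "?D m n = 2 - 2 * l2inner \<Omega> (u m) (u n)" "(l2norm \<Omega> (\<lambda>x. u m x + u n x))\<^sup>2 = 2 + 2 * l2inner \<Omega> (u m) (u n)"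
      using l2norm_lincomb_sq[OF H10_L2[OF u(1)[of m]] H10_L2[OF u(1)[of n]], of 1 "-1"]
        l2norm_lincomb_sq[OF H10_L2[OF u(1)[of m]] H10_L2[OF u(1)[of n]], of 1 1] u(2) by simp_all
    moreover have "?H m n = (h10norm \<Omega> (u m))\<^sup>2 - 2 * grad_inner \<Omega> (u m) (u n) + (h10norm \<Omega> (u n))\<^sup>2"
      "(h10norm \<Omega> (\<lambda>x. u m x + u n x))\<^sup>2 = (h10norm \<Omega> (u m))\<^sup>2 + 2 * grad_inner \<Omega> (u m) (u n) + (h10norm \<Omega> (u n))\<^sup>2"
      using h10norm_lincomb_sq[OF \<Omega>(1) H10_H1[OF u(1)[of m]] H10_H1[OF u(1)[of n]], of 1 "-1"]
        h10norm_lincomb_sq[OF \<Omega>(1) H10_H1[OF u(1)[of m]] H10_H1[OF u(1)[of n]], of 1 1] by simp_all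
    ultimately have "\<mu> * (4 - ?D m n) \<le> 2 * (h10norm \<Omega> (u m))\<^sup>2 + 2 * (h10norm \<Omega> (u n))\<^sup>2 - ?H m n"
      by simp
    then have "?H m n \<le> \<mu> * ?D m n - 4 * \<mu> + 2 * (h10norm \<Omega> (u m))\<^sup>2 + 2 * (h10norm \<Omega> (u n))\<^sup>2"
      by (simp add: right_diff_distrib)
    also have "\<dots> \<le> \<mu> * ?D m n + 2 * (1 / real (Suc m)) + 2 * (1 / real (Suc n))"
      using u(3)[of m] u(3)[of n] by linarith
    finally show ?thesis by simp
  qed
  \<comment> \<open>The factors \<open>2\<close> come from absorbing half of the squared distance
    into the left-hand side.\<close>
  define E where "E m n = 2 * \<epsilon> * (2 / real (Suc m) + 2 / real (Suc n)) + 2 * C * (\<Sum>p\<in>P. (?l (u m) p - ?l (u n) p)\<^sup>2)" for m n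
  have D: "?D m n \<le> E m n" for m n
  proof -
    have "?l (\<lambda>x. u m x - u n x) p = ?l (u m) p - ?l (u n) p" for p
      using l2inner_lincomb_left[OF H10_L2[OF u(1)[of m]] H10_L2[OF u(1)[of n]] ind[of p], of 1 "-1"] by simp
    then have "?D m n \<le> \<epsilon> * ?H m n + C * (\<Sum>p\<in>P. (?l (u m) p - ?l (u n) p)\<^sup>2)"
      using PhC(3)[OF H10_diff[OF \<Omega>(1) u(1)[of m] u(1)[of n]]] by simp
    also have "\<epsilon> * ?H m n \<le> \<epsilon> * (\<mu> * ?D m n + (2 / real (Suc m) + 2 / real (Suc n)))"
      using par[of m n] \<epsilon>(1) by (intro mult_left_mono) auto
    also have "\<dots> = (\<epsilon> * \<mu>) * ?D m n + \<epsilon> * (2 / real (Suc m) + 2 / real (Suc n))"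
      by (simp only: distrib_left mult.assoc)
    also have "(\<epsilon> * \<mu>) * ?D m n \<le> 1 / 2 * ?D m n" using \<epsilon>(2) by (intro mult_right_mono) auto
    finally show ?thesis unfolding E_def by (simp add: mult.assoc del: of_nat_Suc)
  qed
  have E_small: "\<exists>N. \<forall>m\<ge>N. \<forall>n\<ge>N. E m n < e" if "e > 0" for e
  proof -
    obtain L where L: "\<And>p. p \<in> P \<Longrightarrow> (\<lambda>n. ?l (u n) p) \<longlonglongrightarrow> L p"
      using r(2) unfolding convergent_def u_def by metis
    have "((\<lambda>(m, n). E m n) \<longlongrightarrow> 2 * \<epsilon> * (0 + 0) + 2 * C * (\<Sum>p\<in>P. (L p - L p)\<^sup>2)) (sequentially \<times>\<^sub>F sequentially)"
    proof -
      have fst: "filterlim fst sequentially (sequentially \<times>\<^sub>F sequentially)"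
        and snd: "filterlim snd sequentially (sequentially \<times>\<^sub>F sequentially)"
        by (rule filterlim_fst filterlim_snd)+
      have inv: "(\<lambda>n. 2 / real (Suc n)) \<longlonglongrightarrow> 0"
        using tendsto_mult_right_zero[OF lim_1_over_n[THEN LIMSEQ_Suc], of 2] by simp
      have "((\<lambda>x. E (fst x) (snd x)) \<longlongrightarrow> 2 * \<epsilon> * (0 + 0) + 2 * C * (\<Sum>p\<in>P. (L p - L p)\<^sup>2)) (sequentially \<times>\<^sub>F sequentially)"
        unfolding E_def
        by (intro tendsto_add tendsto_mult tendsto_const tendsto_sum tendsto_power tendsto_diff
            filterlim_compose[OF inv fst] filterlim_compose[OF inv snd]
            filterlim_compose[OF L fst] filterlim_compose[OF L snd])
      then show ?thesis by (simp add: case_prod_beta')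
    qed
    then have "((\<lambda>(m, n). E m n) \<longlongrightarrow> 0) (sequentially \<times>\<^sub>F sequentially)" by simp
    from order_tendstoD(2)[OF this that]
    have "\<forall>\<^sub>F x in sequentially \<times>\<^sub>F sequentially. E (fst x) (snd x) < e" by (simp add: case_prod_beta')
    then obtain Q Q' where Q: "\<forall>\<^sub>F n in sequentially. Q n" "\<forall>\<^sub>F n in sequentially. Q' n" "\<And>m n. Q m \<Longrightarrow> Q' n \<Longrightarrow> E m n < e"
      unfolding eventually_prod_filter by auto
    from Q(1,2) obtain N N' where "\<And>n. n \<ge> N \<Longrightarrow> Q n" "\<And>n. n \<ge> N' \<Longrightarrow> Q' n"
      unfolding eventually_sequentially by blast
    then show ?thesis using Q(3) by (intro exI[of _ "max N N'"]) auto
  qed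
  have D_small: "\<exists>N. \<forall>m\<ge>N. \<forall>n\<ge>N. l2norm \<Omega> (\<lambda>x. u m x - u n x) < e" if "e > 0" for e
  proof -
    have "e\<^sup>2 > 0" using that by simp
    from E_small[OF this] obtain N where N: "\<And>m n. m \<ge> N \<Longrightarrow> n \<ge> N \<Longrightarrow> E m n < e\<^sup>2" by blast
    have "l2norm \<Omega> (\<lambda>x. u m x - u n x) < e" if "m \<ge> N" "n \<ge> N" for m n
      using N[OF that] D[of m n] \<open>e > 0\<close> by (intro power_less_imp_less_base[of _ 2 e]) auto
    then show ?thesis by blast
  qed
  have H_small: "\<exists>N. \<forall>m\<ge>N. \<forall>n\<ge>N. h10norm \<Omega> (\<lambda>x. u m x - u n x) < e" if "e > 0" for e
  proof -
    \<comment> \<open>The two reciprocals are themselves at most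
      \<open>E m n / (2 * \<epsilon>)\<close>, so a single constant bounds the gradient distance by
      \<open>E\<close>.\<close>
    define c where "c = \<mu> + 1 / (2 * \<epsilon>)"
    have c: "c > 0" using \<mu> \<epsilon>(1) by (simp add: c_def add_nonneg_pos)
    have "?H m n \<le> c * E m n" for m n
    proof -
      have S: "0 \<le> 2 * C * (\<Sum>p\<in>P. (?l (u m) p - ?l (u n) p)\<^sup>2)"
        using PhC(2) by (intro mult_nonneg_nonneg sum_nonneg) auto
      have "?H m n \<le> \<mu> * ?D m n + (2 / real (Suc m) + 2 / real (Suc n))" using par[of m n] by simp
      also have "\<mu> * ?D m n \<le> \<mu> * E m n" using D \<mu> by (rule mult_left_mono)
      also have "2 / real (Suc m) + 2 / real (Suc n) \<le> (1 / (2 * \<epsilon>)) * E m n"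
        using S \<epsilon>(1) unfolding E_def by (simp add: distrib_left del: of_nat_Suc)
      finally show ?thesis by (simp add: c_def distrib_right)
    qed
    note H_le = this
    have "e\<^sup>2 / c > 0" using that c by simp
    from E_small[OF this] obtain N where N: "\<And>m n. m \<ge> N \<Longrightarrow> n \<ge> N \<Longrightarrow> E m n < e\<^sup>2 / c" by blast
    have "?H m n < e\<^sup>2" if "m \<ge> N" "n \<ge> N" for m n
      using N[OF that] H_le[of m n] c by (simp add: pos_less_divide_eq mult.commute)
    then have "h10norm \<Omega> (\<lambda>x. u m x - u n x) < e" if "m \<ge> N" "n \<ge> N" for m n
      using that \<open>e > 0\<close> by (intro power_less_imp_less_base[of _ 2 e]) auto
    then show ?thesis by blast
  qed
  obtain v where v: "v \<in> H10 \<Omega>" "(\<lambda>n. l2norm \<Omega> (u n)) \<longlonglongrightarrow> l2norm \<Omega> v" "(\<lambda>n. h10norm \<Omega> (u n)) \<longlonglongrightarrow> h10norm \<Omega> v"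
    by (rule H10_complete[OF \<Omega>(1) u(1) D_small H_small])
  have "l2norm \<Omega> v = 1" using v(2) u(2) by (simp add: LIMSEQ_const_iff)
  moreover have "(h10norm \<Omega> v)\<^sup>2 \<le> \<mu>"
  proof (rule LIMSEQ_le[OF tendsto_power[OF v(3)]])
    show "(\<lambda>n. \<mu> + 1 / real (Suc n)) \<longlonglongrightarrow> \<mu>"
      using tendsto_add[OF tendsto_const[of \<mu>] lim_1_over_n[THEN LIMSEQ_Suc]] by simp
  qed (use u(3) in blast)
  moreover have "\<mu> \<le> (h10norm \<Omega> v)\<^sup>2" using lower[OF v(1)] \<open>l2norm \<Omega> v = 1\<close> by simp
  ultimately show ?thesis using that v(1) lower by (metis order_antisym)
qed

text \<open>The minimal Rayleigh quotient is an eigenvalue by first variation and a lower bound for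
  all others, because testing an eigenfunction with itself turns its eigenvalue into a Rayleigh
  quotient. This identifies the \<open>LEAST\<close> in \<open>lambda1\<close>.\<close>

lemma lambda1_Poincare:
  fixes \<Omega> :: "'a::euclidean_space set"
  assumes \<Omega>: "open \<Omega>" "bounded \<Omega>" and v: "v \<in> H10 \<Omega>"
  shows "lambda1 \<Omega> * (l2norm \<Omega> v)\<^sup>2 \<le> (h10norm \<Omega> v)\<^sup>2"
proof (cases "l2norm \<Omega> v = 0")
  case False
  \<comment> \<open>Here \<open>v\<close> itself witnesses that the minimization is over a nonempty
    set.\<close>
  obtain w \<mu> where w: "w \<in> H10 \<Omega>" "l2norm \<Omega> w = 1" "(h10norm \<Omega> w)\<^sup>2 = \<mu>"
    and lower: "\<And>v. v \<in> H10 \<Omega> \<Longrightarrow> \<mu> * (l2norm \<Omega> v)\<^sup>2 \<le> (h10norm \<Omega> v)\<^sup>2"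
    by (rule Rayleigh_minimizer[OF \<Omega> v False]) blast
  have "grad_inner \<Omega> w z = \<mu> * l2inner \<Omega> w z" if z: "z \<in> H10 \<Omega>" for z
  proof -
    \<comment> \<open>The form \<open>(h10norm \<Omega> v)\<^sup>2 - \<mu> * (l2norm \<Omega>
      v)\<^sup>2\<close> is nonnegative and vanishes at \<open>w\<close>, so its constant
      coefficient on the line through \<open>w\<close> in direction \<open>z\<close> is zero and the
      mixed term must vanish.\<close>
    have "(grad_inner \<Omega> w z - \<mu> * l2inner \<Omega> w z)\<^sup>2 \<le> 0 * ((h10norm \<Omega> z)\<^sup>2 - \<mu> * (l2norm \<Omega> z)\<^sup>2)"
    proof (rule discriminant_bound)
      fix x :: real
      have "(h10norm \<Omega> (\<lambda>y. 1 * w y + x * z y))\<^sup>2 = \<mu> + 2 * x * grad_inner \<Omega> w z + x\<^sup>2 * (h10norm \<Omega> z)\<^sup>2"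
        using h10norm_lincomb_sq[OF \<Omega>(1) H10_H1[OF w(1)] H10_H1[OF z], of 1 x] w(3) by simp
      moreover have "(l2norm \<Omega> (\<lambda>y. 1 * w y + x * z y))\<^sup>2 = 1 + 2 * x * l2inner \<Omega> w z + x\<^sup>2 * (l2norm \<Omega> z)\<^sup>2"
        using l2norm_lincomb_sq[OF H10_L2[OF w(1)] H10_L2[OF z], of 1 x] w(2) by simp
      moreover note lower[OF H10_lincomb[OF \<Omega>(1) w(1) z, of 1 x]]
      ultimately show "0 \<le> 0 + 2 * (grad_inner \<Omega> w z - \<mu> * l2inner \<Omega> w z) * x
          + ((h10norm \<Omega> z)\<^sup>2 - \<mu> * (l2norm \<Omega> z)\<^sup>2) * x\<^sup>2"
        by (simp add: algebra_simps)
    qed (use lower[OF z] in simp)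
    then show ?thesis by simp
  qed
  then have eig: "dirichlet_eigenvalue \<Omega> \<mu>"
    unfolding dirichlet_eigenvalue_def using w(1,2) by (intro bexI[of _ w]) (auto simp: grad_inner_def)
  have "lambda1 \<Omega> = \<mu>"
    unfolding lambda1_def
  proof (rule Least_equality[of "dirichlet_eigenvalue \<Omega>" \<mu>, OF eig])
    fix \<nu> assume "dirichlet_eigenvalue \<Omega> \<nu>"
    then obtain z where z: "z \<in> H10 \<Omega>" "l2norm \<Omega> z \<noteq> 0" "grad_inner \<Omega> z z = \<nu> * l2inner \<Omega> z z"
      unfolding dirichlet_eigenvalue_def grad_inner_def by blast
    then have "\<mu> * (l2norm \<Omega> z)\<^sup>2 \<le> \<nu> * (l2norm \<Omega> z)\<^sup>2"
      using lower[OF z(1)] by (simp add: h10norm_sq l2norm_sq)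
    then show "\<mu> \<le> \<nu>" using z(2) by simp
  qed
  then show ?thesis using lower[OF v] by simp
qed simp

section \<open>Backward averages of integrable functions\<close>

text \<open>For positive \<open>h\<close> the mean over a window that ends at \<open>t\<close>. For
  a weak derivative it is the backward difference quotient, in which the right end point
  \<open>t\<close> is the time whose state is used as test element.\<close>

definition backward_average :: "real \<Rightarrow> (real \<Rightarrow> real) \<Rightarrow> real \<Rightarrow> real" where
  "backward_average h g t = (LINT r|lebesgue. indicator {t - h<..<t} r * g r) / h"

lemma integrable_indicator_times:
  fixes g :: "real \<Rightarrow> real"
  assumes "integrable lebesgue g" "A \<in> sets lebesgue"
  shows "integrable lebesgue (\<lambda>r. indicator A r * g r)"
  using integrable_mult_indicator[OF assms(2,1)] by simp

lemma integrable_indicator_interval: "integrable lebesgue (\<lambda>r. indicator {a<..<b::real} r * (c::real))"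
  using emeasure_bounded_finite[of "{a<..<b}"]
  by (intro integrable_mult_left integrable_real_indicator) auto

text \<open>Fubini on the product of \<open>lborel\<close> with itself asks for joint Borel
  measurability; a Borel representative changes none of the averages.\<close>

lemma backward_average_borel:
  assumes g: "integrable lebesgue g"
  obtains g' where "integrable lborel g'" "AE x in lebesgue. g x = g' x"
    "\<And>h t. backward_average h g t = (LINT r|lborel. indicator {t - h<..<t} r * g' r) / h"
proof -
  obtain g' where g': "g' \<in> borel_measurable lborel" "AE x in lborel. g x = g' x"
    using completion_ex_borel_measurable_real[OF borel_measurable_integrable[OF g]] by blast
  have ae: "AE x in lebesgue. g x = g' x" using g'(2) by (rule AE_completion)
  have "integrable lebesgue g'"
    by (rule integrable_cong_AE_imp[OF g measurable_completion[OF g'(1)] ae])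
  then have int: "integrable lborel g'" using g'(1) by (simp add: integrable_completion)
  have "backward_average h g t = (LINT r|lborel. indicator {t - h<..<t} r * g' r) / h" for h t
  proof -
    have m: "(\<lambda>r. indicator {t - h<..<t} r * g' r) \<in> borel_measurable lborel"
      using g'(1) by simp
    have "(LINT r|lebesgue. indicator {t - h<..<t} r * g r) = (LINT r|lebesgue. indicator {t - h<..<t} r * g' r)"
      using ae by (intro integral_cong_AE borel_measurable_integrable[OF integrable_indicator_times[OF g]]
        measurable_completion[OF m]) auto
    also have "\<dots> = (LINT r|lborel. indicator {t - h<..<t} r * g' r)"
      using m by (rule integral_completion)
    finally show ?thesis by (simp add: backward_average_def)
  qed
  with int ae show ?thesis by (rule that)
qed

text \<open>Fubini over the strip \<open>r < t < r + h\<close>: each \<open>r\<close> enters the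
  averages with total weight one, so averaging does not increase the \<open>L1\<close> norm,
  uniformly in \<open>h\<close>.\<close>

lemma backward_average_L1:
  assumes g: "integrable lebesgue g" and h: "h > 0"
  shows "integrable lebesgue (backward_average h g)"
    and "(LINT t|lebesgue. \<bar>backward_average h g t\<bar>) \<le> (LINT t|lebesgue. \<bar>g t\<bar>)"
proof -
  obtain g' where g': "integrable lborel g'" "AE x in lebesgue. g x = g' x"
    "\<And>t. backward_average h g t = (LINT r|lborel. indicator {t - h<..<t} r * g' r) / h"
    by (rule backward_average_borel[OF g]) blast
  have [measurable]: "g' \<in> borel_measurable borel" using borel_measurable_integrable[OF g'(1)] by simp
  define F where "F = (\<lambda>(r, t). (if r < t \<and> t < r + h then g' r else 0))"
  have F_r: "F (r, t) = indicator {r<..<r + h} t * g' r" and F_t: "F (r, t) = indicator {t - h<..<t} r * g' r" for r t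
    by (auto simp: F_def split: split_indicator)
  have int: "integrable (lborel \<Otimes>\<^sub>M lborel) F"
  proof (rule lborel_pair.Fubini_integrable)
    show "F \<in> borel_measurable (lborel \<Otimes>\<^sub>M lborel)" unfolding F_def by measurable
    have "(LINT t|lborel. norm (F (r, t))) = h * \<bar>g' r\<bar>" for r
      using h by (simp add: F_r abs_mult)
    then show "integrable lborel (\<lambda>r. LINT t|lborel. norm (F (r, t)))"
      using g'(1) by simp
    show "AE r in lborel. integrable lborel (\<lambda>t. F (r, t))"
      unfolding F_r using h by (intro AE_I2 integrable_mult_left integrable_real_indicator) auto
  qed
  have eq: "backward_average h g = (\<lambda>t. (LINT r|lborel. F (r, t)) / h)"
    by (simp add: g'(3) F_t fun_eq_iff)
  have intb: "integrable lborel (backward_average h g)"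
    unfolding eq using lborel_pair.integrable_snd[of "\<lambda>r t. F (r, t)"] int by simp
  then show "integrable lebesgue (backward_average h g)"
    by (simp add: integrable_completion borel_measurable_integrable)
  have intn: "integrable (lborel \<Otimes>\<^sub>M lborel) (\<lambda>(r, t). \<bar>F (r, t)\<bar>)"
    using integrable_abs[OF int] by (simp add: case_prod_beta')
  have "(LINT t|lebesgue. \<bar>backward_average h g t\<bar>) = (LINT t|lborel. \<bar>backward_average h g t\<bar>)"
    using borel_measurable_integrable[OF intb] by (intro integral_completion) simp
  also have "\<dots> \<le> (LINT t|lborel. (LINT r|lborel. \<bar>F (r, t)\<bar>) / h)"
  proof (rule integral_mono)
    show "integrable lborel (\<lambda>t. (LINT r|lborel. \<bar>F (r, t)\<bar>) / h)"
      using lborel_pair.integrable_snd[OF intn] by simp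
    fix t
    show "\<bar>backward_average h g t\<bar> \<le> (LINT r|lborel. \<bar>F (r, t)\<bar>) / h"
      unfolding eq using h integral_norm_bound[of lborel "\<lambda>r. F (r, t)"] by (simp add: divide_right_mono)
  qed (intro integrable_abs intb)
  also have "\<dots> = (LINT r|lborel. LINT t|lborel. \<bar>F (r, t)\<bar>) / h"
    using lborel_pair.Fubini_integral[OF intn] by simp
  also have "\<dots> = (LINT r|lborel. \<bar>g' r\<bar>)"
    using h by (simp add: F_r abs_mult)
  also have "\<dots> = (LINT r|lebesgue. \<bar>g' r\<bar>)"
    by (intro integral_completion[symmetric]) simp
  also have "\<dots> = (LINT r|lebesgue. \<bar>g r\<bar>)"
    using g'(2) borel_measurable_integrable[OF g] measurable_completion[of g' lborel borel]
    by (intro integral_cong_AE) auto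
  finally show "(LINT t|lebesgue. \<bar>backward_average h g t\<bar>) \<le> (LINT t|lebesgue. \<bar>g t\<bar>)" .
qed

text \<open>The truncation to \<open>{-1<..<b}\<close> serves integrability. The windows have length
  at most one and end at a positive \<open>t < b\<close>, so they never reach the cuts.\<close>

lemma backward_average_continuous_tendsto:
  assumes \<phi>: "continuous_on UNIV \<phi>" and int: "integrable lebesgue (\<lambda>r. indicator {-1<..<b} r * \<phi> r)"
    and t: "0 < t" "t < b"
  shows "(\<lambda>n. backward_average (1 / real (Suc n)) (\<lambda>r. indicator {-1<..<b} r * \<phi> r) t) \<longlonglongrightarrow> \<phi> t"
proof (rule LIMSEQ_I)
  fix e :: real assume "e > 0"
  then have "e / 2 > 0" by simp
  obtain d where d: "d > 0" "\<And>r. dist r t < d \<Longrightarrow> dist (\<phi> r) (\<phi> t) < e / 2"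
    using \<phi> \<open>e / 2 > 0\<close> unfolding continuous_on_iff by (metis UNIV_I)
  obtain N where N: "1 / real (Suc N) < d" using reals_Archimedean[OF d(1)] by (auto simp: inverse_eq_divide)
  have "\<bar>backward_average (1 / real (Suc n)) (\<lambda>r. indicator {-1<..<b} r * \<phi> r) t - \<phi> t\<bar> < e" if "n \<ge> N" for n
  proof -
    define h where "h = 1 / real (Suc n)"
    have h: "h > 0" "h \<le> 1" by (auto simp: h_def)
    have "h \<le> 1 / real (Suc N)" using that by (simp add: h_def field_simps)
    then have hd: "h < d" using N by simp
    have i1: "integrable lebesgue (\<lambda>r. indicator {t - h<..<t} r * (indicator {-1<..<b} r * \<phi> r))"
      by (intro integrable_indicator_times int) auto
    have i2: "integrable lebesgue (\<lambda>r. indicator {t - h<..<t} r * c)" for c :: real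
      by (rule integrable_indicator_interval)
    have mc: "(LINT r|lebesgue. indicator {t - h<..<t} r * c) = h * c" for c :: real
      using h by simp
    have "\<bar>(LINT r|lebesgue. indicator {t - h<..<t} r * (indicator {-1<..<b} r * \<phi> r)) - h * \<phi> t\<bar>
        = \<bar>LINT r|lebesgue. indicator {t - h<..<t} r * (indicator {-1<..<b} r * \<phi> r) - indicator {t - h<..<t} r * \<phi> t\<bar>"
      by (simp only: Bochner_Integration.integral_diff[OF i1 i2] mc)
    also have "\<dots> \<le> (LINT r|lebesgue. indicator {t - h<..<t} r * (e / 2))"
    proof (rule integral_abs_bound_integral)
      show "integrable lebesgue (\<lambda>r. indicator {t - h<..<t} r * (indicator {-1<..<b} r * \<phi> r) - indicator {t - h<..<t} r * \<phi> t)"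
        by (intro Bochner_Integration.integrable_diff i1 i2)
      fix r
      show "\<bar>indicator {t - h<..<t} r * (indicator {-1<..<b} r * \<phi> r) - indicator {t - h<..<t} r * \<phi> t\<bar>
          \<le> indicator {t - h<..<t} r * (e / 2)"
      proof (cases "r \<in> {t - h<..<t}")
        case True
        then have "dist r t < d" "r \<in> {-1<..<b}" using h hd t by (auto simp: dist_real_def)
        then show ?thesis using d(2)[of r] True by (simp add: dist_real_def)
      qed simp
    qed (rule i2)
    also have "\<dots> = h * (e / 2)" by (rule mc)
    finally have "\<bar>(LINT r|lebesgue. indicator {t - h<..<t} r * (indicator {-1<..<b} r * \<phi> r)) - h * \<phi> t\<bar> / h \<le> e / 2"
      using h by (simp add: pos_divide_le_eq mult.commute)
    moreover have "backward_average h (\<lambda>r. indicator {-1<..<b} r * \<phi> r) t - \<phi> t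
        = ((LINT r|lebesgue. indicator {t - h<..<t} r * (indicator {-1<..<b} r * \<phi> r)) - h * \<phi> t) / h"
      using h by (simp add: backward_average_def diff_divide_distrib)
    ultimately have "\<bar>backward_average h (\<lambda>r. indicator {-1<..<b} r * \<phi> r) t - \<phi> t\<bar> \<le> e / 2"
      using h by simp
    then show ?thesis using \<open>e > 0\<close> by (simp add: h_def)
  qed
  then show "\<exists>N. \<forall>n\<ge>N. norm (backward_average (1 / real (Suc n)) (\<lambda>r. indicator {-1<..<b} r * \<phi> r) t - \<phi> t) < e"
    by auto
qed

text \<open>Clamping \<open>g\<close> to \<open>[-M, M]\<close> costs little in \<open>L1\<close>. A
  measurable function is an almost everywhere limit of continuous ones; clamping these as well gives
  a constant dominating function on the bounded interval.\<close>

lemma integrable_approx_bounded_continuous: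
  fixes g :: "real \<Rightarrow> real"
  assumes g: "integrable lebesgue g" and e: "e > 0"
  obtains \<phi> M where "continuous_on UNIV \<phi>" "\<And>x. \<bar>\<phi> x\<bar> \<le> M"
    "integrable lebesgue (\<lambda>r. indicator {a<..<b} r * \<phi> r)"
    "(LINT r|lebesgue. indicator {a<..<b} r * \<bar>g r - \<phi> r\<bar>) < e"
proof -
  have gm [measurable]: "g \<in> borel_measurable lebesgue" using g by simp
  define cl where "cl M x = max (- M) (min M x)" for M x :: real
  have cl_cont: "continuous_on UNIV (cl M)" for M unfolding cl_def by (intro continuous_intros)
  have cl_b: "\<bar>cl M x\<bar> \<le> M" if "M \<ge> 0" for M x using that by (auto simp: cl_def)
  have cl_le: "\<bar>cl M x\<bar> \<le> \<bar>x\<bar>" if "M \<ge> 0" for M x using that by (auto simp: cl_def)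
  have cl_m [measurable]: "(\<lambda>r. cl M (g r)) \<in> borel_measurable lebesgue" for M
    unfolding cl_def by simp
  have "(\<lambda>n. LINT r|lebesgue. \<bar>g r - cl (real n) (g r)\<bar>) \<longlonglongrightarrow> integral\<^sup>L lebesgue (\<lambda>_::real. 0::real)"
  proof (rule integral_dominated_convergence[where w = "\<lambda>r. 2 * \<bar>g r\<bar>"])
    show "AE r in lebesgue. (\<lambda>n. \<bar>g r - cl (real n) (g r)\<bar>) \<longlonglongrightarrow> 0"
    proof (rule AE_I2)
      fix r
      obtain n0 :: nat where n0: "\<bar>g r\<bar> \<le> real n0" using real_arch_simple by blast
      have "\<forall>\<^sub>F n in sequentially. \<bar>g r - cl (real n) (g r)\<bar> = 0"
        using eventually_ge_at_top[of n0] by eventually_elim (use n0 in \<open>auto simp: cl_def\<close>)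
      then show "(\<lambda>n. \<bar>g r - cl (real n) (g r)\<bar>) \<longlonglongrightarrow> 0" by (rule tendsto_eventually)
    qed
    show "AE r in lebesgue. norm \<bar>g r - cl (real n) (g r)\<bar> \<le> 2 * \<bar>g r\<bar>" for n
      using cl_le[of "real n"] by (intro AE_I2) (smt (verit) of_nat_0_le_iff real_norm_def)
  qed (use g in auto)
  then have "(\<lambda>n. LINT r|lebesgue. \<bar>g r - cl (real n) (g r)\<bar>) \<longlonglongrightarrow> 0" by simp
  then have "\<forall>\<^sub>F n in sequentially. (LINT r|lebesgue. \<bar>g r - cl (real n) (g r)\<bar>) < e / 2"
    using e by (intro order_tendstoD(2)) auto
  then obtain m :: nat where m: "(LINT r|lebesgue. \<bar>g r - cl (real m) (g r)\<bar>) < e / 2"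
    using eventually_happens by fastforce
  define M where "M = real m"
  have M: "M \<ge> 0" by (simp add: M_def)
  obtain Nl gs where gs: "negligible Nl" "\<And>n. continuous_on UNIV (gs n)" "\<And>x. x \<notin> Nl \<Longrightarrow> (\<lambda>n. gs n x) \<longlonglongrightarrow> g x"
    using lebesgue_measurable_imp_measurable_on[OF gm, of UNIV] unfolding measurable_on_def by auto
  have gs_m: "gs n \<in> borel_measurable lebesgue" for n
    using borel_measurable_continuous_onI[OF gs(2)] by (intro measurable_completion) simp
  have cgs_m: "(\<lambda>r. cl M (gs n r)) \<in> borel_measurable lebesgue" for n
    using gs_m[of n] unfolding cl_def by simp
  have ind: "integrable lebesgue (\<lambda>r. indicator {a<..<b} r * c)" for c :: real
    by (rule integrable_indicator_interval)
  have "(\<lambda>n. LINT r|lebesgue. indicator {a<..<b} r * \<bar>cl M (g r) - cl M (gs n r)\<bar>) \<longlonglongrightarrow> integral\<^sup>L lebesgue (\<lambda>_::real. 0::real)"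
  proof (rule integral_dominated_convergence[where w = "\<lambda>r. indicator {a<..<b} r * (2 * M)"])
    have "AE r in lebesgue. r \<notin> Nl" using gs(1) by (intro AE_not_in) (simp add: negligible_iff_null_sets)
    then show "AE r in lebesgue. (\<lambda>n. indicator {a<..<b} r * \<bar>cl M (g r) - cl M (gs n r)\<bar>) \<longlonglongrightarrow> 0"
    proof eventually_elim
      case (elim r)
      have "(\<lambda>n. cl M (gs n r)) \<longlonglongrightarrow> cl M (g r)"
        using cl_cont[of M] gs(3)[OF elim] by (auto simp: continuous_on_eq_continuous_at intro: isCont_tendsto_compose)
      then have "(\<lambda>n. indicator {a<..<b} r * \<bar>cl M (g r) - cl M (gs n r)\<bar>) \<longlonglongrightarrow> indicator {a<..<b} r * \<bar>cl M (g r) - cl M (g r)\<bar>"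
        by (intro tendsto_intros)
      then show ?case by simp
    qed
    show "AE r in lebesgue. norm (indicator {a<..<b} r * \<bar>cl M (g r) - cl M (gs n r)\<bar>) \<le> indicator {a<..<b} r * (2 * M)" for n
    proof (rule AE_I2)
      fix r show "norm (indicator {a<..<b} r * \<bar>cl M (g r) - cl M (gs n r)\<bar>) \<le> indicator {a<..<b} r * (2 * M)"
        using cl_b[OF M, of "g r"] cl_b[OF M, of "gs n r"] by (auto split: split_indicator)
    qed
    show "(\<lambda>r. indicator {a<..<b} r * \<bar>cl M (g r) - cl M (gs n r)\<bar>) \<in> borel_measurable lebesgue" for n
      by (intro borel_measurable_times borel_measurable_indicator borel_measurable_abs borel_measurable_diff cl_m cgs_m) simp
  qed (use ind in auto)
  then have "(\<lambda>n. LINT r|lebesgue. indicator {a<..<b} r * \<bar>cl M (g r) - cl M (gs n r)\<bar>) \<longlonglongrightarrow> 0" by simp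
  then have "\<forall>\<^sub>F n in sequentially. (LINT r|lebesgue. indicator {a<..<b} r * \<bar>cl M (g r) - cl M (gs n r)\<bar>) < e / 2"
    using e by (intro order_tendstoD(2)) auto
  then obtain n where n: "(LINT r|lebesgue. indicator {a<..<b} r * \<bar>cl M (g r) - cl M (gs n r)\<bar>) < e / 2"
    using eventually_happens by fastforce
  define \<phi> where "\<phi> r = cl M (gs n r)" for r
  have \<phi>_m [measurable]: "\<phi> \<in> borel_measurable lebesgue" using cgs_m[of n] by (simp add: \<phi>_def[abs_def])
  have \<phi>_b: "\<bar>\<phi> r\<bar> \<le> M" for r using cl_b[OF M] by (simp add: \<phi>_def)
  have "continuous_on UNIV \<phi>" unfolding \<phi>_def
    by (intro continuous_on_compose2[OF cl_cont gs(2)]) auto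
  moreover have i\<phi>: "integrable lebesgue (\<lambda>r. indicator {a<..<b} r * \<phi> r)"
    by (rule Bochner_Integration.integrable_bound[OF ind[of M]])
       (use \<phi>_b M in \<open>auto simp: abs_mult intro!: mult_left_mono borel_measurable_times borel_measurable_indicator\<close>)
  moreover have "(LINT r|lebesgue. indicator {a<..<b} r * \<bar>g r - \<phi> r\<bar>) < e"
  proof -
    have ig: "integrable lebesgue (\<lambda>r. \<bar>g r - cl M (g r)\<bar>)"
    proof (rule Bochner_Integration.integrable_bound[where f = "\<lambda>r. 2 * \<bar>g r\<bar>"])
      have "\<bar>g r - cl M (g r)\<bar> \<le> 2 * \<bar>g r\<bar>" for r using cl_le[OF M, of "g r"] by linarith
      then show "AE r in lebesgue. norm \<bar>g r - cl M (g r)\<bar> \<le> norm (2 * \<bar>g r\<bar>)" by simp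
    qed (use g in auto)
    have ic: "integrable lebesgue (\<lambda>r. indicator {a<..<b} r * \<bar>cl M (g r) - \<phi> r\<bar>)"
    proof (rule Bochner_Integration.integrable_bound[OF ind[of "2 * M"]])
      show "AE r in lebesgue. norm (indicator {a<..<b} r * \<bar>cl M (g r) - \<phi> r\<bar>) \<le> norm (indicator {a<..<b} r * (2 * M))"
      proof (rule AE_I2)
        fix r show "norm (indicator {a<..<b} r * \<bar>cl M (g r) - \<phi> r\<bar>) \<le> norm (indicator {a<..<b} r * (2 * M))"
          using cl_b[OF M, of "g r"] \<phi>_b[of r] M by (auto split: split_indicator)
      qed
    qed (intro borel_measurable_times borel_measurable_indicator borel_measurable_abs borel_measurable_diff cl_m \<phi>_m, simp)
    have "(LINT r|lebesgue. indicator {a<..<b} r * \<bar>g r - \<phi> r\<bar>)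
        \<le> (LINT r|lebesgue. \<bar>g r - cl M (g r)\<bar> + indicator {a<..<b} r * \<bar>cl M (g r) - \<phi> r\<bar>)"
    proof (rule integral_mono)
      have "integrable lebesgue (\<lambda>r. \<bar>indicator {a<..<b} r * g r - indicator {a<..<b} r * \<phi> r\<bar>)"
        using g by (intro integrable_abs Bochner_Integration.integrable_diff i\<phi> integrable_indicator_times) auto
      then show "integrable lebesgue (\<lambda>r. indicator {a<..<b} r * \<bar>g r - \<phi> r\<bar>)"
        by (rule back_subst[of "integrable lebesgue"]) (auto split: split_indicator)
      fix r show "indicator {a<..<b} r * \<bar>g r - \<phi> r\<bar> \<le> \<bar>g r - cl M (g r)\<bar> + indicator {a<..<b} r * \<bar>cl M (g r) - \<phi> r\<bar>"
        by (auto split: split_indicator)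
    qed (intro Bochner_Integration.integrable_add ig ic)
    also have "\<dots> = (LINT r|lebesgue. \<bar>g r - cl M (g r)\<bar>) + (LINT r|lebesgue. indicator {a<..<b} r * \<bar>cl M (g r) - \<phi> r\<bar>)"
      by (rule Bochner_Integration.integral_add[OF ig ic])
    also have "\<dots> < e" using m n by (simp add: M_def \<phi>_def)
    finally show ?thesis .
  qed
  ultimately show ?thesis using that \<phi>_b by blast
qed

text \<open>Density argument with three errors of size \<open>e / 3\<close>: contraction handles the
  averages of \<open>g - \<phi>\<close>, continuity those of \<open>\<phi>\<close>, and the last
  error is the approximation itself.\<close>

lemma backward_average_tendsto_L1:
  assumes g: "integrable lebesgue g"
  shows "(\<lambda>n. LINT t|lebesgue. indicator {0<..<b} t * \<bar>backward_average (1 / real (Suc n)) g t - g t\<bar>) \<longlonglongrightarrow> 0"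
proof (rule LIMSEQ_I)
  fix e :: real assume e: "e > 0"
  let ?I = "\<lambda>t. indicator {0<..<b} t :: real" and ?J = "\<lambda>t. indicator {-1<..<b} t :: real"
  let ?S = "\<lambda>n. backward_average (1 / real (Suc n))"
  have "e / 3 > 0" using e by simp
  obtain \<phi> M where \<phi>: "continuous_on UNIV \<phi>" "\<And>x. \<bar>\<phi> x\<bar> \<le> M" "integrable lebesgue (\<lambda>r. ?J r * \<phi> r)"
    "(LINT r|lebesgue. ?J r * \<bar>g r - \<phi> r\<bar>) < e / 3"
    by (rule integrable_approx_bounded_continuous[OF g \<open>e / 3 > 0\<close>, of "-1" b]) blast
  let ?\<psi> = "\<lambda>r. ?J r * \<phi> r"
  have M: "M \<ge> 0" using \<phi>(2)[of 0] by simp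
  have iS: "integrable lebesgue (?S n f)" if "integrable lebesgue f" for n f
    using backward_average_L1(1)[OF that] by simp
  have iJg: "integrable lebesgue (\<lambda>r. ?J r * g r)" by (intro integrable_indicator_times g) auto
  have iII: "integrable lebesgue (\<lambda>t. ?I t * c)" for c :: real
    by (rule integrable_indicator_interval)
  have "(\<lambda>n. LINT t|lebesgue. ?I t * \<bar>?S n ?\<psi> t - \<phi> t\<bar>) \<longlonglongrightarrow> integral\<^sup>L lebesgue (\<lambda>_::real. 0::real)"
  proof (rule integral_dominated_convergence[where w = "\<lambda>t. ?I t * (2 * M)"])
    show "AE t in lebesgue. (\<lambda>n. ?I t * \<bar>?S n ?\<psi> t - \<phi> t\<bar>) \<longlonglongrightarrow> 0"
    proof (rule AE_I2)
      fix t
      show "(\<lambda>n. ?I t * \<bar>?S n ?\<psi> t - \<phi> t\<bar>) \<longlonglongrightarrow> 0"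
      proof (cases "t \<in> {0<..<b}")
        case True
        then have "(\<lambda>n. ?I t * \<bar>?S n ?\<psi> t - \<phi> t\<bar>) \<longlonglongrightarrow> ?I t * \<bar>\<phi> t - \<phi> t\<bar>"
          by (intro tendsto_intros backward_average_continuous_tendsto \<phi>(1,3)) auto
        then show ?thesis by simp
      qed simp
    qed
    show "AE t in lebesgue. norm (?I t * \<bar>?S n ?\<psi> t - \<phi> t\<bar>) \<le> ?I t * (2 * M)" for n
    proof (rule AE_I2)
      fix t
      have "\<bar>LINT r|lebesgue. indicator {t - 1 / real (Suc n)<..<t} r * ?\<psi> r\<bar>
          \<le> (LINT r|lebesgue. indicator {t - 1 / real (Suc n)<..<t} r * M)"
        by (rule integral_abs_bound_integral)
           (use \<phi>(2) M in \<open>auto intro!: integrable_indicator_times \<phi>(3) integrable_indicator_interval split: split_indicator\<close>)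
      also have "\<dots> = M / real (Suc n)" by simp
      finally have "\<bar>?S n ?\<psi> t\<bar> \<le> M"
        by (simp add: backward_average_def abs_mult field_simps del: of_nat_Suc)
      then show "norm (?I t * \<bar>?S n ?\<psi> t - \<phi> t\<bar>) \<le> ?I t * (2 * M)"
        using \<phi>(2)[of t] by (auto split: split_indicator)
    qed
    show "(\<lambda>t. ?I t * \<bar>?S n ?\<psi> t - \<phi> t\<bar>) \<in> borel_measurable lebesgue" for n
      using borel_measurable_integrable[OF iS[OF \<phi>(3)]] measurable_completion[of \<phi> lborel borel]
        borel_measurable_continuous_onI[OF \<phi>(1)]
      by (intro borel_measurable_times borel_measurable_indicator borel_measurable_abs borel_measurable_diff) auto
  qed (use iII in auto)
  then have "(\<lambda>n. LINT t|lebesgue. ?I t * \<bar>?S n ?\<psi> t - \<phi> t\<bar>) \<longlonglongrightarrow> 0" by simp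
  then have "\<forall>\<^sub>F n in sequentially. (LINT t|lebesgue. ?I t * \<bar>?S n ?\<psi> t - \<phi> t\<bar>) < e / 3"
    using e by (intro order_tendstoD(2)) auto
  then obtain N where N: "\<And>n. n \<ge> N \<Longrightarrow> (LINT t|lebesgue. ?I t * \<bar>?S n ?\<psi> t - \<phi> t\<bar>) < e / 3"
    by (auto simp: eventually_sequentially)
  have "(LINT t|lebesgue. ?I t * \<bar>?S n g t - g t\<bar>) < e" if "n \<ge> N" for n
  proof -
    let ?d = "\<lambda>r. ?J r * g r - ?\<psi> r"
    have id: "integrable lebesgue ?d" by (intro Bochner_Integration.integrable_diff iJg \<phi>(3))
    \<comment> \<open>For \<open>t\<close> in \<open>{0<..<b}\<close> the window lies in
      \<open>{-1<..<b}\<close>, so \<open>g\<close> and its truncation have the same average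
      there.\<close>
    have dec: "?S n g t = ?S n ?d t + ?S n ?\<psi> t" if t: "t \<in> {0<..<b}" for t
    proof -
      have "indicator {t - h<..<t} r * g r = indicator {t - h<..<t} r * ?d r + indicator {t - h<..<t} r * ?\<psi> r"
        if "h \<le> 1" for h r :: real
        using t that by (auto split: split_indicator)
      from this[of "1 / real (Suc n)"]
      have "indicator {t - 1 / real (Suc n)<..<t} r * g r
          = indicator {t - 1 / real (Suc n)<..<t} r * ?d r + indicator {t - 1 / real (Suc n)<..<t} r * ?\<psi> r" for r
        by simp
      then have "(LINT r|lebesgue. indicator {t - 1 / real (Suc n)<..<t} r * g r)
         = (LINT r|lebesgue. indicator {t - 1 / real (Suc n)<..<t} r * ?d r + indicator {t - 1 / real (Suc n)<..<t} r * ?\<psi> r)"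
        by simp
      also have "\<dots> = (LINT r|lebesgue. indicator {t - 1 / real (Suc n)<..<t} r * ?d r)
          + (LINT r|lebesgue. indicator {t - 1 / real (Suc n)<..<t} r * ?\<psi> r)"
        by (intro Bochner_Integration.integral_add integrable_indicator_times id \<phi>(3)) auto
      finally show ?thesis by (simp add: backward_average_def add_divide_distrib distrib_right)
    qed
    have iI: "integrable lebesgue (\<lambda>t. ?I t * f t)" if "integrable lebesgue f" for f
      by (intro integrable_indicator_times that) auto
    have ia: "integrable lebesgue (\<lambda>t. \<bar>?S n ?d t\<bar>)" by (intro integrable_abs iS id)
    have ic: "integrable lebesgue (\<lambda>t. ?J t * \<bar>g t - \<phi> t\<bar>)"
      using integrable_abs[OF id] by (rule back_subst[of "integrable lebesgue"]) (auto split: split_indicator)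
    have ib: "integrable lebesgue (\<lambda>t. ?I t * \<bar>?S n ?\<psi> t - \<phi> t\<bar>)"
    proof -
      have "integrable lebesgue (\<lambda>t. ?I t * \<bar>?S n ?\<psi> t - ?\<psi> t\<bar>)"
        by (intro iI integrable_abs Bochner_Integration.integrable_diff iS \<phi>(3))
      then show ?thesis by (rule back_subst[of "integrable lebesgue"]) (auto split: split_indicator)
    qed
    have "(LINT t|lebesgue. ?I t * \<bar>?S n g t - g t\<bar>)
        \<le> (LINT t|lebesgue. (\<bar>?S n ?d t\<bar> + ?I t * \<bar>?S n ?\<psi> t - \<phi> t\<bar>) + ?J t * \<bar>g t - \<phi> t\<bar>)"
    proof (rule integral_mono)
      fix t
      show "?I t * \<bar>?S n g t - g t\<bar> \<le> (\<bar>?S n ?d t\<bar> + ?I t * \<bar>?S n ?\<psi> t - \<phi> t\<bar>) + ?J t * \<bar>g t - \<phi> t\<bar>"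
      proof (cases "t \<in> {0<..<b}")
        case True
        then show ?thesis using dec[OF True] by simp
      next
        case False
        then show ?thesis by simp
      qed
    qed (intro Bochner_Integration.integrable_add Bochner_Integration.integrable_diff integrable_abs iI iS g ia ib ic)+
    also have "\<dots> = (LINT t|lebesgue. \<bar>?S n ?d t\<bar>) + (LINT t|lebesgue. ?I t * \<bar>?S n ?\<psi> t - \<phi> t\<bar>)
        + (LINT t|lebesgue. ?J t * \<bar>g t - \<phi> t\<bar>)"
      using ia ib ic by simp
    also have "(LINT t|lebesgue. \<bar>?S n ?d t\<bar>) \<le> (LINT t|lebesgue. \<bar>?d t\<bar>)"
      using backward_average_L1(2)[OF id] by simp
    also have "(LINT t|lebesgue. \<bar>?d t\<bar>) = (LINT t|lebesgue. ?J t * \<bar>g t - \<phi> t\<bar>)"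
      by (intro Bochner_Integration.integral_cong) (auto split: split_indicator)
    finally show ?thesis using N[OF that] \<phi>(4) by linarith
  qed
  moreover have "(LINT t|lebesgue. ?I t * \<bar>?S n g t - g t\<bar>) \<ge> 0" for n by simp
  ultimately show "\<exists>N. \<forall>n\<ge>N. norm ((LINT t|lebesgue. ?I t * \<bar>?S n g t - g t\<bar>) - 0) < e"
    by (intro exI[of _ N]) simp
qed

section \<open>Functions of time and their weak derivatives\<close>

lemma flat_step_continuous: "continuous_on UNIV (flat_step n)"
  using flat_step_deriv by (meson DERIV_isCont continuous_at_imp_continuous_on)

lemma flat_step_1_nonneg: "0 \<le> flat_step (Suc 0) x"
  by (simp add: flat_step_1)

text \<open>The step rises from 0 to 1 and this is its derivative, so the kernel has integral one
  without a normalizing factor.\<close>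

lemma flat_step_1_integral: "integrable lborel (flat_step (Suc 0))" "(LINT x|lborel. flat_step (Suc 0) x) = 1"
proof -
  have m: "flat_step (Suc 0) \<in> borel_measurable borel"
    by (intro borel_measurable_continuous_onI flat_step_continuous)
  have "(\<integral>\<^sup>+x. ennreal (flat_step (Suc 0) x) * indicator {0..} x \<partial>lborel) = ennreal (1 - flat_step 0 0)"
    by (rule nn_integral_FTC_atLeast[OF m flat_step_deriv flat_step_1_nonneg flat_step_0_at_top])
  moreover have "(\<lambda>x. ennreal (flat_step (Suc 0) x) * indicator {0..} x) = (\<lambda>x. ennreal (flat_step (Suc 0) x))"
    by (auto simp: flat_step_1 split: split_indicator)
  ultimately have "(\<integral>\<^sup>+x. ennreal (flat_step (Suc 0) x) \<partial>lborel) = ennreal 1"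
    by (simp add: flat_step_0)
  then have "integrable lborel (flat_step (Suc 0)) \<and> (LINT x|lborel. flat_step (Suc 0) x) = 1"
    using m by (subst nn_integral_eq_integrable[symmetric]) (auto simp: flat_step_1_nonneg)
  then show "integrable lborel (flat_step (Suc 0))" "(LINT x|lborel. flat_step (Suc 0) x) = 1" by auto
qed

text \<open>The substitution \<open>x = s + y / (n + 1)\<close> turns the rescaled kernel into a
  fixed integrable one. It concentrates at \<open>s\<close> from the right, where the falling step
  tends to 1 because \<open>s < t\<close>.\<close>

lemma flat_step_kernel_tendsto:
  fixes g :: "real \<Rightarrow> real"
  assumes g: "continuous_on UNIV g" "\<And>x. \<bar>g x\<bar> \<le> B" and st: "s < t"
  shows "(\<lambda>n. LINT x|lborel. real (Suc n) * flat_step (Suc 0) (real (Suc n) * (x - s)) *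
            flat_step 0 (real (Suc n) * (t - x)) * g x) \<longlonglongrightarrow> g s"
proof -
  have B: "B \<ge> 0" using g(2)[of 0] by simp
  let ?f = "\<lambda>n y. flat_step (Suc 0) y * flat_step 0 (real (Suc n) * (t - s) - y) * g (s + y / real (Suc n))"
  have subst: "(LINT x|lborel. real (Suc n) * flat_step (Suc 0) (real (Suc n) * (x - s)) *
            flat_step 0 (real (Suc n) * (t - x)) * g x) = (LINT y|lborel. ?f n y)" for n
  proof -
    define N where "N = real (Suc n)"
    have N: "N > 0" by (simp add: N_def)
    have e: "N * (s + y / N - s) = y" "N * (t - (s + y / N)) = N * (t - s) - y" for y
      using N by (simp_all add: field_simps)
    have "(LINT x|lborel. N * flat_step (Suc 0) (N * (x - s)) * flat_step 0 (N * (t - x)) * g x)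
        = (1 / N) * (LINT y|lborel. N * flat_step (Suc 0) y * flat_step 0 (N * (t - s) - y) * g (s + y / N))"
      using N by (subst lborel_integral_real_affine[where c = "1 / N" and t = s]) (simp_all add: e)
    also have "\<dots> = (LINT y|lborel. flat_step (Suc 0) y * flat_step 0 (N * (t - s) - y) * g (s + y / N))"
      using N by (simp add: mult.assoc)
    finally show ?thesis by (simp add: N_def)
  qed
  have "(\<lambda>n. LINT y|lborel. ?f n y) \<longlonglongrightarrow> (LINT y|lborel. flat_step (Suc 0) y * g s)"
  proof (rule integral_dominated_convergence[where w = "\<lambda>y. flat_step (Suc 0) y * B"])
    show "AE y in lborel. (\<lambda>n. ?f n y) \<longlonglongrightarrow> flat_step (Suc 0) y * g s"
    proof (rule AE_I2)
      fix y
      have "filterlim (\<lambda>n. (t - s) * real (Suc n)) at_top sequentially"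
        using st by (intro filterlim_tendsto_pos_mult_at_top[OF tendsto_const]
            filterlim_compose[OF filterlim_real_sequentially filterlim_Suc]) simp
      then have "filterlim (\<lambda>n. - y + (t - s) * real (Suc n)) at_top sequentially"
        by (rule filterlim_tendsto_add_at_top[OF tendsto_const])
      then have "(\<lambda>n. flat_step 0 (- y + (t - s) * real (Suc n))) \<longlonglongrightarrow> 1"
        by (rule filterlim_compose[OF flat_step_0_at_top])
      then have 1: "(\<lambda>n. flat_step 0 (real (Suc n) * (t - s) - y)) \<longlonglongrightarrow> 1"
        by (simp add: mult.commute)
      have "(\<lambda>n. s + y * (1 / real (Suc n))) \<longlonglongrightarrow> s + y * 0"
        by (intro tendsto_intros lim_1_over_n[THEN LIMSEQ_Suc])
      then have "(\<lambda>n. s + y / real (Suc n)) \<longlonglongrightarrow> s" by simp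
      with g(1) have 2: "(\<lambda>n. g (s + y / real (Suc n))) \<longlonglongrightarrow> g s"
        by (auto simp: continuous_on_eq_continuous_at intro: isCont_tendsto_compose)
      show "(\<lambda>n. ?f n y) \<longlonglongrightarrow> flat_step (Suc 0) y * g s"
        using tendsto_mult[OF tendsto_mult[OF tendsto_const 1] 2, of "flat_step (Suc 0) y"] by simp
    qed
    show "AE y in lborel. norm (?f n y) \<le> flat_step (Suc 0) y * B" for n
    proof (rule AE_I2)
      fix y
      have "flat_step 0 (real (Suc n) * (t - s) - y) * \<bar>g (s + y / real (Suc n))\<bar> \<le> 1 * B"
        using B by (intro mult_mono flat_step_0_bounds g(2)) auto
      then show "norm (?f n y) \<le> flat_step (Suc 0) y * B"
        using mult_left_mono[OF _ flat_step_1_nonneg[of y]]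
        by (simp add: abs_mult flat_step_1_nonneg flat_step_0_bounds mult.assoc del: of_nat_Suc)
    qed
    show "(\<lambda>y. flat_step (Suc 0) y * g s) \<in> borel_measurable lborel"
      by (simp, intro borel_measurable_continuous_onI continuous_intros flat_step_continuous)
    show "?f n \<in> borel_measurable lborel" for n
      by (simp, intro borel_measurable_continuous_onI continuous_intros flat_step_continuous
          continuous_on_compose2[OF flat_step_continuous] continuous_on_compose2[OF g(1)]) auto
    show "integrable lborel (\<lambda>y. flat_step (Suc 0) y * B)"
      by (intro integrable_mult_left flat_step_1_integral)
  qed
  then show ?thesis unfolding subst by (simp add: flat_step_1_integral del: of_nat_Suc)
qed

lemma box_bump_real: "box_bump s t n x = flat_step 0 (real n * (x - s)) * flat_step 0 (real n * (t - x))"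
  for s t x :: real
  by (simp add: box_bump_def)

lemma box_bump_real_deriv:
  fixes s t x :: real
  shows "deriv (box_bump s t n) x =
     real n * flat_step (Suc 0) (real n * (x - s)) * flat_step 0 (real n * (t - x))
     - real n * flat_step 0 (real n * (x - s)) * flat_step (Suc 0) (real n * (t - x))"
proof (rule DERIV_imp_deriv)
  have 1: "((\<lambda>x. flat_step 0 (real n * (x - s))) has_real_derivative flat_step (Suc 0) (real n * (x - s)) * real n) (at x)"
    by (rule DERIV_chain2[OF flat_step_deriv]) (auto intro!: derivative_eq_intros)
  have 2: "((\<lambda>x. flat_step 0 (real n * (t - x))) has_real_derivative flat_step (Suc 0) (real n * (t - x)) * (- real n)) (at x)"
    by (rule DERIV_chain2[OF flat_step_deriv]) (auto intro!: derivative_eq_intros)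
  show "(box_bump s t n has_real_derivative
     real n * flat_step (Suc 0) (real n * (x - s)) * flat_step 0 (real n * (t - x))
     - real n * flat_step 0 (real n * (x - s)) * flat_step (Suc 0) (real n * (t - x))) (at x)"
    unfolding box_bump_real[abs_def]
    by (rule DERIV_cong[OF DERIV_mult[OF 1 2]]) (simp add: algebra_simps)
qed

text \<open>The weak identity is tested with bumps over \<open>{s<..<t}\<close>. Their derivative is
  a kernel concentrating at \<open>s\<close> minus one concentrating at \<open>t\<close>, and the
  bumps themselves tend to the indicator. The condition \<open>0 < s\<close> keeps them inside the
  open half-line.\<close>

lemma weak_derivative_increment_pos:
  fixes g k :: "real \<Rightarrow> real"
  assumes g: "continuous_on {0..} g" and k: "integrable lebesgue (\<lambda>r. indicator {0<..<b} r * k r)"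
    and weak: "\<And>\<eta>. \<eta> \<in> test_functions {0<..} \<Longrightarrow>
      (LINT t|lebesgue_on {0<..}. deriv \<eta> t * g t) = - (LINT t|lebesgue_on {0<..}. \<eta> t * k t)"
    and st: "0 < s" "s < t" "t \<le> b"
  shows "g t - g s = (LINT r|lebesgue. indicator {s<..<t} r * k r)"
proof -
  \<comment> \<open>Clamping the argument to \<open>{s..t}\<close> gives a bounded continuous
    function on the line that agrees with \<open>g\<close> where the bump is supported.\<close>
  define gc where "gc x = g (max s (min t x))" for x
  have gc_cont: "continuous_on UNIV gc"
    unfolding gc_def using st
    by (intro continuous_on_compose2[OF g] continuous_intros) auto
  have "compact (g ` {s..t})"
    using st by (intro compact_continuous_image continuous_on_subset[OF g]) auto
  then obtain B where B: "\<forall>y\<in>g ` {s..t}. norm y \<le> B"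
    using compact_imp_bounded bounded_iff by blast
  have gc_B: "\<bar>gc x\<bar> \<le> B" for x
    using B st unfolding gc_def by (simp add: ball_simps)
  let ?\<eta> = "\<lambda>n. box_bump s t (Suc n)"
  have \<eta>: "?\<eta> n \<in> test_functions {0<..}" for n
    using st by (intro box_bump_test_function) auto
  let ?A = "\<lambda>n x. real (Suc n) * flat_step (Suc 0) (real (Suc n) * (x - s)) * flat_step 0 (real (Suc n) * (t - x)) * gc x"
  let ?B = "\<lambda>n x. real (Suc n) * flat_step 0 (real (Suc n) * (x - s)) * flat_step (Suc 0) (real (Suc n) * (t - x)) * gc x"
  have cont: "continuous_on UNIV (?A n)" "continuous_on UNIV (?B n)" for n
    by (intro continuous_intros continuous_on_compose2[OF flat_step_continuous] gc_cont; simp)+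
  have supp: "?A n x = 0 \<and> ?B n x = 0" if "x \<notin> {s..t}" for n x
    using that by (auto simp: flat_step_0 flat_step_1 zero_less_mult_iff simp del: of_nat_Suc)
  have int: "integrable lborel (?A n)" "integrable lborel (?B n)" for n
    by (rule integrable_continuous_compact_support[OF cont(1) compact_Icc]; use supp in blast)
       (rule integrable_continuous_compact_support[OF cont(2) compact_Icc]; use supp in blast)
  have lhs: "(LINT x|lebesgue_on {0<..}. deriv (?\<eta> n) x * g x) = (LINT x|lborel. ?A n x) - (LINT x|lborel. ?B n x)" for n
  proof -
    have "(LINT x|lebesgue_on {0<..}. deriv (?\<eta> n) x * g x) = (LINT x|lebesgue. indicator {0<..} x * (deriv (?\<eta> n) x * g x))"
      by (simp add: integral_restrict_space)
    also have "(\<lambda>x. indicator {0<..} x * (deriv (?\<eta> n) x * g x)) = (\<lambda>x. ?A n x - ?B n x)"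
    proof
      fix x
      show "indicator {0<..} x * (deriv (?\<eta> n) x * g x) = ?A n x - ?B n x"
      proof (cases "x \<in> {s..t}")
        case True
        then have "gc x = g x" "x > 0" using st by (auto simp: gc_def max_def min_def)
        then show ?thesis unfolding box_bump_real_deriv by (simp add: left_diff_distrib del: of_nat_Suc)
      next
        case False
        then have "deriv (?\<eta> n) x = 0"
          unfolding box_bump_real_deriv by (auto simp: flat_step_0 flat_step_1 zero_less_mult_iff simp del: of_nat_Suc)
        then show ?thesis
          by (simp only: conjunct1[OF supp[OF False]] conjunct2[OF supp[OF False]] mult_zero_left mult_zero_right diff_self)
      qed
    qed
    also have "(LINT x|lebesgue. ?A n x - ?B n x) = (LINT x|lborel. ?A n x - ?B n x)"
      using int[of n] by (intro integral_completion borel_measurable_diff borel_measurable_integrable)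
    finally show ?thesis using int[of n] by simp
  qed
  have limA: "(\<lambda>n. LINT x|lborel. ?A n x) \<longlonglongrightarrow> g s"
    using flat_step_kernel_tendsto[OF gc_cont gc_B st(2)] st by (simp add: gc_def)
  have limB: "(\<lambda>n. LINT x|lborel. ?B n x) \<longlonglongrightarrow> g t"
  proof -
    \<comment> \<open>Reflection turns the kernel at the right end \<open>t\<close> into the
      standard one at \<open>- t\<close>, so the same limit applies to both ends.\<close>
    have refl: "(LINT x|lborel. ?B n x) = (LINT x|lborel. real (Suc n) * flat_step (Suc 0) (real (Suc n) * (x - (- t))) *
        flat_step 0 (real (Suc n) * (- s - x)) * gc (- x))" for n
      by (subst lborel_integral_real_affine[where c = "-1" and t = 0]) (auto simp: algebra_simps simp del: of_nat_Suc)
    have "continuous_on UNIV (\<lambda>x. gc (- x))"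
      by (intro continuous_on_compose2[OF gc_cont] continuous_intros) auto
    from flat_step_kernel_tendsto[OF this gc_B, of "- t" "- s"]
    have "(\<lambda>n. LINT x|lborel. ?B n x) \<longlonglongrightarrow> gc (- (- t))" using st(2) by (simp only: refl neg_less_iff_less)
    then show ?thesis using st by (simp add: gc_def)
  qed
  have "(\<lambda>n. LINT r|lebesgue_on {0<..}. ?\<eta> n r * k r) \<longlonglongrightarrow> (LINT r|lebesgue. indicator {s<..<t} r * k r)"
  proof -
    have eq: "(LINT r|lebesgue_on {0<..}. ?\<eta> n r * k r) = (LINT r|lebesgue. ?\<eta> n r * (indicator {0<..<b} r * k r))" for n
    proof -
      have "indicator {0<..} r * (?\<eta> n r * k r) = ?\<eta> n r * (indicator {0<..<b} r * k r)" for r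
        using box_bump_support[of s t "Suc n" r] st
        by (cases "box_bump s t (Suc n) r = 0") (auto split: split_indicator)
      then have "(\<lambda>r. indicator {0<..} r * (?\<eta> n r * k r)) = (\<lambda>r. ?\<eta> n r * (indicator {0<..<b} r * k r))"
        by (rule ext)
      moreover have "(LINT r|lebesgue_on {0<..}. ?\<eta> n r * k r) = (LINT r|lebesgue. indicator {0<..} r * (?\<eta> n r * k r))"
        by (simp add: integral_restrict_space)
      ultimately show ?thesis by (simp only:)
    qed
    have "(\<lambda>n. LINT r|lebesgue. ?\<eta> n r * (indicator {0<..<b} r * k r)) \<longlonglongrightarrow>
        (LINT r|lebesgue. indicator {s<..<t} r * (indicator {0<..<b} r * k r))"
    proof (rule integral_dominated_convergence[where w = "\<lambda>r. \<bar>indicator {0<..<b} r * k r\<bar>"])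
      show "AE r in lebesgue. (\<lambda>n. ?\<eta> n r * (indicator {0<..<b} r * k r)) \<longlonglongrightarrow> indicator {s<..<t} r * (indicator {0<..<b} r * k r)"
        using LIMSEQ_Suc[OF box_bump_tendsto[of s t]] by (intro AE_I2 tendsto_mult tendsto_const) (simp add: box_real)
      show "AE r in lebesgue. norm (?\<eta> n r * (indicator {0<..<b} r * k r)) \<le> \<bar>indicator {0<..<b} r * k r\<bar>" for n
        using box_bump_bounds[of s t "Suc n"] by (intro AE_I2) (auto simp: abs_mult intro: mult_left_le_one_le)
      show "(\<lambda>r. ?\<eta> n r * (indicator {0<..<b} r * k r)) \<in> borel_measurable lebesgue" for n
        using borel_measurable_continuous_onI[OF test_functions_continuous[OF \<eta>[of n]]]
        by (intro borel_measurable_times[OF measurable_completion borel_measurable_integrable[OF k]]) simp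
      show "(\<lambda>r. indicator {s<..<t} r * (indicator {0<..<b} r * k r)) \<in> borel_measurable lebesgue"
        by (intro borel_measurable_integrable integrable_indicator_times k) auto
    qed (intro integrable_abs k)
    moreover have "indicator {s<..<t} r * (indicator {0<..<b} r * k r) = indicator {s<..<t} r * k r" for r
      using st by (auto split: split_indicator)
    ultimately show ?thesis by (simp add: eq)
  qed
  from tendsto_minus[OF this] tendsto_diff[OF limA limB]
  have "g s - g t = - (LINT r|lebesgue. indicator {s<..<t} r * k r)"
    unfolding weak[OF \<eta>, symmetric] lhs by (rule LIMSEQ_unique[rotated])
  then show ?thesis by simp
qed

text \<open>Only the left end point \<open>0\<close> is new; it is reached from positive times by
  continuity of \<open>g\<close> and dominated convergence.\<close>

lemma weak_derivative_increment:
  fixes g k :: "real \<Rightarrow> real"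
  assumes g: "continuous_on {0..} g" and k: "integrable lebesgue (\<lambda>r. indicator {0<..<b} r * k r)"
    and weak: "\<And>\<eta>. \<eta> \<in> test_functions {0<..} \<Longrightarrow>
      (LINT t|lebesgue_on {0<..}. deriv \<eta> t * g t) = - (LINT t|lebesgue_on {0<..}. \<eta> t * k t)"
    and st: "0 \<le> s" "s \<le> t" "t \<le> b"
  shows "g t - g s = (LINT r|lebesgue. indicator {s<..<t} r * k r)"
proof -
  consider "s = t" | "0 < s" "s < t" | "s = 0" "0 < t" using st by linarith
  then show ?thesis
  proof cases
    case 2
    then show ?thesis using weak_derivative_increment_pos[OF g k weak] st by blast
  next
    case 3
    \<comment> \<open>The double successor keeps \<open>sn n\<close> strictly below \<open>t\<close>
      already for \<open>n = 0\<close>.\<close>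
    define sn where "sn n = t * (1 / real (Suc (Suc n)))" for n
    have sn0: "sn \<longlonglongrightarrow> 0"
      unfolding sn_def using tendsto_mult_right_zero[OF LIMSEQ_Suc[OF LIMSEQ_Suc[OF lim_1_over_n]]] by simp
    have sn: "0 < sn n" "sn n < t" for n
      using 3 mult_strict_left_mono[of "1 / real (Suc (Suc n))" 1 t] by (simp_all add: sn_def)
    have "(\<lambda>n. g (sn n)) \<longlonglongrightarrow> g 0"
      using g sn(1) sn0 by (auto simp: continuous_on_sequentially o_def less_imp_le)
    then have 1: "(\<lambda>n. g t - g (sn n)) \<longlonglongrightarrow> g t - g 0" by (intro tendsto_intros)
    have "(\<lambda>n. LINT r|lebesgue. indicator {sn n<..<t} r * (indicator {0<..<b} r * k r)) \<longlonglongrightarrow>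
        (LINT r|lebesgue. indicator {0<..<t} r * (indicator {0<..<b} r * k r))"
    proof (rule integral_dominated_convergence[where w = "\<lambda>r. \<bar>indicator {0<..<b} r * k r\<bar>"])
      show "AE r in lebesgue. (\<lambda>n. indicator {sn n<..<t} r * (indicator {0<..<b} r * k r)) \<longlonglongrightarrow> indicator {0<..<t} r * (indicator {0<..<b} r * k r)"
      proof (rule AE_I2)
        fix r
        show "(\<lambda>n. indicator {sn n<..<t} r * (indicator {0<..<b} r * k r)) \<longlonglongrightarrow> indicator {0<..<t} r * (indicator {0<..<b} r * k r)"
        proof (cases "0 < r")
          case True
          have "\<forall>\<^sub>F n in sequentially. sn n < r" using order_tendstoD(2)[OF sn0 True] .
          then have "\<forall>\<^sub>F n in sequentially. indicator {sn n<..<t} r * (indicator {0<..<b} r * k r) = indicator {0<..<t} r * (indicator {0<..<b} r * k r)"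
            by eventually_elim (use True in \<open>auto split: split_indicator\<close>)
          then show ?thesis by (rule tendsto_eventually)
        qed simp
      qed
      show "(\<lambda>r. indicator {sn n<..<t} r * (indicator {0<..<b} r * k r)) \<in> borel_measurable lebesgue"
        "(\<lambda>r. indicator {0<..<t} r * (indicator {0<..<b} r * k r)) \<in> borel_measurable lebesgue" for n
        by (intro borel_measurable_integrable integrable_indicator_times k; simp)+
      show "AE r in lebesgue. norm (indicator {sn n<..<t} r * (indicator {0<..<b} r * k r)) \<le> \<bar>indicator {0<..<b} r * k r\<bar>" for n
        by (intro AE_I2) (auto simp: abs_mult split: split_indicator)
    qed (intro integrable_abs k)
    moreover have "indicator {s'<..<t} r * (indicator {0<..<b} r * k r) = indicator {s'<..<t} r * k r" if "0 \<le> s'" for s' r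
      using that st by (auto split: split_indicator)
    ultimately have "(\<lambda>n. LINT r|lebesgue. indicator {sn n<..<t} r * k r) \<longlonglongrightarrow> (LINT r|lebesgue. indicator {0<..<t} r * k r)"
      using sn(1) by (simp add: less_imp_le)
    moreover have "(LINT r|lebesgue. indicator {sn n<..<t} r * k r) = g t - g (sn n)" for n
      using weak_derivative_increment_pos[OF g k weak sn(1) sn(2) st(3)] by simp
    ultimately show ?thesis using LIMSEQ_unique[OF 1] 3 by simp
  qed simp
qed

section \<open>Functionals in \<open>Hminus1\<close> and their norm\<close>

lemma test_function_zero: "(\<lambda>x. 0) \<in> test_functions U"
  by (rule test_functionsI[of _ "{}"]) (auto simp: C_k_const)

lemma H10_zero: "open \<Omega> \<Longrightarrow> (\<lambda>x. 0) \<in> H10 \<Omega>"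
  by (intro test_function_H10 test_function_zero)

lemma h10norm_zero:
  assumes "open \<Omega>"
  shows "h10norm \<Omega> (\<lambda>x. 0) = 0"
  using h10norm_scale[OF assms H10_H1[OF H10_zero[OF assms]], of 0] by simp

lemma Hminus1_lincomb:
  "F \<in> Hminus1 \<Omega> \<Longrightarrow> v \<in> H10 \<Omega> \<Longrightarrow> w \<in> H10 \<Omega> \<Longrightarrow> F (\<lambda>x. a * v x + b * w x) = a * F v + b * F w"
  by (simp add: Hminus1_def)

lemma Hminus1_diff_right:
  "F \<in> Hminus1 \<Omega> \<Longrightarrow> v \<in> H10 \<Omega> \<Longrightarrow> w \<in> H10 \<Omega> \<Longrightarrow> F (\<lambda>x. v x - w x) = F v - F w"
  using Hminus1_lincomb[of F \<Omega> v w 1 "-1"] by simp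

lemma hm1norm_bdd_above:
  assumes "F \<in> Hminus1 \<Omega>"
  shows "bdd_above {\<bar>F v\<bar> | v. v \<in> H10 \<Omega> \<and> h10norm \<Omega> v \<le> 1}"
proof -
  obtain C where C: "\<And>v. v \<in> H10 \<Omega> \<Longrightarrow> \<bar>F v\<bar> \<le> C * h10norm \<Omega> v"
    using assms unfolding Hminus1_def by blast
  \<comment> \<open>The constant in the definition of \<open>Hminus1\<close> carries no
    sign.\<close>
  have "\<bar>F v\<bar> \<le> max C 0" if "v \<in> H10 \<Omega>" "h10norm \<Omega> v \<le> 1" for v
  proof -
    have "C * h10norm \<Omega> v \<le> max C 0 * h10norm \<Omega> v" by (intro mult_right_mono) (auto simp: h10norm_nonneg)
    also have "\<dots> \<le> max C 0 * 1" using that by (intro mult_left_mono) auto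
    finally show ?thesis using C[OF that(1)] by simp
  qed
  then show ?thesis by (auto intro!: bdd_aboveI[of _ "max C 0"])
qed

text \<open>Normalization gives the bound when the gradient seminorm of \<open>v\<close> is
  positive. If it is zero, the bound required for membership in \<open>Hminus1\<close> already
  forces \<open>F v = 0\<close>.\<close>

lemma Hminus1_bound:
  assumes \<Omega>: "open \<Omega>" and F: "F \<in> Hminus1 \<Omega>" and v: "v \<in> H10 \<Omega>"
  shows "\<bar>F v\<bar> \<le> hm1norm \<Omega> F * h10norm \<Omega> v"
proof (cases "h10norm \<Omega> v = 0")
  case True
  obtain C where "\<bar>F v\<bar> \<le> C * h10norm \<Omega> v" using F v unfolding Hminus1_def by blast
  then show ?thesis using True by simp
next
  case False
  define c where "c = 1 / h10norm \<Omega> v"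
  have c: "c > 0" using False h10norm_nonneg[of \<Omega> v] by (simp add: c_def)
  let ?w = "\<lambda>x. c * v x"
  have w: "?w \<in> H10 \<Omega>" using H10_lincomb[OF \<Omega> v v, of c 0] by simp
  have "h10norm \<Omega> ?w = 1"
    using h10norm_scale[OF \<Omega> H10_H1[OF v], of c] c False by (simp add: c_def)
  then have "\<bar>F ?w\<bar> \<le> hm1norm \<Omega> F"
    unfolding hm1norm_def using w by (intro cSup_upper hm1norm_bdd_above[OF F]) auto
  moreover have "F ?w = c * F v" using Hminus1_lincomb[OF F v v, of c 0] by simp
  ultimately have "c * \<bar>F v\<bar> \<le> hm1norm \<Omega> F" using c by (simp add: abs_mult)
  then show ?thesis using False h10norm_nonneg[of \<Omega> v] by (simp add: c_def pos_divide_le_eq)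
qed

lemma hm1norm_nonneg:
  assumes \<Omega>: "open \<Omega>" and F: "F \<in> Hminus1 \<Omega>"
  shows "0 \<le> hm1norm \<Omega> F"
proof -
  have "\<bar>F (\<lambda>x. 0)\<bar> \<le> hm1norm \<Omega> F"
    unfolding hm1norm_def using H10_zero[OF \<Omega>] h10norm_zero[OF \<Omega>]
    by (intro cSup_upper hm1norm_bdd_above[OF F]) auto
  then show ?thesis by linarith
qed

lemma Hminus1_diff:
  assumes \<Omega>: "open \<Omega>" and F: "F \<in> Hminus1 \<Omega>" and G: "G \<in> Hminus1 \<Omega>"
  shows "F - G \<in> Hminus1 \<Omega>"
  unfolding Hminus1_def
proof (intro CollectI conjI ballI allI)
  fix v w a b assume "v \<in> H10 \<Omega>" "w \<in> H10 \<Omega>"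
  then show "(F - G) (\<lambda>x. a * v x + b * w x) = a * (F - G) v + b * (F - G) w"
    using Hminus1_lincomb[OF F] Hminus1_lincomb[OF G] by (simp add: algebra_simps)
next
  have "\<bar>(F - G) v\<bar> \<le> (hm1norm \<Omega> F + hm1norm \<Omega> G) * h10norm \<Omega> v" if "v \<in> H10 \<Omega>" for v
    using Hminus1_bound[OF \<Omega> F that] Hminus1_bound[OF \<Omega> G that] by (simp add: distrib_right)
  then show "\<exists>C. \<forall>v\<in>H10 \<Omega>. \<bar>(F - G) v\<bar> \<le> C * h10norm \<Omega> v" by blast
qed

section \<open>Measurability and simple approximation of functions of time\<close>

lemma borel_measurable_AE_limit:
  fixes f :: "real \<Rightarrow> real"
  assumes J: "J \<in> sets lebesgue" and fs: "\<And>n. fs n \<in> borel_measurable (lebesgue_on J)"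
    and lim: "AE t in lebesgue_on J. (\<lambda>n. fs n t) \<longlonglongrightarrow> f t"
  shows "f \<in> borel_measurable (lebesgue_on J)"
proof -
  define F where "F n t = indicator J t * fs n t" for n t
  have "F n \<in> borel_measurable lebesgue" for n
    using fs[of n] J by (simp add: borel_measurable_restrict_space_iff F_def[abs_def])
  then have "(\<lambda>t. lim (\<lambda>n. F n t)) \<in> borel_measurable lebesgue"
    by (rule borel_measurable_lim_metric)
  moreover have "AE t in lebesgue. lim (\<lambda>n. F n t) = indicator J t * f t"
  proof -
    have "AE t in lebesgue. t \<in> J \<longrightarrow> (\<lambda>n. fs n t) \<longlonglongrightarrow> f t" using lim J by (simp add: AE_restrict_space_iff)
    then show ?thesis
    proof eventually_elim
      case (elim t)
      then have "(\<lambda>n. F n t) \<longlonglongrightarrow> indicator J t * f t"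
        by (cases "t \<in> J") (auto simp: F_def)
      then show ?case by (rule limI)
    qed
  qed
  ultimately have "(\<lambda>t. indicator J t * f t) \<in> borel_measurable lebesgue"
    by (rule borel_measurable_AE)
  then show ?thesis using J by (simp add: borel_measurable_restrict_space_iff)
qed

text \<open>A family indexed by \<open>v\<close> may be evaluated at a time-dependent simple index,
  since only finitely many \<open>v\<close> occur. This lifts facts about pairings with a fixed
  element to pairings with a simple function.\<close>

lemma simple_function_select:
  assumes z: "simple_function M z"
  shows "t \<in> space M \<Longrightarrow> f (z t) t = (\<Sum>v\<in>z ` space M. indicator (z -` {v} \<inter> space M) t * (f v t :: real))"
    and "(\<And>v. v \<in> z ` space M \<Longrightarrow> f v \<in> borel_measurable M) \<Longrightarrow> (\<lambda>t. f (z t) t) \<in> borel_measurable M"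
    and "(\<And>v. v \<in> z ` space M \<Longrightarrow> integrable M (f v)) \<Longrightarrow> integrable M (\<lambda>t. f (z t) t)"
proof -
  have fin: "finite (z ` space M)" and sets: "\<And>v. z -` {v} \<inter> space M \<in> sets M"
    using simple_functionD[OF z] by auto
  show eq: "f (z t) t = (\<Sum>v\<in>z ` space M. indicator (z -` {v} \<inter> space M) t * f v t)" if "t \<in> space M" for t
  proof -
    have "(\<Sum>v\<in>z ` space M. indicator (z -` {v} \<inter> space M) t * f v t) = (\<Sum>v\<in>z ` space M. if v = z t then f v t else 0)"
      using that by (intro sum.cong) (auto split: split_indicator)
    also have "\<dots> = f (z t) t" using that fin by (simp add: sum.delta')
    finally show ?thesis by simp
  qed
  show "(\<lambda>t. f (z t) t) \<in> borel_measurable M" if "\<And>v. v \<in> z ` space M \<Longrightarrow> f v \<in> borel_measurable M"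
    using that sets by (subst measurable_cong[OF eq]) (auto intro!: borel_measurable_sum borel_measurable_times borel_measurable_indicator)
  show "integrable M (\<lambda>t. f (z t) t)" if "\<And>v. v \<in> z ` space M \<Longrightarrow> integrable M (f v)"
  proof (subst Bochner_Integration.integrable_cong[OF refl eq])
    show "integrable M (\<lambda>t. \<Sum>v\<in>z ` space M. indicator (z -` {v} \<inter> space M) t * f v t)"
      using integrable_mult_indicator[OF sets that] by (intro Bochner_Integration.integrable_sum) simp
  qed
qed

lemma h10norm_diff_triangle:
  assumes "open \<Omega>" "u \<in> H10 \<Omega>" "v \<in> H10 \<Omega>" "w \<in> H10 \<Omega>"
  shows "h10norm \<Omega> (\<lambda>x. u x - w x) \<le> h10norm \<Omega> (\<lambda>x. u x - v x) + h10norm \<Omega> (\<lambda>x. v x - w x)"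
  using h10norm_add[OF assms(1) H10_H1[OF H10_diff[OF assms(1,2,3)]] H10_H1[OF H10_diff[OF assms(1,3,4)]]] by simp

lemma h10norm_minus_commute:
  assumes "open \<Omega>" "v \<in> H10 \<Omega>" "w \<in> H10 \<Omega>"
  shows "h10norm \<Omega> (\<lambda>x. v x - w x) = h10norm \<Omega> (\<lambda>x. w x - v x)"
  using h10norm_scale[OF assms(1) H10_H1[OF H10_diff[OF assms]], of "-1"] by simp

lemma strongly_measurable_H10:
  assumes \<Omega>: "open \<Omega>" and J: "J \<in> sets lebesgue" and u: "strongly_measurable J (H10 \<Omega>) (h10norm \<Omega>) u"
  obtains s where "AE t in lebesgue_on J. u t \<in> H10 \<Omega>" "\<And>n. simple_function (lebesgue_on J) (s n)"
    "\<And>n t. t \<in> J \<Longrightarrow> s n t \<in> H10 \<Omega>" "AE t in lebesgue_on J. (\<lambda>n. h10norm \<Omega> (\<lambda>x. u t x - s n t x)) \<longlonglongrightarrow> 0"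
proof -
  obtain s where s: "\<And>n. simple_function (lebesgue_on J) (s n)" "\<And>n t. t \<in> J \<Longrightarrow> s n t \<in> H10 \<Omega>"
    "AE t in lebesgue_on J. (\<lambda>n. h10norm \<Omega> (s n t - u t)) \<longlonglongrightarrow> 0" and ae: "AE t in lebesgue_on J. u t \<in> H10 \<Omega>"
    using u unfolding strongly_measurable_def by blast
  have "AE t in lebesgue_on J. (\<lambda>n. h10norm \<Omega> (\<lambda>x. u t x - s n t x)) \<longlonglongrightarrow> 0"
    using s(3) ae AE_space[of "lebesgue_on J"]
  proof eventually_elim
    case (elim t)
    then have "t \<in> J" by simp
    then show ?case using elim h10norm_minus_commute[OF \<Omega> s(2) elim(2)] by (simp add: fun_diff_def)
  qed
  then show ?thesis using that ae s by blast
qed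

text \<open>The norm of the difference depends on \<open>u t\<close> with Lipschitz constant one, so
  it is an almost everywhere limit of simple functions.\<close>

lemma h10norm_diff_measurable:
  assumes \<Omega>: "open \<Omega>" and J: "J \<in> sets lebesgue" and u: "strongly_measurable J (H10 \<Omega>) (h10norm \<Omega>) u"
    and v: "v \<in> H10 \<Omega>"
  shows "(\<lambda>t. h10norm \<Omega> (\<lambda>x. u t x - v x)) \<in> borel_measurable (lebesgue_on J)"
proof -
  obtain s where s: "AE t in lebesgue_on J. u t \<in> H10 \<Omega>" "\<And>n. simple_function (lebesgue_on J) (s n)"
    "\<And>n t. t \<in> J \<Longrightarrow> s n t \<in> H10 \<Omega>" "AE t in lebesgue_on J. (\<lambda>n. h10norm \<Omega> (\<lambda>x. u t x - s n t x)) \<longlonglongrightarrow> 0"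
    by (rule strongly_measurable_H10[OF \<Omega> J u]) blast
  show ?thesis
  proof (rule borel_measurable_AE_limit[OF J])
    show "(\<lambda>t. h10norm \<Omega> (\<lambda>x. s n t x - v x)) \<in> borel_measurable (lebesgue_on J)" for n
      by (rule borel_measurable_simple_function[OF simple_function_compose1[OF s(2), of "\<lambda>w. h10norm \<Omega> (\<lambda>x. w x - v x)"]])
    show "AE t in lebesgue_on J. (\<lambda>n. h10norm \<Omega> (\<lambda>x. s n t x - v x)) \<longlonglongrightarrow> h10norm \<Omega> (\<lambda>x. u t x - v x)"
      using s(1,4) AE_space[of "lebesgue_on J"]
    proof eventually_elim
      case (elim t)
      then have sn: "s n t \<in> H10 \<Omega>" for n using s(3) by simp
      have "norm (h10norm \<Omega> (\<lambda>x. s n t x - v x) - h10norm \<Omega> (\<lambda>x. u t x - v x)) \<le> h10norm \<Omega> (\<lambda>x. u t x - s n t x)" for n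
        using h10norm_diff_triangle[OF \<Omega> sn[of n] elim(1) v] h10norm_diff_triangle[OF \<Omega> elim(1) sn[of n] v]
          h10norm_minus_commute[OF \<Omega> sn[of n] elim(1)] by (simp add: abs_le_iff)
      then have "(\<lambda>n. h10norm \<Omega> (\<lambda>x. s n t x - v x) - h10norm \<Omega> (\<lambda>x. u t x - v x)) \<longlonglongrightarrow> 0"
        by (intro Lim_null_comparison[OF always_eventually elim(2)]) simp
      then show ?case by (rule LIM_zero_cancel)
    qed
  qed
qed

lemma Hminus1_pairing_measurable:
  assumes \<Omega>: "open \<Omega>" and J: "J \<in> sets lebesgue" and w: "strongly_measurable J (Hminus1 \<Omega>) (hm1norm \<Omega>) w"
    and v: "v \<in> H10 \<Omega>"
  shows "(\<lambda>t. w t v) \<in> borel_measurable (lebesgue_on J)"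
proof -
  obtain s where s: "\<And>n. simple_function (lebesgue_on J) (s n)" "\<And>n t. t \<in> J \<Longrightarrow> s n t \<in> Hminus1 \<Omega>"
    "AE t in lebesgue_on J. (\<lambda>n. hm1norm \<Omega> (s n t - w t)) \<longlonglongrightarrow> 0" and ae: "AE t in lebesgue_on J. w t \<in> Hminus1 \<Omega>"
    using w unfolding strongly_measurable_def by blast
  show ?thesis
  proof (rule borel_measurable_AE_limit[OF J])
    show "(\<lambda>t. s n t v) \<in> borel_measurable (lebesgue_on J)" for n
      by (rule borel_measurable_simple_function[OF simple_function_compose1[OF s(1), of "\<lambda>F. F v"]])
    show "AE t in lebesgue_on J. (\<lambda>n. s n t v) \<longlonglongrightarrow> w t v"
      using s(3) ae AE_space[of "lebesgue_on J"]
    proof eventually_elim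
      case (elim t)
      then have t: "t \<in> J" by simp
      have "\<forall>n. norm (s n t v - w t v) \<le> hm1norm \<Omega> (s n t - w t) * h10norm \<Omega> v"
        using Hminus1_bound[OF \<Omega> Hminus1_diff[OF \<Omega> s(2)[OF t] elim(2)] v] by simp
      from Lim_null_comparison[OF always_eventually[OF this] tendsto_mult_left_zero[OF elim(1)]]
      show ?case by (rule LIM_zero_cancel)
    qed
  qed
qed

text \<open>Strong measurability gives approximation only pointwise almost everywhere. Setting an
  approximant to zero wherever its norm is large relative to that of \<open>u t\<close> creates a
  dominating function and leaves the pointwise limit unchanged.\<close>

lemma H10_simple_approx_L4:
  assumes \<Omega>: "open \<Omega>" and J: "J \<in> sets lebesgue" and u: "u \<in> bochner_Lp 4 J (H10 \<Omega>) (h10norm \<Omega>)" and e: "e > 0"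
  obtains z where "simple_function (lebesgue_on J) z" "\<And>t. t \<in> J \<Longrightarrow> z t \<in> H10 \<Omega>"
    "integrable (lebesgue_on J) (\<lambda>t. (h10norm \<Omega> (\<lambda>x. u t x - z t x)) ^ 4)"
    "(LINT t|lebesgue_on J. (h10norm \<Omega> (\<lambda>x. u t x - z t x)) ^ 4) < e"
proof -
  let ?M = "lebesgue_on J"
  have sm: "strongly_measurable J (H10 \<Omega>) (h10norm \<Omega>) u" using u by (simp add: bochner_Lp_def)
  have int: "integrable ?M (\<lambda>t. (h10norm \<Omega> (u t)) ^ 4)"
    using u h10norm_nonneg[of \<Omega>] by (simp add: bochner_Lp_def powr_numeral)
  obtain s where s: "AE t in ?M. u t \<in> H10 \<Omega>" "\<And>n. simple_function ?M (s n)"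
    "\<And>n t. t \<in> J \<Longrightarrow> s n t \<in> H10 \<Omega>" "AE t in ?M. (\<lambda>n. h10norm \<Omega> (\<lambda>x. u t x - s n t x)) \<longlonglongrightarrow> 0"
    by (rule strongly_measurable_H10[OF \<Omega> J sm]) blast
  \<comment> \<open>The factor \<open>2\<close> must exceed one: approximants whose distance from
    \<open>u t\<close> is below its norm are kept.\<close>
  define A where "A n = {t \<in> space ?M. h10norm \<Omega> (s n t) \<le> 2 * h10norm \<Omega> (u t)}" for n
  have hu: "(\<lambda>t. h10norm \<Omega> (u t)) \<in> borel_measurable ?M"
    using h10norm_diff_measurable[OF \<Omega> J sm H10_zero[OF \<Omega>]] by simp
  have hs: "(\<lambda>t. h10norm \<Omega> (s n t)) \<in> borel_measurable ?M" for n
    by (rule borel_measurable_simple_function[OF simple_function_compose1[OF s(2)]])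
  have A: "A n \<in> sets ?M" for n unfolding A_def using hu hs[of n] by measurable
  define z where "z n t = (if t \<in> A n then s n t else (\<lambda>x. 0))" for n t
  have z: "simple_function ?M (z n)" for n
    unfolding z_def using A s(2) by (intro simple_function_If_set) (auto simp: A_def)
  have zH: "z n t \<in> H10 \<Omega>" if "t \<in> J" for n t using that s(3) H10_zero[OF \<Omega>] by (simp add: z_def)
  let ?d = "\<lambda>n t. h10norm \<Omega> (\<lambda>x. u t x - z n t x)"
  have d_meas: "?d n \<in> borel_measurable ?M" for n
    using simple_function_select(2)[OF z, of n "\<lambda>v t. h10norm \<Omega> (\<lambda>x. u t x - v x)"]
      h10norm_diff_measurable[OF \<Omega> J sm] zH by auto
  have key: "AE t in ?M. (\<forall>n. ?d n t \<le> 3 * h10norm \<Omega> (u t)) \<and> (\<lambda>n. ?d n t) \<longlonglongrightarrow> 0"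
    using s(1,4) AE_space[of ?M]
  proof eventually_elim
    case (elim t)
    then have t: "t \<in> J" by simp
    have tri: "h10norm \<Omega> (\<lambda>x. u t x - w x) \<le> h10norm \<Omega> (u t) + h10norm \<Omega> w"
      "h10norm \<Omega> w \<le> h10norm \<Omega> (u t) + h10norm \<Omega> (\<lambda>x. u t x - w x)" if "w \<in> H10 \<Omega>" for w
      using h10norm_diff_triangle[OF \<Omega> elim(1) H10_zero[OF \<Omega>] that] h10norm_minus_commute[OF \<Omega> H10_zero[OF \<Omega>] that]
        h10norm_diff_triangle[OF \<Omega> that elim(1) H10_zero[OF \<Omega>]] h10norm_minus_commute[OF \<Omega> that elim(1)] by simp_all
    have zb: "h10norm \<Omega> (z n t) \<le> 2 * h10norm \<Omega> (u t)" for n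
      using h10norm_nonneg[of \<Omega> "u t"] h10norm_zero[OF \<Omega>] by (auto simp: z_def A_def)
    have 1: "?d n t \<le> 3 * h10norm \<Omega> (u t)" for n
      using tri(1)[OF zH[OF t, of n]] zb[of n] by simp
    have "(\<lambda>n. ?d n t) \<longlonglongrightarrow> 0"
    \<comment> \<open>Where \<open>u t\<close> has norm zero the domination alone gives the limit;
      elsewhere the cut-off is eventually inactive.\<close>
    proof (cases "h10norm \<Omega> (u t) = 0")
      case True
      then have "?d n t = 0" for n using 1[of n] h10norm_nonneg[of \<Omega> "\<lambda>x. u t x - z n t x"] by simp
      then show ?thesis by simp
    next
      case False
      then have "h10norm \<Omega> (u t) > 0" using h10norm_nonneg[of \<Omega> "u t"] by simp
      from order_tendstoD(2)[OF elim(2) this]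
      have "\<forall>\<^sub>F n in sequentially. h10norm \<Omega> (\<lambda>x. u t x - s n t x) = ?d n t"
      proof eventually_elim
        case (elim n)
        then have "t \<in> A n" using tri(2)[OF s(3)[OF t, of n]] t by (simp add: A_def)
        then show ?case by (simp add: z_def)
      qed
      from Lim_transform_eventually[OF elim(2) this] show ?thesis .
    qed
    with 1 show ?case by blast
  qed
  have bound: "AE t in ?M. norm ((?d n t) ^ 4) \<le> 81 * (h10norm \<Omega> (u t)) ^ 4" for n
    using key
  proof eventually_elim
    case (elim t)
    then have "(?d n t) ^ 4 \<le> (3 * h10norm \<Omega> (u t)) ^ 4" by (intro power_mono h10norm_nonneg) auto
    then show ?case by (simp add: power_mult_distrib h10norm_nonneg)
  qed
  have "(\<lambda>n. LINT t|?M. (?d n t) ^ 4) \<longlonglongrightarrow> integral\<^sup>L ?M (\<lambda>_. 0)"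
  proof (rule integral_dominated_convergence[where w = "\<lambda>t. 81 * (h10norm \<Omega> (u t)) ^ 4"])
    show "AE t in ?M. (\<lambda>n. (?d n t) ^ 4) \<longlonglongrightarrow> 0"
      using key by eventually_elim (use tendsto_power[of _ 0 sequentially 4] in fastforce)
  qed (use bound d_meas int in auto)
  then have "\<forall>\<^sub>F n in sequentially. (LINT t|?M. (?d n t) ^ 4) < e"
    using e by (intro order_tendstoD(2)) auto
  then obtain n where n: "(LINT t|?M. (?d n t) ^ 4) < e" using eventually_happens by fastforce
  have "integrable ?M (\<lambda>t. (?d n t) ^ 4)"
    by (rule Bochner_Integration.integrable_bound[where f = "\<lambda>t. 81 * (h10norm \<Omega> (u t)) ^ 4"])
       (use int d_meas bound[of n] in \<open>auto elim!: eventually_mono\<close>)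
  then show ?thesis using that[OF z[of n] zH] n by blast
qed

section \<open>The energy inequality\<close>

lemma integrable_lebesgue_on_iff:
  fixes f :: "real \<Rightarrow> real"
  assumes "J \<in> sets lebesgue"
  shows "integrable (lebesgue_on J) f \<longleftrightarrow> integrable lebesgue (\<lambda>t. indicator J t * f t)"
    and "(LINT t|lebesgue_on J. f t) = (LINT t|lebesgue. indicator J t * f t)"
  using assms by (simp_all add: integrable_restrict_space integral_restrict_space)

lemma integrable_lebesgue_on_subset:
  fixes g :: "real \<Rightarrow> real"
  assumes J: "J \<in> sets lebesgue" and g: "integrable lebesgue g"
  shows "integrable (lebesgue_on J) g" and "(LINT t|lebesgue_on J. \<bar>g t\<bar>) \<le> (LINT t|lebesgue. \<bar>g t\<bar>)"
proof -
  show "integrable (lebesgue_on J) g"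
    using integrable_indicator_times[OF g J] by (simp add: integrable_lebesgue_on_iff J)
  show "(LINT t|lebesgue_on J. \<bar>g t\<bar>) \<le> (LINT t|lebesgue. \<bar>g t\<bar>)"
    unfolding integrable_lebesgue_on_iff(2)[OF J]
    using g J by (intro integral_mono integrable_indicator_times integrable_abs) (auto split: split_indicator)
qed

lemma integrable_continuous_Ioo:
  fixes f :: "real \<Rightarrow> real"
  assumes "continuous_on {a..b} f"
  shows "integrable (lebesgue_on {a<..<b}) f" "(LINT t|lebesgue_on {a<..<b}. f t) = integral {a..b} f"
proof -
  have "integrable lborel (\<lambda>t. indicator {a..b} t *\<^sub>R f t)"
    by (rule borel_integrable_compact[OF compact_Icc assms])
  then have "integrable lebesgue (\<lambda>t. indicator {a..b} t * f t)"
    by (simp add: integrable_completion borel_measurable_integrable)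
  from integrable_indicator_times[OF this, of "{a<..<b}"]
  have "integrable lebesgue (\<lambda>t. indicator {a<..<b} t * f t)"
    by (rule back_subst[of "integrable lebesgue"]) (auto split: split_indicator)
  then show *: "integrable (lebesgue_on {a<..<b}) f" by (simp add: integrable_lebesgue_on_iff)
  show "(LINT t|lebesgue_on {a<..<b}. f t) = integral {a..b} f"
    using lebesgue_integral_eq_integral[OF *] integral_open_interval_real[of a b f] by simp
qed

text \<open>\<open>E\<close> is merely continuous, so a discrete product rule moves the difference
  onto the weight. The quotient of the product \<open>Y\<close> integrates to boundary terms; the
  quotient of the weight converges to its derivative. The \<open>max\<close> continues
  \<open>E\<close> by the constant \<open>E 0\<close> to negative times.\<close>

lemma weighted_difference_quotient_tendsto:
  fixes E :: "real \<Rightarrow> real"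
  assumes E: "continuous_on {0..} E" and b: "0 < b" and c: "0 \<le> c"
  shows "(\<lambda>n. LINT t|lebesgue_on {0<..<b}. exp (c * t) * (real (Suc n) * (E t - E (max (t - 1 / real (Suc n)) 0))))
     \<longlonglongrightarrow> exp (c * b) * E b - E 0 - (LINT t|lebesgue_on {0<..<b}. exp (c * t) * (c * E t))"
    and "integrable (lebesgue_on {0<..<b}) (\<lambda>t. exp (c * t) * (real (Suc n) * (E t - E (max (t - 1 / real (Suc n)) 0))))"
proof -
  let ?M = "lebesgue_on {0<..<b}"
  define F where "F x = E (max x 0)" for x
  have F: "continuous_on UNIV F" unfolding F_def by (intro continuous_on_compose2[OF E] continuous_intros) auto
  define W where "W x = exp (c * x)" for x
  define Y where "Y x = W x * F x" for x
  have W: "continuous_on UNIV W" unfolding W_def by (intro continuous_intros)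
  have Y: "continuous_on UNIV Y" unfolding Y_def by (intro continuous_intros W F)
  define h where "h n = 1 / real (Suc n)" for n
  have h: "0 < h n" "h n \<le> 1" "real (Suc n) * h n = 1" for n by (auto simp: h_def)
  have FE: "F t = E t" if "t \<in> {0<..<b}" for t using that by (simp add: F_def)
  have quotient: "exp (c * t) * (real (Suc n) * (E t - E (max (t - 1 / real (Suc n)) 0)))
      = real (Suc n) * (Y t - Y (t - h n)) - real (Suc n) * (W t - W (t - h n)) * F (t - h n)"
    if "t \<in> {0<..<b}" for n t
    using FE[OF that] unfolding W_def[symmetric] Y_def F_def[symmetric] h_def[symmetric] by (simp add: algebra_simps)
  have shift: "continuous_on S (\<lambda>t. f (t - d))" if "continuous_on UNIV f" for S d and f :: "real \<Rightarrow> real"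
    by (intro continuous_on_compose2[OF that] continuous_intros) auto
  have iA: "integrable ?M (\<lambda>t. real (Suc n) * (Y t - Y (t - h n)))" for n
    by (intro integrable_continuous_Ioo continuous_intros shift[OF Y] continuous_on_subset[OF Y]) auto
  have iB: "integrable ?M (\<lambda>t. real (Suc n) * (W t - W (t - h n)) * F (t - h n))" for n
    by (intro integrable_continuous_Ioo continuous_intros shift[OF W] shift[OF F] continuous_on_subset[OF W]) auto
  show "integrable ?M (\<lambda>t. exp (c * t) * (real (Suc n) * (E t - E (max (t - 1 / real (Suc n)) 0))))"
    using Bochner_Integration.integrable_diff[OF iA iB, of n n]
    by (rule Bochner_Integration.integrable_cong[THEN iffD1, OF refl, rotated]) (simp add: quotient del: of_nat_Suc)
  have eq: "(LINT t|?M. exp (c * t) * (real (Suc n) * (E t - E (max (t - 1 / real (Suc n)) 0))))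
      = (LINT t|?M. real (Suc n) * (Y t - Y (t - h n))) - (LINT t|?M. real (Suc n) * (W t - W (t - h n)) * F (t - h n))" for n
    unfolding Bochner_Integration.integral_diff[OF iA iB, symmetric]
    by (intro Bochner_Integration.integral_cong refl quotient) simp
  have limA: "(\<lambda>n. LINT t|?M. real (Suc n) * (Y t - Y (t - h n))) \<longlonglongrightarrow> Y b - Y 0"
  proof -
    \<comment> \<open>Through an antiderivative the integrated quotient of \<open>Y\<close> becomes
      two difference quotients of \<open>Z\<close>, at \<open>b\<close> and at \<open>0\<close>. The
      larger interval makes both derivatives two-sided and leaves room for steps of length up to
      one.\<close>
    obtain Z where Z: "\<And>x. x \<in> {-2..b + 1} \<Longrightarrow> (Z has_vector_derivative Y x) (at x within {-2..b + 1})"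
      using antiderivative_continuous[OF continuous_on_subset[OF Y subset_UNIV], of "-2" "b + 1"] by blast
    have ZD: "(Z has_real_derivative Y x) (at x)" if "x \<in> {-2<..<b + 1}" for x
      using Z[of x] that by (simp add: has_real_derivative_iff_has_vector_derivative at_within_Icc_at)
    have "(LINT t|?M. real (Suc n) * (Y t - Y (t - h n)))
        = - (real (Suc n) * (Z (b + (1 / real (Suc n)) *\<^sub>R (-1)) - Z b))
          + real (Suc n) * (Z (0 + (1 / real (Suc n)) *\<^sub>R (-1)) - Z 0)" for n
    proof -
      have "(Y has_integral (Z b - Z 0)) {0..b}"
        using b ZD by (intro fundamental_theorem_of_calculus)
          (auto simp: has_real_derivative_iff_has_vector_derivative[symmetric] intro: has_field_derivative_at_within)
      moreover have "((\<lambda>t. Y (t - h n)) has_integral (Z (b - h n) - Z (0 - h n))) {0..b}"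
      proof (intro fundamental_theorem_of_calculus)
        fix t assume "t \<in> {0..b}"
        then have "(Z has_real_derivative Y (t - h n)) (at (t - h n))" using h[of n] by (intro ZD) auto
        moreover have "((\<lambda>t. t - h n) has_real_derivative 1) (at t within {0..b})"
          by (auto intro!: derivative_eq_intros)
        ultimately have "((\<lambda>t. Z (t - h n)) has_real_derivative Y (t - h n) * 1) (at t within {0..b})"
          by (rule DERIV_chain2)
        then
        have "((\<lambda>t. Z (t - h n)) has_real_derivative Y (t - h n)) (at t within {0..b})"
          by simp
        then show "((\<lambda>t. Z (t - h n)) has_vector_derivative Y (t - h n)) (at t within {0..b})"
          by (simp add: has_real_derivative_iff_has_vector_derivative)
      qed (use b in simp)
      ultimately have "((\<lambda>t. real (Suc n) * (Y t - Y (t - h n))) has_integral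
          real (Suc n) * ((Z b - Z 0) - (Z (b - h n) - Z (0 - h n)))) {0..b}"
        by (intro has_integral_mult_right has_integral_diff)
      then have "integral {0..b} (\<lambda>t. real (Suc n) * (Y t - Y (t - h n)))
          = real (Suc n) * ((Z b - Z 0) - (Z (b - h n) - Z (0 - h n)))"
        by (rule integral_unique)
      moreover have "(LINT t|?M. real (Suc n) * (Y t - Y (t - h n))) = integral {0..b} (\<lambda>t. real (Suc n) * (Y t - Y (t - h n)))"
        by (intro integrable_continuous_Ioo continuous_intros shift[OF Y] continuous_on_subset[OF Y]) auto
      ultimately show ?thesis by (simp add: h_def[symmetric] right_diff_distrib del: of_nat_Suc)
    qed
    moreover have "(\<lambda>n. - (real (Suc n) * (Z (b + (1 / real (Suc n)) *\<^sub>R (-1)) - Z b))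
          + real (Suc n) * (Z (0 + (1 / real (Suc n)) *\<^sub>R (-1)) - Z 0)) \<longlonglongrightarrow> - (Y b \<bullet> (-1)) + Y 0 \<bullet> (-1)"
      using ZD[of b] ZD[of 0] b
      by (intro tendsto_add tendsto_minus difference_quotient_tendsto) (auto simp: has_field_derivative_def)
    ultimately show ?thesis by simp
  qed
  have limB: "(\<lambda>n. LINT t|?M. real (Suc n) * (W t - W (t - h n)) * F (t - h n)) \<longlonglongrightarrow> (LINT t|?M. exp (c * t) * (c * E t))"
  proof -
    have "compact (E ` {0..b})" by (intro compact_continuous_image continuous_on_subset[OF E]) auto
    then obtain B where B: "\<forall>y\<in>E ` {0..b}. norm y \<le> B" using compact_imp_bounded bounded_iff by blast
    have "B \<ge> 0" using B b by (force intro: order_trans[OF abs_ge_zero])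
    show ?thesis
    proof (rule integral_dominated_convergence[where w = "\<lambda>t. exp (c * b) * c * B"])
      show "integrable ?M (\<lambda>t. exp (c * b) * c * B)"
        by (intro integrable_continuous_Ioo continuous_intros)
      have "continuous_on {0..b} (\<lambda>t. exp (c * t) * (c * E t))"
        by (intro continuous_intros continuous_on_subset[OF E]) auto
      then show "(\<lambda>t. exp (c * t) * (c * E t)) \<in> borel_measurable ?M"
        by (intro borel_measurable_integrable integrable_continuous_Ioo)
      show "(\<lambda>t. real (Suc n) * (W t - W (t - h n)) * F (t - h n)) \<in> borel_measurable ?M" for n
        by (rule borel_measurable_integrable[OF iB])
      show "AE t in ?M. (\<lambda>n. real (Suc n) * (W t - W (t - h n)) * F (t - h n)) \<longlonglongrightarrow> exp (c * t) * (c * E t)"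
      proof (rule AE_I2)
        fix t assume "t \<in> space ?M"
        then have t: "t \<in> {0<..<b}" by simp
        have "(W has_derivative (\<lambda>x. (c * W t) \<bullet> x)) (at t)"
          unfolding W_def by (auto intro!: derivative_eq_intros simp: mult_ac)
        from difference_quotient_tendsto[OF this, of "-1"]
        have "(\<lambda>n. - (real (Suc n) * (W (t + (1 / real (Suc n)) *\<^sub>R (-1)) - W t))) \<longlonglongrightarrow> - ((c * W t) \<bullet> (-1))"
          by (rule tendsto_minus)
        then have 1: "(\<lambda>n. real (Suc n) * (W t - W (t - h n))) \<longlonglongrightarrow> c * W t"
          by (simp add: h_def right_diff_distrib del: of_nat_Suc)
        have "(\<lambda>n. t - h n) \<longlonglongrightarrow> t - 0" unfolding h_def by (intro tendsto_intros lim_1_over_n[THEN LIMSEQ_Suc])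
        then have "(\<lambda>n. F (t - h n)) \<longlonglongrightarrow> F t"
          using F by (auto simp: continuous_on_eq_continuous_at intro: isCont_tendsto_compose)
        from tendsto_mult[OF 1 this] show "(\<lambda>n. real (Suc n) * (W t - W (t - h n)) * F (t - h n)) \<longlonglongrightarrow> exp (c * t) * (c * E t)"
          using FE[OF t] by (simp add: W_def mult_ac del: of_nat_Suc)
      qed
      show "AE t in ?M. norm (real (Suc n) * (W t - W (t - h n)) * F (t - h n)) \<le> exp (c * b) * c * B" for n
      proof (rule AE_I2)
        fix t assume "t \<in> space ?M"
        then have t: "0 < t" "t < b" by auto
        have "W t - W (t - h n) = W t * (1 - exp (- (c * h n)))"
          by (simp add: W_def right_diff_distrib exp_add[symmetric])
        moreover have "0 \<le> 1 - exp (- (c * h n))" "1 - exp (- (c * h n)) \<le> c * h n"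
          using c h[of n] exp_ge_add_one_self[of "- (c * h n)"] by auto
        moreover have "0 < W t" "W t \<le> exp (c * b)" using t c by (auto simp: W_def mult_left_mono)
        ultimately have "0 \<le> W t - W (t - h n)" "W t - W (t - h n) \<le> exp (c * b) * (c * h n)"
          by (auto intro!: mult_mono mult_nonneg_nonneg)
        then have "real (Suc n) * (W t - W (t - h n)) \<le> real (Suc n) * (exp (c * b) * (c * h n))"
          by (intro mult_left_mono) auto
        also have "\<dots> = exp (c * b) * c * (real (Suc n) * h n)" by (simp only: mult_ac)
        finally have 1: "real (Suc n) * (W t - W (t - h n)) \<le> exp (c * b) * c" by (simp only: h(3) mult_1_right)
        have "max (t - h n) 0 \<in> {0..b}" using t b h(1)[of n] by auto
        then have "\<bar>F (t - h n)\<bar> \<le> B" using B by (simp add: F_def)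
        with 1 \<open>0 \<le> W t - W (t - h n)\<close> c
        show "norm (real (Suc n) * (W t - W (t - h n)) * F (t - h n)) \<le> exp (c * b) * c * B"
          by (simp add: abs_mult mult_mono del: of_nat_Suc)
      qed
    qed
  qed
  from tendsto_diff[OF limA limB] show "(\<lambda>n. LINT t|?M. exp (c * t) * (real (Suc n) * (E t - E (max (t - 1 / real (Suc n)) 0))))
     \<longlonglongrightarrow> exp (c * b) * E b - E 0 - (LINT t|?M. exp (c * t) * (c * E t))"
    unfolding eq using b by (simp add: Y_def W_def F_def)
qed

text \<open>Whichever factor is small relative to the other is replaced: either
  \<open>b \<le> \<eta> * a powr (1/3)\<close> bounds the product by the first term, or
  \<open>a \<le> (b / \<eta>) ^ 3\<close> bounds it by the second.\<close>

lemma Young_4_3: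
  fixes a b \<eta> :: real
  assumes "0 \<le> a" "0 \<le> b" "0 < \<eta>"
  shows "a * b \<le> \<eta> * a powr (4/3) + b ^ 4 / \<eta> ^ 3"
proof (cases "b \<le> \<eta> * a powr (1/3)")
  case True
  have "a * b \<le> a * (\<eta> * a powr (1/3))" using True assms by (intro mult_left_mono)
  also have "\<dots> = \<eta> * a powr (4/3)"
    using assms powr_mult_base[of a "1/3"] by simp
  also have "\<dots> \<le> \<eta> * a powr (4/3) + b ^ 4 / \<eta> ^ 3" using assms by simp
  finally show ?thesis .
next
  case False
  then have "a powr (1/3) \<le> b / \<eta>" using assms by (simp add: pos_le_divide_eq mult.commute)
  then have "(a powr (1/3)) ^ 3 \<le> (b / \<eta>) ^ 3" by (intro power_mono) auto
  moreover have "(a powr (1/3)) ^ 3 = a"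
    using assms by (cases "a = 0") (auto simp: powr_powr simp flip: powr_numeral)
  ultimately have "a * b \<le> (b / \<eta>) ^ 3 * b" using assms by (intro mult_right_mono) auto
  also have "\<dots> = b ^ 4 / \<eta> ^ 3" by (simp add: power_divide power_numeral_reduce)
  also have "\<dots> \<le> \<eta> * a powr (4/3) + b ^ 4 / \<eta> ^ 3" using assms by simp
  finally show ?thesis .
qed

lemma C_time_L2:
  assumes u: "u \<in> C_time (L2 \<Omega>) (l2norm \<Omega>)"
  shows "0 \<le> t \<Longrightarrow> u t \<in> L2 \<Omega>"
    and "v \<in> L2 \<Omega> \<Longrightarrow> continuous_on {0..} (\<lambda>t. l2inner \<Omega> (u t) v)"
    and "continuous_on {0..} (\<lambda>t. (l2norm \<Omega> (u t))\<^sup>2)"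
proof -
  show L2: "u t \<in> L2 \<Omega>" if "0 \<le> t" for t using u that by (simp add: C_time_def)
  \<comment> \<open>Membership in \<open>L2\<close> is known only at nonnegative times, whereas the
    convergence lemmas ask for it at every index; hence \<open>max s 0\<close>.\<close>
  have lim: "((\<lambda>s. l2norm \<Omega> (\<lambda>x. u (max s 0) x - u t x)) \<longlongrightarrow> 0) (at t within {0..})" if "t \<in> {0..}" for t
  proof (rule Lim_transform_eventually)
    show "((\<lambda>s. l2norm \<Omega> (u s - u t)) \<longlongrightarrow> 0) (at t within {0..})" using u that by (simp add: C_time_def)
    show "\<forall>\<^sub>F s in at t within {0..}. l2norm \<Omega> (u s - u t) = l2norm \<Omega> (\<lambda>x. u (max s 0) x - u t x)"
      by (auto simp: eventually_at_filter fun_diff_def max_def)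
  qed
  have max: "u (max s 0) \<in> L2 \<Omega>" for s by (intro L2) simp
  show "continuous_on {0..} (\<lambda>t. l2inner \<Omega> (u t) v)" if v: "v \<in> L2 \<Omega>"
  proof -
    have "continuous_on {0..} (\<lambda>t. l2inner \<Omega> (u (max t 0)) v)"
      unfolding continuous_on_def
    proof
      fix t :: real assume t: "t \<in> {0..}"
      then show "((\<lambda>t. l2inner \<Omega> (u (max t 0)) v) \<longlongrightarrow> l2inner \<Omega> (u (max t 0)) v) (at t within {0..})"
        using l2inner_tendsto[OF L2[of t] v max lim[OF t]] by simp
    qed
    then show ?thesis by (rule continuous_on_cong[THEN iffD1, rotated 2]) (auto simp: max_def)
  qed
  have "continuous_on {0..} (\<lambda>t. l2norm \<Omega> (u (max t 0)))"
    unfolding continuous_on_def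
  proof
    fix t :: real assume t: "t \<in> {0..}"
    then show "((\<lambda>t. l2norm \<Omega> (u (max t 0))) \<longlongrightarrow> l2norm \<Omega> (u (max t 0))) (at t within {0..})"
      using l2norm_tendsto[OF L2[of t] max lim[OF t]] by simp
  qed
  then have "continuous_on {0..} (\<lambda>t. l2norm \<Omega> (u t))"
    by (rule continuous_on_cong[THEN iffD1, rotated 2]) (auto simp: max_def)
  then show "continuous_on {0..} (\<lambda>t. (l2norm \<Omega> (u t))\<^sup>2)" by (intro continuous_intros)
qed

text \<open>Young's inequality with \<open>\<eta> = 1\<close> dominates the pairing by an integrable
  power of the dual norm plus a constant, which is integrable because \<open>J\<close> has finite
  measure.\<close>

lemma Hminus1_pairing_integrable:
  assumes \<Omega>: "open \<Omega>" and J: "J \<in> lmeasurable"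
    and w: "w \<in> bochner_Lp (4/3) J (Hminus1 \<Omega>) (hm1norm \<Omega>)" and v: "v \<in> H10 \<Omega>"
  shows "integrable (lebesgue_on J) (\<lambda>t. w t v)"
proof (rule Bochner_Integration.integrable_bound)
  have J': "J \<in> sets lebesgue" using J by (simp add: fmeasurableD)
  have sm: "strongly_measurable J (Hminus1 \<Omega>) (hm1norm \<Omega>) w" using w by (simp add: bochner_Lp_def)
  have "emeasure (lebesgue_on J) (space (lebesgue_on J)) \<noteq> \<infinity>"
    using J J' by (simp add: emeasure_restrict_space fmeasurable_def)
  then interpret finite_measure "lebesgue_on J" by (rule finite_measureI)
  show "integrable (lebesgue_on J) (\<lambda>t. hm1norm \<Omega> (w t) powr (4/3) + (h10norm \<Omega> v) ^ 4)"
    using w by (intro Bochner_Integration.integrable_add integrable_const) (simp add: bochner_Lp_def)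
  show "(\<lambda>t. w t v) \<in> borel_measurable (lebesgue_on J)" by (rule Hminus1_pairing_measurable[OF \<Omega> J' sm v])
  have "AE t in lebesgue_on J. w t \<in> Hminus1 \<Omega>" using sm by (simp add: strongly_measurable_def)
  then show "AE t in lebesgue_on J. norm (w t v) \<le> norm (hm1norm \<Omega> (w t) powr (4/3) + (h10norm \<Omega> v) ^ 4)"
  proof eventually_elim
    case (elim t)
    have "\<bar>w t v\<bar> \<le> hm1norm \<Omega> (w t) * h10norm \<Omega> v" by (rule Hminus1_bound[OF \<Omega> elim v])
    also have "\<dots> \<le> 1 * hm1norm \<Omega> (w t) powr (4/3) + (h10norm \<Omega> v) ^ 4 / 1 ^ 3"
      by (intro Young_4_3 hm1norm_nonneg[OF \<Omega> elim] h10norm_nonneg) simp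
    finally show ?case by simp
  qed
qed

text \<open>The identity \<open>|u(t)|\<^sup>2 - |u(s)|\<^sup>2 = 2 (u(t) - u(s), u(t)) - |u(t) - u(s)|\<^sup>2\<close> bounds the increments of
  \<open>|u|\<^sup>2\<close> from above by pairings of the time derivative with the fixed element \<open>u(t)\<close>. Averaging over
  \<open>t\<close> and letting the increment tend to zero needs only scalar Lebesgue differentiation once \<open>u\<close> is
  replaced by a simple function, at a cost controlled by Young's inequality.\<close>

lemma energy_inequality:
  fixes u :: "real \<Rightarrow> 'a::euclidean_space \<Rightarrow> real"
  assumes \<Omega>: "open \<Omega>" and b: "0 < b" and c: "0 \<le> c"
    and uC: "u \<in> C_time (L2 \<Omega>) (l2norm \<Omega>)"
    and uL: "u \<in> bochner_Lp 4 {0<..<b} (H10 \<Omega>) (h10norm \<Omega>)"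
    and wL: "w \<in> bochner_Lp (4/3) {0<..<b} (Hminus1 \<Omega>) (hm1norm \<Omega>)"
    and incr: "\<And>v s t. v \<in> H10 \<Omega> \<Longrightarrow> 0 \<le> s \<Longrightarrow> s \<le> t \<Longrightarrow> t \<le> b \<Longrightarrow>
      l2inner \<Omega> (u t) v - l2inner \<Omega> (u s) v = (LINT r|lebesgue. indicator {s<..<t} r * w r v)"
  shows "integrable (lebesgue_on {0<..<b}) (\<lambda>t. w t (u t))"
    and "exp (c * b) * (l2norm \<Omega> (u b))\<^sup>2 - (l2norm \<Omega> (u 0))\<^sup>2
      \<le> (LINT t|lebesgue_on {0<..<b}. exp (c * t) * (c * (l2norm \<Omega> (u t))\<^sup>2 + 2 * w t (u t)))"
proof -
  define J where "J = {0<..<b}"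
  have J: "J \<in> sets lebesgue" "J \<in> lmeasurable" by (auto simp: J_def)
  let ?M = "lebesgue_on J"
  have spM: "space ?M = J" by simp
  note u_L2 = C_time_L2(1)[OF uC]
  have uL': "u \<in> bochner_Lp 4 J (H10 \<Omega>) (h10norm \<Omega>)" and wL': "w \<in> bochner_Lp (4/3) J (Hminus1 \<Omega>) (hm1norm \<Omega>)"
    using uL wL by (simp_all add: J_def)
  have smu: "strongly_measurable J (H10 \<Omega>) (h10norm \<Omega>) u" using uL' by (simp add: bochner_Lp_def)
  have AEu: "AE t in ?M. u t \<in> H10 \<Omega>" using smu by (simp add: strongly_measurable_def)
  have AEw: "AE t in ?M. w t \<in> Hminus1 \<Omega>" using wL' by (simp add: bochner_Lp_def strongly_measurable_def)
  define N where "N t = h10norm \<Omega> (u t)" for t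
  have N4: "integrable ?M (\<lambda>t. N t ^ 4)"
    using uL' h10norm_nonneg[of \<Omega>] by (simp add: bochner_Lp_def powr_numeral N_def)
  define m where "m t = hm1norm \<Omega> (w t) powr (4/3)" for t
  have m_int: "integrable ?M m" using wL' by (simp add: bochner_Lp_def m_def[abs_def])
  have m_nonneg: "0 \<le> m t" for t by (simp add: m_def)
  have w_int: "integrable ?M (\<lambda>t. w t v)" if "v \<in> H10 \<Omega>" for v
    by (rule Hminus1_pairing_integrable[OF \<Omega> J(2) wL' that])
  have Young: "\<bar>F v\<bar> \<le> \<eta> * hm1norm \<Omega> F powr (4/3) + h10norm \<Omega> v ^ 4 / \<eta> ^ 3"
    if "F \<in> Hminus1 \<Omega>" "v \<in> H10 \<Omega>" "\<eta> > 0" for F v \<eta>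
    using Hminus1_bound[OF \<Omega> that(1,2)] Young_4_3[OF hm1norm_nonneg[OF \<Omega> that(1)] h10norm_nonneg that(3)]
    by (rule order_trans)
  define W where "W t = exp (c * t)" for t
  define Wb where "Wb = exp (c * b)"
  have W: "0 < W t" "W t \<le> Wb" if "t \<in> J" for t using that c by (auto simp: W_def Wb_def J_def mult_left_mono)
  have Wb: "0 < Wb" by (simp add: Wb_def)
  have W_meas: "W \<in> borel_measurable ?M"
    unfolding W_def[abs_def] J_def
    by (intro borel_measurable_integrable integrable_continuous_Ioo continuous_intros)
  have W_int: "integrable ?M (\<lambda>t. W t * f t)" if "integrable ?M f" for f
  proof (rule Bochner_Integration.integrable_bound)
    show "integrable ?M (\<lambda>t. Wb * f t)" using that by simp
    show "AE t in ?M. norm (W t * f t) \<le> norm (Wb * f t)"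
    proof (rule AE_I2)
      fix t assume "t \<in> space ?M"
      then show "norm (W t * f t) \<le> norm (Wb * f t)"
        using W[of t] Wb by (simp add: abs_mult mult_right_mono)
    qed
  qed (intro borel_measurable_times W_meas borel_measurable_integrable[OF that])
  define E where "E t = (l2norm \<Omega> (u t))\<^sup>2" for t
  have E_cont: "continuous_on {0..} E" unfolding E_def by (rule C_time_L2(3)[OF uC])
  define D where "D t = w t (u t)" for t
  \<comment> \<open>Measurability of the pairing is available only for a fixed test element; simple
    approximants of \<open>u\<close> reduce the diagonal pairing to that case.\<close>
  have D_meas: "D \<in> borel_measurable ?M"
  proof -
    obtain s where s: "\<And>n. simple_function ?M (s n)" "\<And>n t. t \<in> J \<Longrightarrow> s n t \<in> H10 \<Omega>"
      "AE t in ?M. (\<lambda>n. h10norm \<Omega> (\<lambda>x. u t x - s n t x)) \<longlonglongrightarrow> 0"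
      by (rule strongly_measurable_H10[OF \<Omega> J(1) smu]) blast
    show ?thesis
    proof (rule borel_measurable_AE_limit[OF J(1)])
      show "(\<lambda>t. w t (s n t)) \<in> borel_measurable ?M" for n
        using s(2) by (intro simple_function_select(2)[OF s(1), of n "\<lambda>v t. w t v"] borel_measurable_integrable[OF w_int]) auto
      show "AE t in ?M. (\<lambda>n. w t (s n t)) \<longlonglongrightarrow> D t"
        using s(3) AEu AEw AE_space[of ?M]
      proof eventually_elim
        case (elim t)
        then have t: "t \<in> J" by simp
        have "\<forall>n. norm (w t (s n t) - D t) \<le> hm1norm \<Omega> (w t) * h10norm \<Omega> (\<lambda>x. u t x - s n t x)"
        proof
          fix n
          show "norm (w t (s n t) - D t) \<le> hm1norm \<Omega> (w t) * h10norm \<Omega> (\<lambda>x. u t x - s n t x)"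
            using Hminus1_bound[OF \<Omega> elim(3) H10_diff[OF \<Omega> elim(2) s(2)[OF t, of n]]]
              Hminus1_diff_right[OF elim(3,2) s(2)[OF t, of n]] by (simp add: D_def abs_minus_commute)
        qed
        from Lim_null_comparison[OF always_eventually[OF this] tendsto_mult_right_zero[OF elim(1)]]
        show ?case by (rule LIM_zero_cancel)
      qed
    qed
  qed
  have D_int: "integrable ?M D"
  proof (rule Bochner_Integration.integrable_bound[OF _ D_meas])
    show "integrable ?M (\<lambda>t. m t + N t ^ 4)" by (intro Bochner_Integration.integrable_add m_int N4)
    show "AE t in ?M. norm (D t) \<le> norm (m t + N t ^ 4)"
      using AEu AEw by eventually_elim (use Young[of _ _ 1] in \<open>force simp: D_def m_def N_def\<close>)
  qed
  then show "integrable (lebesgue_on {0<..<b}) (\<lambda>t. w t (u t))" by (simp add: D_def[abs_def] J_def)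

  define k where "k v r = indicator J r * w r v" for v r
  have k_int: "integrable lebesgue (k v)" if "v \<in> H10 \<Omega>" for v
    using w_int[OF that] J by (simp add: integrable_lebesgue_on_iff k_def[abs_def])
  \<comment> \<open>Extended by zero to the whole line, the majorant is subject to the
    \<open>L1\<close> contraction of averages; \<open>K\<close> is its total mass.\<close>
  define mJ where "mJ r = indicator J r * m r" for r
  have mJ_int: "integrable lebesgue mJ" using m_int J by (simp add: integrable_lebesgue_on_iff mJ_def[abs_def])
  define K where "K = (LINT r|lebesgue. \<bar>mJ r\<bar>)"
  have K: "K \<ge> 0" "(LINT t|?M. m t) = K"
    unfolding K_def by (auto simp: mJ_def abs_mult m_nonneg integrable_lebesgue_on_iff J)
  let ?h = "\<lambda>n. 1 / real (Suc n)"
  let ?BA = "\<lambda>n. backward_average (?h n)"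
  \<comment> \<open>Since \<open>k v\<close> vanishes outside \<open>J\<close>, the averaging window
    is cut off at time zero, which produces the \<open>max\<close>.\<close>
  have BA_eq: "?BA n (k v) t = real (Suc n) * (l2inner \<Omega> (u t) v - l2inner \<Omega> (u (max (t - ?h n) 0)) v)"
    if t: "t \<in> J" and v: "v \<in> H10 \<Omega>" for n t v
  proof -
    have "indicator {t - ?h n<..<t} r * k v r = indicator {max (t - ?h n) 0<..<t} r * w r v" for r
      using t by (auto simp: k_def J_def split: split_indicator)
    moreover have "l2inner \<Omega> (u t) v - l2inner \<Omega> (u (max (t - ?h n) 0)) v
        = (LINT r|lebesgue. indicator {max (t - ?h n) 0<..<t} r * w r v)"
      using t by (intro incr[OF v]) (auto simp: J_def)
    ultimately show ?thesis by (simp add: backward_average_def mult.commute del: of_nat_Suc)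
  qed
  have BA_compare: "?BA n (k v) t \<le> ?BA n (k z) t + (\<eta> * ?BA n mJ t + h10norm \<Omega> (\<lambda>x. v x - z x) ^ 4 / \<eta> ^ 3)"
    if v: "v \<in> H10 \<Omega>" and z: "z \<in> H10 \<Omega>" and \<eta>: "\<eta> > 0" for n t v z \<eta>
  proof -
    define C where "C = h10norm \<Omega> (\<lambda>x. v x - z x) ^ 4 / \<eta> ^ 3"
    have C: "C \<ge> 0" using \<eta> by (simp add: C_def h10norm_nonneg)
    let ?I = "\<lambda>r. indicator {t - ?h n<..<t} r :: real"
    have i: "integrable lebesgue (\<lambda>r. ?I r * g r)" if "integrable lebesgue g" for g
      by (intro integrable_indicator_times that) auto
    have iC: "integrable lebesgue (\<lambda>r. ?I r * C)" by (rule integrable_indicator_interval)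
    have im: "integrable lebesgue (\<lambda>r. \<eta> * (?I r * mJ r))" by (intro integrable_mult_right i mJ_int)
    have "(LINT r|lebesgue. ?I r * k v r) \<le> (LINT r|lebesgue. ?I r * k z r + (\<eta> * (?I r * mJ r) + ?I r * C))"
    proof (rule integral_mono_AE)
      have "AE r in lebesgue. r \<in> J \<longrightarrow> w r \<in> Hminus1 \<Omega>" using AEw J by (simp add: AE_restrict_space_iff)
      then show "AE r in lebesgue. ?I r * k v r \<le> ?I r * k z r + (\<eta> * (?I r * mJ r) + ?I r * C)"
      proof eventually_elim
        case (elim r)
        show ?case
        proof (cases "r \<in> J")
          case True
          then have "w r v - w r z \<le> \<eta> * m r + C"
            using Young[OF _ H10_diff[OF \<Omega> v z] \<eta>, of "w r"] elim Hminus1_diff_right[of "w r" \<Omega> v z] v z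
            by (simp add: m_def C_def)
          then show ?thesis using True by (auto simp: k_def mJ_def split: split_indicator)
        next
          case False
          then show ?thesis using C by (auto simp: k_def mJ_def split: split_indicator)
        qed
      qed
    qed (intro Bochner_Integration.integrable_add i im iC k_int v z)+
    also have "\<dots> = (LINT r|lebesgue. ?I r * k z r) + (\<eta> * (LINT r|lebesgue. ?I r * mJ r) + ?h n * C)"
      using i[OF k_int[OF z]] im iC i[OF mJ_int] by simp
    finally have "(LINT r|lebesgue. ?I r * k v r) * real (Suc n) \<le>
        ((LINT r|lebesgue. ?I r * k z r) + (\<eta> * (LINT r|lebesgue. ?I r * mJ r) + ?h n * C)) * real (Suc n)"
      by (rule mult_right_mono) simp
    also have "\<dots> = (LINT r|lebesgue. ?I r * k z r) * real (Suc n)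
        + (\<eta> * ((LINT r|lebesgue. ?I r * mJ r) * real (Suc n)) + C)"
      by (simp add: distrib_right del: of_nat_Suc)
    finally show ?thesis by (simp add: backward_average_def C_def del: of_nat_Suc)
  qed
  have BA_int: "integrable ?M (?BA n g)" if "integrable lebesgue g" for n g
    by (intro integrable_lebesgue_on_subset(1) backward_average_L1(1) J that) simp
  define \<Lambda> where "\<Lambda> = exp (c * b) * E b - E 0 - (LINT t|?M. exp (c * t) * (c * E t))"
  let ?Q = "\<lambda>n t. real (Suc n) * (E t - E (max (t - ?h n) 0))"
  have Q_lim: "(\<lambda>n. LINT t|?M. W t * ?Q n t) \<longlonglongrightarrow> \<Lambda>"
    using weighted_difference_quotient_tendsto(1)[OF E_cont b c] by (simp add: \<Lambda>_def W_def J_def del: of_nat_Suc)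
  have Q_int: "integrable ?M (\<lambda>t. W t * ?Q n t)" for n
    using weighted_difference_quotient_tendsto(2)[OF E_cont b c] by (simp add: W_def J_def del: of_nat_Suc)
  have Q_le: "AE t in ?M. ?Q n t \<le> 2 * ?BA n (k (u t)) t" for n
    using AEu AE_space[of ?M]
  proof eventually_elim
    case (elim t)
    then have t: "t \<in> J" by simp
    let ?s = "max (t - ?h n) 0"
    have L: "u t \<in> L2 \<Omega>" "u ?s \<in> L2 \<Omega>" using t by (auto intro!: u_L2 simp: J_def)
    have "0 \<le> (l2norm \<Omega> (\<lambda>x. 1 *\<^sub>R u t x + (-1) *\<^sub>R u ?s x))\<^sup>2" by simp
    also have "\<dots> = E t - 2 * l2inner \<Omega> (u ?s) (u t) + E ?s"
      unfolding l2norm_lincomb_sq[OF L] by (simp add: E_def l2inner_commute)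
    finally have "E t - E ?s \<le> 2 * (l2inner \<Omega> (u t) (u t) - l2inner \<Omega> (u ?s) (u t))"
      by (simp add: E_def l2norm_sq)
    then have "?Q n t \<le> real (Suc n) * (2 * (l2inner \<Omega> (u t) (u t) - l2inner \<Omega> (u ?s) (u t)))"
      by (rule mult_left_mono) simp
    then show ?case unfolding BA_eq[OF t elim(1)] by (simp only: mult_ac)
  qed
  have main: "\<Lambda> \<le> 2 * (LINT t|?M. W t * D t) + e" if e: "e > 0" for e
  proof -
    \<comment> \<open>Chosen so that the dual-norm part of the error is at most
      \<open>e / 2\<close>; \<open>K + 1\<close> covers a vanishing \<open>K\<close>.\<close>
    define \<eta> where "\<eta> = e / (8 * Wb * (K + 1))"
    have \<eta>: "\<eta> > 0" using e Wb K by (simp add: \<eta>_def)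
    have "4 * Wb * (\<eta> * K) \<le> 4 * Wb * (\<eta> * (K + 1))" using Wb \<eta> by (intro mult_left_mono) auto
    also have "\<dots> = (8 * Wb * (K + 1) * \<eta>) / 2" by (simp add: mult_ac)
    also have "8 * Wb * (K + 1) * \<eta> = e" using Wb K by (simp add: \<eta>_def)
    finally have \<eta>K: "4 * Wb * (\<eta> * K) \<le> e / 2" .
    \<comment> \<open>Tolerance for the simple approximation: after division by
      \<open>\<eta> ^ 3\<close> and multiplication by \<open>4 * Wb\<close> it becomes
      \<open>e / 2\<close>.\<close>
    have "\<eta> ^ 3 * e / (8 * Wb) > 0" using \<eta> e Wb by simp
    from H10_simple_approx_L4[OF \<Omega> J(1) uL' this] obtain z where z: "simple_function ?M z" "\<And>t. t \<in> J \<Longrightarrow> z t \<in> H10 \<Omega>"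
      "integrable ?M (\<lambda>t. h10norm \<Omega> (\<lambda>x. u t x - z t x) ^ 4)"
      "(LINT t|?M. h10norm \<Omega> (\<lambda>x. u t x - z t x) ^ 4) < \<eta> ^ 3 * e / (8 * Wb)" by blast
    define d where "d t = h10norm \<Omega> (\<lambda>x. u t x - z t x) ^ 4 / \<eta> ^ 3" for t
    have d_int: "integrable ?M d" unfolding d_def using z(3) by simp
    have d_nonneg: "d t \<ge> 0" for t using \<eta> by (simp add: d_def h10norm_nonneg)
    have d_small: "4 * Wb * (LINT t|?M. d t) \<le> e / 2"
      unfolding d_def using z(4) \<eta> Wb by (simp add: field_simps)
    have zr: "v \<in> H10 \<Omega>" if "v \<in> z ` space ?M" for v using that z(2) by auto
    have fin: "finite (z ` space ?M)" using simple_functionD(1)[OF z(1)] .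
    have BAz_int: "integrable ?M (\<lambda>t. ?BA n (k (z t)) t)" for n
      by (intro simple_function_select(3)[OF z(1), of "\<lambda>v. ?BA n (k v)"] BA_int k_int zr)
    have wz_int: "integrable ?M (\<lambda>t. w t (z t))"
      by (intro simple_function_select(3)[OF z(1), of "\<lambda>v t. w t v"] w_int zr)
    have bound_W: "(LINT t|?M. W t * f t) \<le> Wb * (LINT t|?M. \<bar>f t\<bar>)" if "integrable ?M f" for f
    proof -
      have "(LINT t|?M. W t * f t) \<le> (LINT t|?M. Wb * \<bar>f t\<bar>)"
      proof (rule integral_mono)
        fix t assume "t \<in> space ?M"
        then have "W t * f t \<le> W t * \<bar>f t\<bar>" "W t * \<bar>f t\<bar> \<le> Wb * \<bar>f t\<bar>"
          using W[of t] by (auto intro!: mult_left_mono mult_right_mono)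
        then show "W t * f t \<le> Wb * \<bar>f t\<bar>" by linarith
      qed (intro W_int that integrable_mult_right integrable_abs)+
      then show ?thesis by simp
    qed
    \<comment> \<open>Under the average \<open>u t\<close> is exchanged for \<open>z t\<close>. The
      resulting error is the same for all \<open>n\<close>, because averaging does not increase the
      \<open>L1\<close> norm of \<open>mJ\<close>.\<close>
    have step: "(LINT t|?M. W t * ?Q n t) \<le> 2 * (LINT t|?M. W t * ?BA n (k (z t)) t) + 2 * Wb * (\<eta> * K + (LINT t|?M. d t))" for n
    proof -
      have r_int: "integrable ?M (\<lambda>t. \<eta> * ?BA n mJ t + d t)"
        by (intro Bochner_Integration.integrable_add integrable_mult_right BA_int mJ_int d_int)
      have "(LINT t|?M. W t * ?Q n t) \<le> (LINT t|?M. 2 * (W t * ?BA n (k (z t)) t) + 2 * (W t * (\<eta> * ?BA n mJ t + d t)))"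
      proof (rule integral_mono_AE[OF Q_int])
        show "integrable ?M (\<lambda>t. 2 * (W t * ?BA n (k (z t)) t) + 2 * (W t * (\<eta> * ?BA n mJ t + d t)))"
          by (intro Bochner_Integration.integrable_add integrable_mult_right W_int BAz_int r_int)
        show "AE t in ?M. W t * ?Q n t \<le> 2 * (W t * ?BA n (k (z t)) t) + 2 * (W t * (\<eta> * ?BA n mJ t + d t))"
          using Q_le[of n] AEu AE_space[of ?M]
        proof eventually_elim
          case (elim t)
          then have t: "t \<in> J" by simp
          have "?Q n t \<le> 2 * (?BA n (k (z t)) t + (\<eta> * ?BA n mJ t + d t))"
            using elim(1) BA_compare[OF elim(2) z(2)[OF t] \<eta>, of n t] by (simp add: d_def del: of_nat_Suc)
          then have "W t * ?Q n t \<le> W t * (2 * (?BA n (k (z t)) t + (\<eta> * ?BA n mJ t + d t)))"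
            using W(1)[OF t] by (intro mult_left_mono) auto
          then show ?case by (simp only: distrib_left mult.left_commute[of "W t" 2])
        qed
      qed
      also have "\<dots> = 2 * (LINT t|?M. W t * ?BA n (k (z t)) t) + 2 * (LINT t|?M. W t * (\<eta> * ?BA n mJ t + d t))"
        using W_int[OF BAz_int[of n]] W_int[OF r_int] by simp
      also have "(LINT t|?M. W t * (\<eta> * ?BA n mJ t + d t)) \<le> Wb * (LINT t|?M. \<bar>\<eta> * ?BA n mJ t + d t\<bar>)"
        by (rule bound_W[OF r_int])
      also have "(LINT t|?M. \<bar>\<eta> * ?BA n mJ t + d t\<bar>) \<le> (LINT t|?M. \<eta> * \<bar>?BA n mJ t\<bar> + d t)"
      proof (rule integral_mono)
        fix t show "\<bar>\<eta> * ?BA n mJ t + d t\<bar> \<le> \<eta> * \<bar>?BA n mJ t\<bar> + d t"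
          using \<eta> d_nonneg[of t] abs_triangle_ineq[of "\<eta> * ?BA n mJ t" "d t"] by (simp add: abs_mult)
      qed (intro integrable_abs r_int Bochner_Integration.integrable_add integrable_mult_right BA_int mJ_int d_int)+
      also have "\<dots> = \<eta> * (LINT t|?M. \<bar>?BA n mJ t\<bar>) + (LINT t|?M. d t)"
        using BA_int[OF mJ_int, of n] d_int by simp
      also have "(LINT t|?M. \<bar>?BA n mJ t\<bar>) \<le> (LINT t|lebesgue. \<bar>?BA n mJ t\<bar>)"
        by (intro integrable_lebesgue_on_subset(2) J backward_average_L1(1) mJ_int) simp
      also have "\<dots> \<le> K" unfolding K_def by (intro backward_average_L1(2) mJ_int) simp
      finally show ?thesis using \<eta> Wb by (simp add: mult_left_mono mult.assoc)
    qed
    \<comment> \<open>As \<open>z\<close> has finitely many values, the error is bounded by a finite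
      sum of scalar \<open>L1\<close> errors of averages with fixed elements.\<close>
    have lim: "(\<lambda>n. LINT t|?M. W t * ?BA n (k (z t)) t) \<longlonglongrightarrow> (LINT t|?M. W t * w t (z t))"
    proof -
      let ?S = "\<lambda>n v. LINT t|lebesgue. indicator {0<..<b} t * \<bar>?BA n (k v) t - k v t\<bar>"
      have bound: "\<forall>n. norm ((LINT t|?M. W t * ?BA n (k (z t)) t) - (LINT t|?M. W t * w t (z t))) \<le> Wb * (\<Sum>v\<in>z ` space ?M. ?S n v)"
      proof
        fix n
        let ?f = "\<lambda>t. ?BA n (k (z t)) t - w t (z t)"
        have f_int: "integrable ?M ?f" by (intro Bochner_Integration.integrable_diff BAz_int wz_int)
        have iv: "integrable ?M (\<lambda>t. \<bar>?BA n (k v) t - k v t\<bar>)" if "v \<in> z ` space ?M" for v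
          by (intro integrable_abs Bochner_Integration.integrable_diff BA_int integrable_lebesgue_on_subset(1) J k_int zr that)
        have "(LINT t|?M. W t * ?BA n (k (z t)) t) - (LINT t|?M. W t * w t (z t)) = (LINT t|?M. W t * ?f t)"
          using W_int[OF BAz_int[of n]] W_int[OF wz_int] by (simp add: right_diff_distrib)
        moreover have "- (LINT t|?M. W t * ?f t) \<le> Wb * (LINT t|?M. \<bar>?f t\<bar>)"
          using bound_W[OF Bochner_Integration.integrable_minus[OF f_int]]
          by (simp only: mult_minus_right Bochner_Integration.integral_minus abs_minus_cancel)
        ultimately have "norm ((LINT t|?M. W t * ?BA n (k (z t)) t) - (LINT t|?M. W t * w t (z t))) \<le> Wb * (LINT t|?M. \<bar>?f t\<bar>)"
          using bound_W[OF f_int] by (simp only: real_norm_def abs_le_iff)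
        also have "(LINT t|?M. \<bar>?f t\<bar>) \<le> (LINT t|?M. (\<Sum>v\<in>z ` space ?M. \<bar>?BA n (k v) t - k v t\<bar>))"
        proof (rule integral_mono)
          fix t assume t: "t \<in> space ?M"
          then have "\<bar>?f t\<bar> = \<bar>?BA n (k (z t)) t - k (z t) t\<bar>" by (simp add: k_def)
          also have "\<dots> \<le> (\<Sum>v\<in>z ` space ?M. \<bar>?BA n (k v) t - k v t\<bar>)"
            using t fin by (intro member_le_sum[of "z t" _ "\<lambda>v. \<bar>?BA n (k v) t - k v t\<bar>"]) auto
          finally show "\<bar>?f t\<bar> \<le> (\<Sum>v\<in>z ` space ?M. \<bar>?BA n (k v) t - k v t\<bar>)" .
        qed (intro integrable_abs f_int Bochner_Integration.integrable_sum iv; assumption)+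
        also have "\<dots> = (\<Sum>v\<in>z ` space ?M. (LINT t|?M. \<bar>?BA n (k v) t - k v t\<bar>))"
          by (rule Bochner_Integration.integral_sum[OF iv])
        also have "\<dots> = (\<Sum>v\<in>z ` space ?M. ?S n v)"
          unfolding integrable_lebesgue_on_iff(2)[OF J(1)] by (simp only: J_def)
        finally show "norm ((LINT t|?M. W t * ?BA n (k (z t)) t) - (LINT t|?M. W t * w t (z t))) \<le> Wb * (\<Sum>v\<in>z ` space ?M. ?S n v)"
          using Wb by simp
      qed
      have "(\<lambda>n. Wb * (\<Sum>v\<in>z ` space ?M. ?S n v)) \<longlonglongrightarrow> Wb * (\<Sum>v\<in>z ` space ?M. 0)"
        by (intro tendsto_mult tendsto_const tendsto_sum backward_average_tendsto_L1 k_int zr)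
      then have "(\<lambda>n. Wb * (\<Sum>v\<in>z ` space ?M. ?S n v)) \<longlonglongrightarrow> 0" by simp
      from Lim_null_comparison[OF always_eventually[OF bound] this]
      show ?thesis by (rule LIM_zero_cancel)
    qed
    have "\<Lambda> \<le> 2 * (LINT t|?M. W t * w t (z t)) + 2 * Wb * (\<eta> * K + (LINT t|?M. d t))"
      using step by (intro LIMSEQ_le[OF Q_lim tendsto_add[OF tendsto_mult[OF tendsto_const lim] tendsto_const]]) blast
    \<comment> \<open>In the limit \<open>z t\<close> is exchanged back for \<open>u t\<close> by
      the same Young estimate, now without averaging.\<close>
    also have "(LINT t|?M. W t * w t (z t)) \<le> (LINT t|?M. W t * D t + W t * (\<eta> * m t + d t))"
    proof (rule integral_mono_AE)
      show "AE t in ?M. W t * w t (z t) \<le> W t * D t + W t * (\<eta> * m t + d t)"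
        using AEu AEw AE_space[of ?M]
      proof eventually_elim
        case (elim t)
        then have t: "t \<in> J" by simp
        have "w t (z t) \<le> D t + (\<eta> * m t + d t)"
          using Young[OF elim(2) H10_diff[OF \<Omega> elim(1) z(2)[OF t]] \<eta>] Hminus1_diff_right[OF elim(2,1) z(2)[OF t]]
          by (simp add: D_def m_def d_def)
        then have "W t * w t (z t) \<le> W t * (D t + (\<eta> * m t + d t))" using W(1)[OF t] by (intro mult_left_mono) auto
        then show ?case by (simp only: distrib_left)
      qed
    qed (intro Bochner_Integration.integrable_add W_int wz_int D_int integrable_mult_right m_int d_int)+
    also have "\<dots> = (LINT t|?M. W t * D t) + (LINT t|?M. W t * (\<eta> * m t + d t))"
      by (intro Bochner_Integration.integral_add Bochner_Integration.integrable_add W_int D_int integrable_mult_right m_int d_int)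
    also have "(LINT t|?M. W t * (\<eta> * m t + d t)) \<le> Wb * (LINT t|?M. \<bar>\<eta> * m t + d t\<bar>)"
      by (intro bound_W Bochner_Integration.integrable_add integrable_mult_right m_int d_int)
    also have "(LINT t|?M. \<bar>\<eta> * m t + d t\<bar>) = \<eta> * K + (LINT t|?M. d t)"
      using \<eta> d_nonneg m_nonneg m_int d_int by (simp add: K(2))
    \<comment> \<open>Each of the two exchanges costs \<open>2 * Wb\<close> times the error, hence
      the factor \<open>4\<close>.\<close>
    finally have "\<Lambda> \<le> 2 * (LINT t|?M. W t * D t) + 4 * Wb * (\<eta> * K) + 4 * Wb * (LINT t|?M. d t)"
      by (simp add: algebra_simps)
    then show ?thesis using \<eta>K d_small by linarith
  qed
  have "\<Lambda> \<le> 2 * (LINT t|?M. W t * D t)" by (rule field_le_epsilon[OF main])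
  moreover have iE: "integrable ?M (\<lambda>t. exp (c * t) * (c * E t))"
    unfolding J_def by (intro integrable_continuous_Ioo continuous_intros continuous_on_subset[OF E_cont]) auto
  moreover have "(LINT t|?M. exp (c * t) * (c * E t + 2 * D t))
      = (LINT t|?M. exp (c * t) * (c * E t)) + 2 * (LINT t|?M. W t * D t)"
  proof -
    have "(\<lambda>t. exp (c * t) * (c * E t + 2 * D t)) = (\<lambda>t. exp (c * t) * (c * E t) + 2 * (W t * D t))"
      by (simp add: W_def algebra_simps)
    then show ?thesis using iE W_int[OF D_int] by simp
  qed
  ultimately have "exp (c * b) * E b - E 0 \<le> (LINT t|?M. exp (c * t) * (c * E t + 2 * D t))"
    unfolding \<Lambda>_def by linarith
  then show "exp (c * b) * (l2norm \<Omega> (u b))\<^sup>2 - (l2norm \<Omega> (u 0))\<^sup>2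
      \<le> (LINT t|lebesgue_on {0<..<b}. exp (c * t) * (c * (l2norm \<Omega> (u t))\<^sup>2 + 2 * w t (u t)))"
    by (simp add: E_def D_def J_def)
qed

section \<open>From the energy inequality to the weighted estimate\<close>

lemma set_integral_Icc_eq_Ioo:
  fixes f :: "real \<Rightarrow> real"
  assumes "integrable (lebesgue_on {a<..<b}) f"
  shows "(LINT s:{a..b}|lebesgue. f s) = (LINT s|lebesgue_on {a<..<b}. f s)"
proof -
  have int: "integrable lebesgue (\<lambda>s. indicator {a<..<b} s * f s)"
    using assms by (simp add: integrable_lebesgue_on_iff)
  have "AE s in lebesgue. s \<notin> {a, b}"
    by (intro AE_not_in) (simp add: negligible_iff_null_sets[symmetric])
  then have ae: "AE s in lebesgue. indicator {a<..<b} s * f s = indicator {a..b} s * f s"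
    by eventually_elim (auto split: split_indicator)
  have "(LINT s|lebesgue. indicator {a..b} s * f s) = (LINT s|lebesgue. indicator {a<..<b} s * f s)"
    using borel_measurable_integrable[OF int] borel_measurable_AE[OF borel_measurable_integrable[OF int] ae] ae
    by (intro integral_cong_AE) (auto elim: eventually_mono)
  then show ?thesis by (simp add: set_lebesgue_integral_def integrable_lebesgue_on_iff(2))
qed

text \<open>The essential supremum is finite above by assumption and cannot be minus infinity
  because it dominates a real number, so its conversion to a real loses nothing.\<close>

lemma linf_norm_AE_bound:
  assumes "esssup (lebesgue_on J) (\<lambda>t. ereal (N (f t))) < \<infinity>"
  shows "AE t in lebesgue_on J. N (f t) \<le> linf_norm J N f"
  using esssup_AE[of "\<lambda>t. ereal (N (f t))" "lebesgue_on J"]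
proof eventually_elim
  case (elim t)
  then obtain r where "esssup (lebesgue_on J) (\<lambda>t. ereal (N (f t))) = ereal r"
    using assms by (cases "esssup (lebesgue_on J) (\<lambda>t. ereal (N (f t)))") auto
  then show ?case using elim by (simp add: linf_norm_def)
qed

theorem lemma2p1:
  fixes \<Omega> :: "'a::euclidean_space set"
    and f :: "real \<Rightarrow> ('a \<Rightarrow> real) \<Rightarrow> real"
    and u0 :: "'a \<Rightarrow> real"
    and u :: "real \<Rightarrow> 'a \<Rightarrow> real"
    and \<alpha> \<beta> t :: real
  assumes "DIM('a) = 2 \<or> DIM('a) = 3"
    and "convex_polyhedral_domain \<Omega>"
    and "f \<in> bochner_Linf {0<..} (Hminus1 \<Omega>) (hm1norm \<Omega>)"
    and "u0 \<in> L2 \<Omega>"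
    and "weak_solution \<Omega> f u0 u"
    and "0 < \<alpha>" and "\<alpha> < lambda1 \<Omega> / 2"
    and "\<beta> = 1 - 2 * \<alpha> / lambda1 \<Omega>"
    and "t > 0"
  shows "\<beta> > 0 \<and>
    (l2norm \<Omega> (u t))\<^sup>2
      + \<beta> * exp (- 2 * \<alpha> * t) *
          (LINT s:{0..t}|lebesgue. exp (2 * \<alpha> * s) * (l2norm \<Omega> (grad \<Omega> (u s)))\<^sup>2)
      + 2 * exp (- 2 * \<alpha> * t) *
          (LINT s:{0..t}|lebesgue. exp (2 * \<alpha> * s) * (l2norm \<Omega> (grad \<Omega> (u s))) ^ 4)
      \<le> exp (- 2 * \<alpha> * t) * (l2norm \<Omega> u0)\<^sup>2
        + 1 / (2 * \<alpha>) * (linf_norm {0<..} (hm1norm \<Omega>) f)\<^sup>2 * (1 - exp (- 2 * \<alpha> * t)) \<and>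
    exp (- 2 * \<alpha> * t) * (l2norm \<Omega> u0)\<^sup>2
        + 1 / (2 * \<alpha>) * (linf_norm {0<..} (hm1norm \<Omega>) f)\<^sup>2 * (1 - exp (- 2 * \<alpha> * t))
      \<le> (l2norm \<Omega> u0)\<^sup>2 + 1 / (2 * \<alpha>) * (linf_norm {0<..} (hm1norm \<Omega>) f)\<^sup>2"
proof -
  have \<Omega>: "open \<Omega>" "bounded \<Omega>" using assms(2) by (auto simp: convex_polyhedral_domain_def)
  have uC: "u \<in> C_time (L2 \<Omega>) (l2norm \<Omega>)" and uL: "u \<in> bochner_Lp 4 {0<..<t} (H10 \<Omega>) (h10norm \<Omega>)"
    and u_init: "AE x in lebesgue_on \<Omega>. u 0 x = u0 x"
    using assms(5,9) by (auto simp: weak_solution_def bochner_Lp_loc_def)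
  obtain ut where utL: "ut \<in> bochner_Lp (4/3) {0<..<t} (Hminus1 \<Omega>) (hm1norm \<Omega>)"
    and weak: "weak_time_derivative \<Omega> u ut"
    and pde: "AE s in lebesgue_on {0<..}. \<forall>v\<in>H10 \<Omega>. ut s v + (1 + (l2norm \<Omega> (grad \<Omega> (u s)))\<^sup>2) *
        l2inner \<Omega> (grad \<Omega> (u s)) (grad \<Omega> v) = f s v"
    using assms(5,9) unfolding weak_solution_def bochner_Lp_loc_def by blast
  let ?J = "{0<..<t}"
  let ?M = "lebesgue_on ?J"
  define c where "c = 2 * \<alpha>"
  have c: "c > 0" using assms(6) by (simp add: c_def)
  have lam: "lambda1 \<Omega> > 0" using assms(6,7) by simp
  have \<beta>: "\<beta> > 0" using assms(7,8) lam by simp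
  define F where "F = linf_norm {0<..} (hm1norm \<Omega>) f"
  have incr: "l2inner \<Omega> (u b) v - l2inner \<Omega> (u a) v = (LINT r|lebesgue. indicator {a<..<b} r * ut r v)"
    if v: "v \<in> H10 \<Omega>" and ab: "0 \<le> a" "a \<le> b" "b \<le> t" for v a b
  proof (rule weak_derivative_increment[OF C_time_L2(2)[OF uC H10_L2[OF v]] _ _ ab])
    show "integrable lebesgue (\<lambda>r. indicator {0<..<t} r * ut r v)"
      using Hminus1_pairing_integrable[OF \<Omega>(1) _ utL v] by (simp add: integrable_lebesgue_on_iff)
    show "(LINT s|lebesgue_on {0<..}. deriv \<eta> s * l2inner \<Omega> (u s) v) = - (LINT s|lebesgue_on {0<..}. \<eta> s * ut s v)"
      if "\<eta> \<in> test_functions {0<..}" for \<eta>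
      using weak that v by (simp add: weak_time_derivative_def)
  qed
  define N where "N s = l2norm \<Omega> (grad \<Omega> (u s))" for s
  have N_h10: "N s = h10norm \<Omega> (u s)" for s by (simp add: N_def h10norm_def)
  have energy: "integrable ?M (\<lambda>s. ut s (u s))"
    "exp (c * t) * (l2norm \<Omega> (u t))\<^sup>2 - (l2norm \<Omega> (u 0))\<^sup>2
      \<le> (LINT s|?M. exp (c * s) * (c * (l2norm \<Omega> (u s))\<^sup>2 + 2 * ut s (u s)))"
    using energy_inequality[OF \<Omega>(1) assms(9) less_imp_le[OF c] uC uL utL incr] by auto
  have exp_cont: "continuous_on S (\<lambda>s. exp (c * s))" for S by (intro continuous_intros)
  have weight: "integrable ?M (\<lambda>s. exp (c * s) * g s)" if "integrable ?M g" for g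
  proof (rule Bochner_Integration.integrable_bound)
    show "integrable ?M (\<lambda>s. exp (c * t) * g s)" using that by simp
    show "AE s in ?M. norm (exp (c * s) * g s) \<le> norm (exp (c * t) * g s)"
    proof (rule AE_I2)
      fix s assume "s \<in> space ?M"
      then have "exp (c * s) \<le> exp (c * t)" using c by simp
      then show "norm (exp (c * s) * g s) \<le> norm (exp (c * t) * g s)" by (simp add: abs_mult mult_right_mono)
    qed
  qed (intro borel_measurable_times borel_measurable_integrable[OF integrable_continuous_Ioo(1)[OF exp_cont]]
      borel_measurable_integrable[OF that])
  have N4: "integrable ?M (\<lambda>s. N s ^ 4)"
    using uL h10norm_nonneg[of \<Omega>] by (simp add: bochner_Lp_def powr_numeral N_h10)
  have one: "integrable ?M (\<lambda>s. C)" for C :: real by (intro integrable_continuous_Ioo continuous_intros)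
  have sm: "strongly_measurable ?J (H10 \<Omega>) (h10norm \<Omega>) u" using uL by (simp add: bochner_Lp_def)
  have N2: "integrable ?M (\<lambda>s. (N s)\<^sup>2)"
  proof (rule Bochner_Integration.integrable_bound[OF Bochner_Integration.integrable_add[OF one[of 1] N4]])
    show "(\<lambda>s. (N s)\<^sup>2) \<in> borel_measurable ?M"
      using h10norm_diff_measurable[OF \<Omega>(1) _ sm H10_zero[OF \<Omega>(1)]] by (simp add: N_h10)
    have "(N s)\<^sup>2 \<le> 1 + N s ^ 4" for s
    proof -
      have "2 * (N s)\<^sup>2 \<le> 1 + N s ^ 4"
        using sum_squares_bound[of 1 "(N s)\<^sup>2"] by (simp flip: power_mult)
      then show ?thesis using zero_le_power2[of "N s"] by linarith
    qed
    then show "AE s in ?M. norm ((N s)\<^sup>2) \<le> norm (1 + N s ^ 4)" by simp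
  qed
  have E_int: "integrable ?M (\<lambda>s. (l2norm \<Omega> (u s))\<^sup>2)"
    by (intro integrable_continuous_Ioo continuous_on_subset[OF C_time_L2(3)[OF uC]]) auto
  have restrict: "AE s in ?M. P s" if "AE s in lebesgue_on {0<..}. P s" for P
  proof -
    have "AE s in lebesgue. s \<in> {0<..} \<longrightarrow> P s" using that by (simp add: AE_restrict_space_iff)
    then have "AE s in lebesgue. s \<in> ?J \<longrightarrow> P s" by eventually_elim auto
    then show ?thesis by (simp add: AE_restrict_space_iff)
  qed
  have f_bound: "AE s in ?M. f s \<in> Hminus1 \<Omega> \<and> hm1norm \<Omega> (f s) \<le> F"
    using assms(3) unfolding F_def bochner_Linf_def strongly_measurable_def
    by (intro restrict AE_conjI linf_norm_AE_bound) auto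
  have pointwise: "AE s in ?M. exp (c * s) * (c * (l2norm \<Omega> (u s))\<^sup>2 + 2 * ut s (u s))
      \<le> F\<^sup>2 * exp (c * s) - \<beta> * (exp (c * s) * (N s)\<^sup>2) - 2 * (exp (c * s) * N s ^ 4)"
  proof -
    have "AE s in ?M. u s \<in> H10 \<Omega>" using sm by (simp add: strongly_measurable_def)
    with f_bound restrict[OF pde] show ?thesis
    proof eventually_elim
      case (elim s)
      \<comment> \<open>The exceptional null set of the equation does not depend on the test
        function, so \<open>v = u s\<close> is admissible for almost every \<open>s\<close>.\<close>
      have "ut s (u s) + (1 + (N s)\<^sup>2) * (N s)\<^sup>2 = f s (u s)"
        using elim(2,3) by (simp add: N_def l2norm_sq)
      moreover have "f s (u s) \<le> F * N s"
      proof -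
        have "f s (u s) \<le> hm1norm \<Omega> (f s) * N s"
          using Hminus1_bound[OF \<Omega>(1) _ elim(3), of "f s"] elim(1) by (simp add: N_h10)
        also have "\<dots> \<le> F * N s" using elim(1) by (intro mult_right_mono) (auto simp: N_def l2norm_nonneg)
        finally show ?thesis .
      qed
      moreover have "2 * (F * N s) \<le> F\<^sup>2 + (N s)\<^sup>2" using sum_squares_bound[of F "N s"] by simp
      moreover have "(1 + (N s)\<^sup>2) * (N s)\<^sup>2 = (N s)\<^sup>2 + N s ^ 4" by (simp add: distrib_right flip: power_add)
      \<comment> \<open>The definition of \<open>\<beta>\<close> says exactly that
        \<open>c / lambda1 \<Omega> = 1 - \<beta>\<close>.\<close>
      moreover have "c * (l2norm \<Omega> (u s))\<^sup>2 \<le> (1 - \<beta>) * (N s)\<^sup>2"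
      proof -
        have "(c / lambda1 \<Omega>) * (lambda1 \<Omega> * (l2norm \<Omega> (u s))\<^sup>2) \<le> (c / lambda1 \<Omega>) * (N s)\<^sup>2"
          using lambda1_Poincare[OF \<Omega> elim(3)] c lam by (intro mult_left_mono) (auto simp: N_h10)
        then show ?thesis using lam assms(8) by (simp add: c_def)
      qed
      moreover have "(1 - \<beta>) * (N s)\<^sup>2 = (N s)\<^sup>2 - \<beta> * (N s)\<^sup>2" by (simp add: left_diff_distrib)
      ultimately have "c * (l2norm \<Omega> (u s))\<^sup>2 + 2 * ut s (u s) \<le> F\<^sup>2 - \<beta> * (N s)\<^sup>2 - 2 * N s ^ 4"
        by linarith
      then have "exp (c * s) * (c * (l2norm \<Omega> (u s))\<^sup>2 + 2 * ut s (u s)) \<le> exp (c * s) * (F\<^sup>2 - \<beta> * (N s)\<^sup>2 - 2 * N s ^ 4)"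
        by (rule mult_left_mono) simp
      then show ?case by (simp add: algebra_simps)
    qed
  qed
  define I2 where "I2 = (LINT s|?M. exp (c * s) * (N s)\<^sup>2)"
  define I4 where "I4 = (LINT s|?M. exp (c * s) * N s ^ 4)"
  have exp_int: "integrable ?M (\<lambda>s. exp (c * s))" by (rule integrable_continuous_Ioo(1)[OF exp_cont])
  have exp_integral: "(LINT s|?M. exp (c * s)) = (exp (c * t) - 1) / c"
  proof -
    have "((\<lambda>s. exp (c * s)) has_integral (exp (c * t) / c - exp (c * 0) / c)) {0..t}"
      using c assms(9)
      by (intro fundamental_theorem_of_calculus)
         (auto intro!: derivative_eq_intros simp: has_real_derivative_iff_has_vector_derivative[symmetric])
    then show ?thesis
      by (simp add: integrable_continuous_Ioo(2)[OF exp_cont] integral_unique diff_divide_distrib)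
  qed
  have "exp (c * t) * (l2norm \<Omega> (u t))\<^sup>2 - (l2norm \<Omega> (u 0))\<^sup>2
      \<le> (LINT s|?M. F\<^sup>2 * exp (c * s) - \<beta> * (exp (c * s) * (N s)\<^sup>2) - 2 * (exp (c * s) * N s ^ 4))"
  proof (rule order_trans[OF energy(2) integral_mono_AE[OF _ _ pointwise]])
    show "integrable ?M (\<lambda>s. exp (c * s) * (c * (l2norm \<Omega> (u s))\<^sup>2 + 2 * ut s (u s)))"
      by (intro weight Bochner_Integration.integrable_add integrable_mult_right E_int energy(1))
    show "integrable ?M (\<lambda>s. F\<^sup>2 * exp (c * s) - \<beta> * (exp (c * s) * (N s)\<^sup>2) - 2 * (exp (c * s) * N s ^ 4))"
      by (intro Bochner_Integration.integrable_diff integrable_mult_right exp_int weight N2 N4)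
  qed
  also have "\<dots> = F\<^sup>2 * ((exp (c * t) - 1) / c) - \<beta> * I2 - 2 * I4"
    using exp_int weight[OF N2] weight[OF N4] by (simp add: exp_integral I2_def I4_def)
  finally have ineq: "exp (c * t) * (l2norm \<Omega> (u t))\<^sup>2 - (l2norm \<Omega> (u 0))\<^sup>2
      \<le> F\<^sup>2 * ((exp (c * t) - 1) / c) - \<beta> * I2 - 2 * I4" .
  \<comment> \<open>The initial condition holds only almost everywhere, which suffices for equality
    of the norms.\<close>
  have u00: "l2norm \<Omega> (u 0) = l2norm \<Omega> u0"
    by (intro l2norm_cong_AE C_time_L2(1)[OF uC] assms(4) u_init) simp
  \<comment> \<open>Multiplication by \<open>q\<close> removes the weight at the final time and
    turns the integral of the weight into \<open>(1 - q) / c\<close>.\<close>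
  define q where "q = exp (- 2 * \<alpha> * t)"
  have q: "0 < q" "q \<le> 1" "q * exp (c * t) = 1"
    using assms(6,9) by (auto simp: q_def c_def mult_exp_exp)
  have "q * (exp (c * t) * (l2norm \<Omega> (u t))\<^sup>2 - (l2norm \<Omega> u0)\<^sup>2)
      \<le> q * (F\<^sup>2 * ((exp (c * t) - 1) / c) - \<beta> * I2 - 2 * I4)"
    using ineq q(1) unfolding u00 by (intro mult_left_mono) auto
  moreover have "q * (exp (c * t) * (l2norm \<Omega> (u t))\<^sup>2 - (l2norm \<Omega> u0)\<^sup>2)
      = (q * exp (c * t)) * (l2norm \<Omega> (u t))\<^sup>2 - q * (l2norm \<Omega> u0)\<^sup>2"
    by (simp only: right_diff_distrib mult.assoc)
  moreover have "q * (F\<^sup>2 * ((exp (c * t) - 1) / c) - \<beta> * I2 - 2 * I4)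
      = 1 / c * F\<^sup>2 * (q * exp (c * t) - q) - \<beta> * q * I2 - 2 * q * I4"
    using c by (simp add: field_simps)
  ultimately have first: "(l2norm \<Omega> (u t))\<^sup>2 + \<beta> * q * I2 + 2 * q * I4
      \<le> q * (l2norm \<Omega> u0)\<^sup>2 + 1 / c * F\<^sup>2 * (1 - q)"
    unfolding q(3) by simp
  have "q * (l2norm \<Omega> u0)\<^sup>2 \<le> 1 * (l2norm \<Omega> u0)\<^sup>2" "1 / c * F\<^sup>2 * (1 - q) \<le> 1 / c * F\<^sup>2 * 1"
    using q(1,2) c by (intro mult_right_mono mult_left_mono; simp)+
  then have second: "q * (l2norm \<Omega> u0)\<^sup>2 + 1 / c * F\<^sup>2 * (1 - q) \<le> (l2norm \<Omega> u0)\<^sup>2 + 1 / c * F\<^sup>2"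
    by simp
  have "(LINT s:{0..t}|lebesgue. exp (2 * \<alpha> * s) * (l2norm \<Omega> (grad \<Omega> (u s)))\<^sup>2) = I2"
    "(LINT s:{0..t}|lebesgue. exp (2 * \<alpha> * s) * (l2norm \<Omega> (grad \<Omega> (u s))) ^ 4) = I4"
    using set_integral_Icc_eq_Ioo[OF weight[OF N2]] set_integral_Icc_eq_Ioo[OF weight[OF N4]]
    by (simp_all add: I2_def I4_def N_def c_def)
  then show ?thesis using \<beta> first second by (simp add: q_def F_def c_def)
qed

end
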